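(* Let $\ell\ge 0$ be an integer, $\boldsymbol{\alpha}\in\mathbb{R}^{2\ell+1}$ and $\Re(s)>0$. Then \[ \det(\Delta_{2\ell+1,\boldsymbol{\alpha}}+s^2)=\operatorname*{\coprod\!\!\prod}_{\mathbf{m}\in\mathbb{Z}^{2\ell+1}}\bigl(|\mathbf{m}+\boldsymbol{\alpha}|^2+s^2\bigr) \cong_{2\ell} \exp\Biggl(-\frac{(-2\pi)^{\ell+1}}{(2\ell+1)!!}s^{2\ell+1}-\sum_{\mathbf{n}\in\mathbb{Z}^{2\ell+1}\setminus\{\mathbf{0}\}}\frac{1}{|\mathbf{n}|^{\ell+1}}\sum_{k=0}^{\ell}\frac{c^{(\ell)}_k}{(2\pi|\mathbf{n}|)^k}s^{\ell-k}e^{2\pi i\mathbf{n}\boldsymbol{\alpha}}e^{-2\pi|\mathbf{n}|s}\Biggr), \] where $c^{(\ell)}_0=1$ and, for $1\le k\le\ell$, $c^{(\ell)}_k=\frac{1}{2^k k!}\prod_{j=1-k}^{k}(\ell+j)$. Moreover, for $\ell=0$ (i.e. $\nu=1$, $\alpha\in\mathbb{R}$) one has the exact identity \[ \operatorname*{\coprod\!\!\prod}_{m=-\infty}^{\infty}\bigl((m+\alpha)^2+s^2\bigr)=\exp\Bigl(2\pi s-2\sum_{n=1}^{\infty}\frac{\cos(2\pi n\alpha)}{n}e^{-2\pi ns}\Bigr)=e^{2\pi s}(1-e^{2\pi i\alpha}e^{-2\pi s})(1-e^{-2\pi i\alpha}e^{-2\pi s}). \]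
   Context: For $\mathbf{x},\mathbf{y}\in\mathbb{R}^{\nu}$, $\mathbf{x}\mathbf{y}=\sum_j x_jy_j$ and $|\mathbf{x}|$ is the Euclidean norm. Zeta-regularized product: for a sequence $(a_n)$ of complex numbers not in $(-\infty,0]$, if $\sum_n a_n^{-w}$ (principal branch) converges absolutely for $\Re(w)\gg1$ and continues holomorphically to a neighbourhood of $w=0$, then $\operatorname*{\coprod\!\!\prod}_n a_n:=\exp\bigl(-\frac{d}{dw}\sum_n a_n^{-w}\big|_{w=0}\bigr)$. $\Delta_{\nu,\boldsymbol{\alpha}}=-\frac{1}{4\pi^2}\sum_{j=1}^\nu\partial^2/\partial x_j^2$ acting on sections of the line bundle over $\mathbb{R}^\nu/\mathbb{Z}^\nu$ given by the character $\mathbf{n}\mapsto e^{2\pi i\mathbf{n}\boldsymbol{\alpha}}$; its eigenvalues are $|\mathbf{m}+\boldsymbol{\alpha}|^2$, $\mathbf{m}\in\mathbb{Z}^\nu$, and $\det(\Delta_{\nu,\boldsymbol{\alpha}}+s^2)$ is defined as the zeta-regularized product displayed in the claim. For two functions, $Z_1(s)\cong_k Z_2(s)$ means there is a polynomial $P(s)$ of degree at most $k$ with $Z_1(s)=Z_2(s)e^{P(s)}$. $(2\ell+1)!!=1\cdot3\cdots(2\ell+1)$. *)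

theory Defs
  imports "HOL-Analysis.Analysis" "HOL-Computational_Algebra.Polynomial"
begin

definition zeta_cont :: "'i set \<Rightarrow> ('i \<Rightarrow> complex) \<Rightarrow> (complex \<Rightarrow> complex) \<Rightarrow> bool" where
  "zeta_cont A a Z \<longleftrightarrow>
     (\<exists>S \<sigma>::real. open S \<and> connected S \<and> 0 \<in> S \<and> {w. Re w > \<sigma>} \<subseteq> S \<and>
        Z holomorphic_on S \<and>
        (\<forall>w. Re w > \<sigma> \<longrightarrow> (\<lambda>n. norm (a n powr (-w))) summable_on A \<and>
                         Z w = (\<Sum>\<^sub>\<infinity>n\<in>A. a n powr (-w))))"

definition zeta_regularizable :: "'i set \<Rightarrow> ('i \<Rightarrow> complex) \<Rightarrow> bool" where
  "zeta_regularizable A a \<longleftrightarrow>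
     (\<forall>n\<in>A. a n \<notin> complex_of_real ` {..0}) \<and>
     (\<exists>Z. zeta_cont A a Z) \<and>
     (\<forall>Z1 Z2. zeta_cont A a Z1 \<longrightarrow> zeta_cont A a Z2 \<longrightarrow> deriv Z1 0 = deriv Z2 0)"

definition zeta_reg_prod :: "'i set \<Rightarrow> ('i \<Rightarrow> complex) \<Rightarrow> complex" where
  "zeta_reg_prod A a = exp (- deriv (SOME Z. zeta_cont A a Z) 0)"

text \<open>Vectors of R^nu / Z^nu are represented as functions on nat; only the
  coordinates j < nu are used. The lattice Z^nu is the set of integer vectors
  vanishing outside {..<nu}.\<close>

definition lattice :: "nat \<Rightarrow> (nat \<Rightarrow> int) set" where
  "lattice \<nu> = {m. \<forall>j\<ge>\<nu>. m j = 0}"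

definition sqnorm_shift :: "nat \<Rightarrow> (nat \<Rightarrow> int) \<Rightarrow> (nat \<Rightarrow> real) \<Rightarrow> real" where
  "sqnorm_shift \<nu> m \<alpha> = (\<Sum>j<\<nu>. (real_of_int (m j) + \<alpha> j)\<^sup>2)"

definition lnorm :: "nat \<Rightarrow> (nat \<Rightarrow> int) \<Rightarrow> real" where
  "lnorm \<nu> n = sqrt (\<Sum>j<\<nu>. (real_of_int (n j))\<^sup>2)"

definition ldot :: "nat \<Rightarrow> (nat \<Rightarrow> int) \<Rightarrow> (nat \<Rightarrow> real) \<Rightarrow> real" where
  "ldot \<nu> n \<alpha> = (\<Sum>j<\<nu>. real_of_int (n j) * \<alpha> j)"

definition det_lap :: "nat \<Rightarrow> (nat \<Rightarrow> real) \<Rightarrow> complex \<Rightarrow> complex" where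
  "det_lap \<nu> \<alpha> s = zeta_reg_prod (lattice \<nu>) (\<lambda>m. complex_of_real (sqnorm_shift \<nu> m \<alpha>) + s\<^sup>2)"

definition odd_dfact :: "nat \<Rightarrow> real" where
  "odd_dfact l = (\<Prod>j\<le>l. real (2*j+1))"

definition cco :: "nat \<Rightarrow> nat \<Rightarrow> real" where
  "cco l k = (if k = 0 then 1 else
     (\<Prod>j\<in>{1 - int k..int k}. real_of_int (int l + j)) / (2 ^ k * fact k))"

definition equiv_upto :: "nat \<Rightarrow> (complex \<Rightarrow> complex) \<Rightarrow> (complex \<Rightarrow> complex) \<Rightarrow> bool" where
  "equiv_upto k Z1 Z2 \<longleftrightarrow>
     (\<exists>P :: complex poly. degree P \<le> k \<and>
        (\<forall>s. Re s > 0 \<longrightarrow> Z1 s = Z2 s * exp (poly P s)))"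

end

theory Submission
  imports Defs "HOL-Probability.Probability" "HOL-Complex_Analysis.Complex_Analysis"
    "HOL-Real_Asymp.Real_Asymp"
begin

text \<open>For \<open>Re w\<close> large, the Mellin transform along the ray through \<open>1 / s\<close> and the (complex) theta
  inversion formula, which is a product of one-dimensional Poisson summations of Gaussians, give
  \<open>\<Sum> (|m + \<alpha>|\<^sup>2 + s\<^sup>2) powr (- w) = H w / Gamma w\<close>. Here \<open>H\<close> is the sum of the \<open>n = 0\<close> term
  \<open>\<pi>\<^bsup>\<nu>/2\<^esup> Gamma (w - \<nu>/2) s\<^bsup>\<nu>-2w\<^esup>\<close> of the dual series and of a sum over \<open>n \<noteq> 0\<close> of
  Bessel-type integrals, which is entire in \<open>w\<close>. For odd \<open>\<nu>\<close> the function \<open>H\<close> is holomorphic at 0, so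
  the derivative of \<open>H / Gamma\<close> at 0 is \<open>H 0\<close>; there the Bessel functions have half-integral order and are
  elementary. In particular the polynomial in the relation \<open>\<cong>\<close> can be taken to be 0.\<close>

section \<open>Parametric integrals\<close>

text \<open>With t = exp v all Mellin integrals run over the whole line: scaling of t becomes
  translation of v, and t -> 1/t becomes reflection, the symmetry of the Bessel functions in their
  order. The complex ray needs no contour rotation, since formulas with a complex parameter follow
  from the real ones by the identity theorem. The parity of \<nu> enters through Gamma (w -
  \<nu>/2), whose poles \<nu>/2 - k avoid 0 for odd \<nu> and hit it for even \<nu>. As 1/Gamma
  vanishes at 0 with derivative 1, no derivative of a Bessel function with respect to its order ever
  occurs. A second obstacle lies in the definition of the regularized product, which picks some
  continuation on some connected domain: its derivative at 0 must be shown to be independent of the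
  choice. The constant (-2 pi)^(l+1) / (2l+1)!! is pi^(\<nu>/2) Gamma (-\<nu>/2), and the numbers
  \<open>cco l k\<close> are the coefficients of the Bessel polynomials.\<close>

lemma holomorphic_on_integral:
  fixes f :: "complex \<Rightarrow> 'a \<Rightarrow> complex"
  assumes "open S"
    and meas: "\<And>z. z \<in> S \<Longrightarrow> f z \<in> borel_measurable M"
    and hol: "\<And>x. x \<in> space M \<Longrightarrow> (\<lambda>z. f z x) holomorphic_on S"
    and dom: "\<And>z0. z0 \<in> S \<Longrightarrow> \<exists>r>0. \<exists>g. integrable M g \<and> cball z0 r \<subseteq> S \<and>
                 (\<forall>z\<in>cball z0 r. \<forall>x\<in>space M. norm (f z x) \<le> g x)"
  shows "(\<lambda>z. \<integral>x. f z x \<partial>M) holomorphic_on S"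
  unfolding holomorphic_on_open[OF \<open>open S\<close>]
proof
  fix z0 assume "z0 \<in> S"
  from dom[OF this] obtain r g where r: "r > 0" and g[measurable]: "integrable M g" and sub: "cball z0 r \<subseteq> S"
    and bd: "\<And>z x. z \<in> cball z0 r \<Longrightarrow> x \<in> space M \<Longrightarrow> norm (f z x) \<le> g x"
    by blast
  have int: "integrable M (f z)" if "z \<in> cball z0 r" for z
    by (rule Bochner_Integration.integrable_bound[OF g]) (use that sub bd meas in \<open>auto intro!: AE_I2 order_trans[OF _ abs_ge_self]\<close>)
  define D where "D = (\<lambda>x. deriv (\<lambda>z. f z x) z0)"
  \<comment> \<open>Only \<open>f\<close> is dominated by hypothesis, not its derivative. A disc of
    radius r/2 about a point of \<open>ball z0 (r/2)\<close> stays inside \<open>cball z0 r\<close>,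
    so Cauchy's inequality bounds the derivative by 2 g / r. By the mean value inequality the same
    function dominates the difference quotients.\<close>
  have dbd: "norm (deriv (\<lambda>z. f z x) \<xi>) \<le> g x / (r/2)" if "\<xi> \<in> ball z0 (r/2)" "x \<in> space M" for \<xi> x
  proof -
    have sub': "cball \<xi> (r/2) \<subseteq> cball z0 r"
      unfolding cball_subset_cball_iff using that by (auto simp: dist_commute)
    have "norm ((deriv ^^ 1) (\<lambda>z. f z x) \<xi>) \<le> fact 1 * g x / (r/2)^1"
    proof (rule Cauchy_inequality)
      show "(\<lambda>z. f z x) holomorphic_on ball \<xi> (r/2)"
        by (rule holomorphic_on_subset[OF hol[OF that(2)]]) (use sub sub' in force)
      show "continuous_on (cball \<xi> (r/2)) (\<lambda>z. f z x)"
        by (rule holomorphic_on_imp_continuous_on, rule holomorphic_on_subset[OF hol[OF that(2)]]) (use sub sub' in force)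
      show "norm (f y x) \<le> g x" if "norm (\<xi> - y) = r/2" for y
        by (rule bd) (use sub' that \<open>x \<in> space M\<close> in \<open>auto simp: dist_norm\<close>)
    qed (use r in auto)
    thus ?thesis by simp
  qed
  have lip: "norm (f z x - f z0 x) \<le> g x / (r/2) * norm (z - z0)" if "z \<in> ball z0 (r/2)" "x \<in> space M" for z x
  proof (rule field_differentiable_bound[where S = "ball z0 (r/2)"])
    show "((\<lambda>z. f z x) has_field_derivative deriv (\<lambda>z. f z x) \<xi>) (at \<xi> within ball z0 (r/2))"
      if "\<xi> \<in> ball z0 (r/2)" for \<xi>
    proof -
      have "\<xi> \<in> S" using that sub r by (auto simp: subset_eq)
      thus ?thesis
        by (metis DERIV_subset \<open>open S\<close> \<open>x \<in> space M\<close> hol holomorphic_derivI subset_UNIV)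
    qed
  next
    show "norm (deriv (\<lambda>z. f z x) \<xi>) \<le> g x / (r/2)" if "\<xi> \<in> ball z0 (r/2)" for \<xi>
      by (rule dbd[OF that \<open>x \<in> space M\<close>])
  qed (insert that(1) r, auto simp: dist_commute)
  show "\<exists>f'. ((\<lambda>z. \<integral>x. f z x \<partial>M) has_field_derivative f') (at z0)"
  proof
    show "((\<lambda>z. \<integral>x. f z x \<partial>M) has_field_derivative (\<integral>x. D x \<partial>M)) (at z0)"
      unfolding DERIV_def tendsto_at_iff_sequentially
    proof (intro allI impI)
      fix X :: "nat \<Rightarrow> complex"
      assume X: "\<forall>i. X i \<in> UNIV - {0}" "X \<longlonglongrightarrow> 0"
      from X(2) have "eventually (\<lambda>n. norm (X n) < r/2) sequentially"
        using r order_tendstoD(2)[OF tendsto_norm_zero[OF X(2)], of "r/2"] by simp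
      then obtain N where N: "\<And>n. n \<ge> N \<Longrightarrow> norm (X n) < r/2"
        unfolding eventually_sequentially by blast
      define Y where "Y = (\<lambda>n. X (n + N))"
      have Y: "Y n \<noteq> 0" "norm (Y n) < r/2" for n using X N by (auto simp: Y_def)
      have Yin: "z0 + Y n \<in> ball z0 (r/2)" "z0 + Y n \<in> cball z0 r" for n
        using Y(2)[of n] r by (auto simp: dist_norm)
      have Y0: "Y \<longlonglongrightarrow> 0" unfolding Y_def by (rule LIMSEQ_ignore_initial_segment[OF X(2)])
      have lim: "(\<lambda>n. (f (z0 + Y n) x - f z0 x) / Y n) \<longlonglongrightarrow> D x" if "x \<in> space M" for x
      proof -
        have "((\<lambda>z. f z x) has_field_derivative D x) (at z0)"
          unfolding D_def by (rule holomorphic_derivI[OF hol[OF that] \<open>open S\<close> \<open>z0 \<in> S\<close>])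
        thus ?thesis unfolding DERIV_def tendsto_at_iff_sequentially using Y0 Y(1) by (auto simp: o_def)
      qed
      have ms: "(\<lambda>x. (f (z0 + Y n) x - f z0 x) / Y n) \<in> borel_measurable M" for n
        using Yin(2)[of n] sub \<open>z0 \<in> S\<close> by (intro borel_measurable_divide borel_measurable_diff meas) auto
      have "(\<lambda>n. \<integral>x. (f (z0 + Y n) x - f z0 x) / Y n \<partial>M) \<longlonglongrightarrow> (\<integral>x. D x \<partial>M)"
      proof (rule integral_dominated_convergence)
        show "D \<in> borel_measurable M"
          by (rule borel_measurable_LIMSEQ_metric[OF ms lim])
        show "integrable M (\<lambda>x. g x / (r/2))" using g by auto
        show "AE x in M. (\<lambda>n. (f (z0 + Y n) x - f z0 x) / Y n) \<longlonglongrightarrow> D x"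
          using lim by auto
        show "AE x in M. norm ((f (z0 + Y n) x - f z0 x) / Y n) \<le> g x / (r/2)" for n
          using lip[OF Yin(1)[of n]] Y(1)[of n] r by (intro AE_I2) (simp add: norm_divide field_simps)
      qed (use ms in auto)
      also have "(\<lambda>n. \<integral>x. (f (z0 + Y n) x - f z0 x) / Y n \<partial>M) =
                 (\<lambda>n. ((\<integral>x. f (z0 + Y n) x \<partial>M) - (\<integral>x. f z0 x \<partial>M)) / Y n)"
        using int Yin r by (simp add: Bochner_Integration.integral_diff)
      finally show "((\<lambda>h. ((\<integral>x. f (z0 + h) x \<partial>M) - (\<integral>x. f z0 x \<partial>M)) / h) \<circ> X) \<longlonglongrightarrow> (\<integral>x. D x \<partial>M)"
        by - (rule LIMSEQ_offset[where k = N], simp add: o_def Y_def)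
    qed
  qed
qed

text \<open>An enumeration of the index set reduces unordered sums to the theorem on term-by-term
  integration of series. Pointwise summability is assumed at every point, so that ordered and
  unordered sums agree on the whole space.\<close>

lemma
  fixes f :: "'i \<Rightarrow> 'a \<Rightarrow> 'b :: {banach, second_countable_topology}"
  assumes "countable A"
    and int: "\<And>n. n \<in> A \<Longrightarrow> integrable M (f n)"
    and pointwise: "\<And>x. x \<in> space M \<Longrightarrow> (\<lambda>n. norm (f n x)) summable_on A"
    and sums: "(\<lambda>n. \<integral>x. norm (f n x) \<partial>M) summable_on A"
  shows integrable_infsum: "integrable M (\<lambda>x. \<Sum>\<^sub>\<infinity>n\<in>A. f n x)"
    and integral_infsum: "(\<integral>x. (\<Sum>\<^sub>\<infinity>n\<in>A. f n x) \<partial>M) = (\<Sum>\<^sub>\<infinity>n\<in>A. \<integral>x. f n x \<partial>M)"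
proof -
  have "integrable M (\<lambda>x. \<Sum>\<^sub>\<infinity>n\<in>A. f n x) \<and>
        (\<integral>x. (\<Sum>\<^sub>\<infinity>n\<in>A. f n x) \<partial>M) = (\<Sum>\<^sub>\<infinity>n\<in>A. \<integral>x. f n x \<partial>M)"
  proof (cases "finite A")
    case True
    thus ?thesis using int by simp
  next
    case False
    with \<open>countable A\<close> have bij: "bij_betw (from_nat_into A) UNIV A"
      by (simp add: bij_betw_from_nat_into)
    define h where "h = from_nat_into A"
    note bij = bij[folded h_def]
    have hA: "h k \<in> A" for k using bij by (auto simp: bij_betw_def)
    have re: "(\<Sum>\<^sub>\<infinity>n\<in>A. F n) = (\<Sum>k. F (h k))" if "(\<lambda>n. norm (F n)) summable_on A" for F :: "'i \<Rightarrow> 'b"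
    proof -
      have "(\<lambda>k. norm (F (h k))) summable_on UNIV"
        using summable_on_reindex_bij_betw[OF bij, of "\<lambda>n. norm (F n)"] that by simp
      hence "(\<lambda>k. F (h k)) sums infsum (\<lambda>k. F (h k)) UNIV"
        by (rule has_sum_imp_sums[OF has_sum_infsum[OF abs_summable_summable]])
      thus ?thesis using infsum_reindex_bij_betw[OF bij, of F] by (simp add: sums_iff)
    qed
    have s1: "summable (\<lambda>k. norm (f (h k) x))" if "x \<in> space M" for x
      using summable_on_reindex_bij_betw[OF bij, of "\<lambda>n. norm (f n x)"] pointwise[OF that]
      by (simp add: summable_on_UNIV_nonneg_real_iff)
    have s2: "summable (\<lambda>k. \<integral>x. norm (f (h k) x) \<partial>M)"
      using summable_on_reindex_bij_betw[OF bij, of "\<lambda>n. \<integral>x. norm (f n x) \<partial>M"] sums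
      by (simp add: summable_on_UNIV_nonneg_real_iff)
    have s3: "(\<lambda>n. norm (\<integral>x. f n x \<partial>M)) summable_on A"
      by (rule summable_on_comparison_test[OF sums]) auto
    have i: "integrable M (\<lambda>x. \<Sum>k. f (h k) x)"
      by (rule integrable_suminf) (use int hA s1 s2 in auto)
    have j: "(\<integral>x. (\<Sum>k. f (h k) x) \<partial>M) = (\<Sum>k. \<integral>x. f (h k) x \<partial>M)"
      by (rule integral_suminf) (use int hA s1 s2 in auto)
    have eq: "(\<Sum>\<^sub>\<infinity>n\<in>A. f n x) = (\<Sum>k. f (h k) x)" if "x \<in> space M" for x
      by (rule re) (rule pointwise[OF that])
    show ?thesis
      using i j eq by (simp add: re[OF s3] cong: Bochner_Integration.integrable_cong Bochner_Integration.integral_cong)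
  qed
  thus "integrable M (\<lambda>x. \<Sum>\<^sub>\<infinity>n\<in>A. f n x)"
    and "(\<integral>x. (\<Sum>\<^sub>\<infinity>n\<in>A. f n x) \<partial>M) = (\<Sum>\<^sub>\<infinity>n\<in>A. \<integral>x. f n x \<partial>M)" by auto
qed

text \<open>The identity theorem, applied to the positive axis, which accumulates at 1. It carries
  the Gamma and Gaussian integrals from real to complex parameters.\<close>

lemma holomorphic_right_half_plane_eqI:
  assumes "f holomorphic_on {z. Re z > 0}" "g holomorphic_on {z. Re z > 0}"
    and eq: "\<And>x. x > 0 \<Longrightarrow> f (of_real x) = g (of_real x)" and "Re z > 0"
  shows "f z = g z"
proof -
  have "f z - g z = 0"
  proof (rule analytic_continuation[where f = "\<lambda>z. f z - g z" and S = "{z. Re z > 0}" and U = "complex_of_real ` {0<..}" and \<xi> = 1])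
    show "(\<lambda>z. f z - g z) holomorphic_on {z. Re z > 0}" using assms by (intro holomorphic_intros)
    show "open {z::complex. Re z > 0}" by (simp add: open_halfspace_Re_gt)
    show "connected {z::complex. Re z > 0}" by (simp add: convex_connected convex_halfspace_Re_gt)
    show "1 islimpt complex_of_real ` {0<..}"
      unfolding islimpt_approachable
    proof (intro allI impI)
      fix e :: real assume "e > 0"
      hence "1 + e/2 \<in> {0<..}" "complex_of_real (1 + e/2) \<noteq> 1" "dist (complex_of_real (1 + e/2)) 1 < e"
        by (auto simp: dist_norm)
      thus "\<exists>x'\<in>complex_of_real ` {0<..}. x' \<noteq> 1 \<and> dist x' 1 < e" by blast
    qed
  qed (use assms in auto)
  thus ?thesis by simp
qed

section \<open>Gamma and Gaussian integrals\<close>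

text \<open>Euler's integral after the substitution t = exp v. This integrand is the majorant in
  nearly every later domination argument.\<close>

lemma integrable_exp_gamma:
  fixes p x :: real
  assumes "p > 0" "x > 0"
  shows "integrable lborel (\<lambda>v. exp (p * v - x * exp v))"
proof -
  have "(\<lambda>t. complex_of_real t powr (of_real p - 1) / of_real (exp (x * t))) absolutely_integrable_on {0<..}"
    by (rule absolutely_integrable_Gamma_integral) (use assms in auto)
  hence "set_integrable lebesgue {0<..} (\<lambda>t. norm (complex_of_real t powr (of_real p - 1) / of_real (exp (x * t))))"
    by (rule set_integrable_norm)
  hence "integrable lebesgue (\<lambda>t. indicator {0<..} t *\<^sub>R (exp (p * ln t - x * exp (ln t)) * (1 / t)))"
    unfolding set_integrable_def
  proof (rule Bochner_Integration.integrable_cong[THEN iffD1, rotated -1], goal_cases)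
    case (2 t)
    thus ?case
      by (cases "t > 0") (auto simp: norm_divide norm_mult norm_powr_real_powr powr_def exp_diff algebra_simps exp_minus divide_simps)
  qed auto
  hence "set_integrable lborel (einterval 0 \<infinity>) (\<lambda>t. exp (p * ln t - x * exp (ln t)) * (1 / t))"
    unfolding set_integrable_def einterval_def by (subst (asm) integrable_completion) (auto simp: greaterThan_def zero_ereal_def)
  hence "set_integrable lborel (einterval (-\<infinity>) \<infinity>) (\<lambda>v. exp (p * v - x * exp v))"
  proof (rule interval_integral_substitution_nonneg[rotated -1])
    show "((ereal \<circ> ln \<circ> real_of_ereal) \<longlongrightarrow> -\<infinity>) (at_right 0)"
      unfolding zero_ereal_def by (simp add: ereal_tendsto_simps ln_at_0)
    show "((ereal \<circ> ln \<circ> real_of_ereal) \<longlongrightarrow> \<infinity>) (at_left \<infinity>)"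
      by (simp add: ereal_tendsto_simps ln_at_top)
  qed (auto intro!: derivative_eq_intros continuous_intros simp: zero_ereal_def)
  thus ?thesis by (simp add: set_integrable_def)
qed

lemma integrable_cexp_gamma:
  assumes "Re w > 0" "Re b > 0"
  shows "integrable lborel (\<lambda>v::real. exp (w * of_real v - b * of_real (exp v)))"
proof (rule Bochner_Integration.integrable_bound[OF integrable_exp_gamma[OF assms]])
  show "(\<lambda>v::real. exp (w * of_real v - b * of_real (exp v))) \<in> borel_measurable lborel"
    by (simp add: borel_measurable_continuous_onI continuous_intros)
qed (simp add: norm_exp_eq_Re)

text \<open>For real b > 0, translating v by - ln b splits off the factor b powr (- w) from the
  integral at b = 1. Both sides are holomorphic in b on the right half plane, where the principal
  logarithm is holomorphic.\<close>

lemma Gamma_integral_exp: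
  assumes w: "Re w > 0" and b: "Re b > 0"
  shows "(\<integral>v. exp (w * of_real v - b * of_real (exp v)) \<partial>lborel) = Gamma w * exp (- w * Ln b)"
proof -
  let ?f = "\<lambda>v::real. exp (w * of_real v - of_real (exp v)) :: complex"
  have one: "(\<integral>v. ?f v \<partial>lborel) = Gamma w"
  proof -
    have "(\<lambda>t. complex_of_real t powr (w - 1) / of_real (exp t)) absolutely_integrable_on {0<..}"
      by (rule absolutely_integrable_Gamma_integral'[OF w])
    hence "integrable lebesgue (\<lambda>t. indicator {0<..} t *\<^sub>R ((1 / t) *\<^sub>R ?f (ln t)))"
      unfolding set_integrable_def
    proof (rule Bochner_Integration.integrable_cong[THEN iffD1, rotated -1], goal_cases)
      case (2 t)
      thus ?case
        by (cases "t > 0") (auto simp: powr_def exp_diff algebra_simps exp_minus divide_simps Ln_of_real exp_of_real scaleR_conv_of_real)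
    qed auto
    hence int: "set_integrable lborel (einterval 0 \<infinity>) (\<lambda>t. (1 / t) *\<^sub>R ?f (ln t))"
      unfolding set_integrable_def einterval_def by (subst (asm) integrable_completion) (auto simp: greaterThan_def zero_ereal_def)
    have "(\<integral>v. ?f v \<partial>lborel) = (LBINT v=-\<infinity>..\<infinity>. ?f v)"
      by (simp add: interval_lebesgue_integral_def set_lebesgue_integral_def einterval_def)
    also have "\<dots> = (LBINT t=0..\<infinity>. (1 / t) *\<^sub>R ?f (ln t))"
    proof (rule interval_integral_substitution_integrable)
      show "((ereal \<circ> ln \<circ> real_of_ereal) \<longlongrightarrow> -\<infinity>) (at_right 0)"
        unfolding zero_ereal_def by (simp add: ereal_tendsto_simps ln_at_0)
      show "((ereal \<circ> ln \<circ> real_of_ereal) \<longlongrightarrow> \<infinity>) (at_left \<infinity>)"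
        by (simp add: ereal_tendsto_simps ln_at_top)
      show "set_integrable lborel (einterval (- \<infinity>) \<infinity>) ?f"
        using integrable_cexp_gamma[OF w, of 1] by (simp add: set_integrable_def)
      show "set_integrable lborel (einterval 0 \<infinity>) (\<lambda>t. (1 / t) *\<^sub>R ?f (ln t))" by (rule int)
    qed (auto intro!: derivative_eq_intros continuous_intros simp: zero_ereal_def)
    also have "\<dots> = (LINT t:{0<..}|lborel. (1 / t) *\<^sub>R ?f (ln t))"
      by (simp add: interval_lebesgue_integral_def einterval_def zero_ereal_def greaterThan_def)
    also have "\<dots> = integral {0<..} (\<lambda>t. (1 / t) *\<^sub>R ?f (ln t))"
      using int by (intro set_borel_integral_eq_integral) (simp add: einterval_def zero_ereal_def greaterThan_def)
    also have "\<dots> = integral {0<..} (\<lambda>t. complex_of_real t powr (w - 1) / of_real (exp t))"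
      by (intro integral_cong) (auto simp: powr_def exp_diff algebra_simps exp_minus divide_simps Ln_of_real exp_of_real scaleR_conv_of_real)
    also have "\<dots> = Gamma w" using Gamma_integral_complex'[OF w] by (rule integral_unique)
    finally show ?thesis .
  qed
  show ?thesis
  proof (rule holomorphic_right_half_plane_eqI[OF _ _ _ b])
    show "(\<lambda>b. \<integral>v. exp (w * of_real v - b * of_real (exp v)) \<partial>lborel) holomorphic_on {z. Re z > 0}"
    proof (rule holomorphic_on_integral)
      show "open {z::complex. Re z > 0}" by (simp add: open_halfspace_Re_gt)
      show "(\<lambda>b. exp (w * of_real v - b * of_real (exp v))) holomorphic_on {z. 0 < Re z}" for v
        by (intro holomorphic_intros)
      show "(\<lambda>v. exp (w * of_real v - z * of_real (exp v))) \<in> borel_measurable lborel" for z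
        by (simp add: borel_measurable_continuous_onI continuous_intros)
    next
      fix z0 :: complex assume "z0 \<in> {z. Re z > 0}"
      hence z0: "Re z0 > 0" by simp
      \<comment> \<open>On the disc of radius Re z0 / 2 the rate keeps at least half of its real
        part, so one integrable function dominates for all of its points.\<close>
      have R: "Re z \<ge> Re z0 / 2" if "z \<in> cball z0 (Re z0 / 2)" for z
        using that abs_Re_le_cmod[of "z0 - z"] by (auto simp: dist_norm)
      show "\<exists>r>0. \<exists>g. integrable lborel g \<and> cball z0 r \<subseteq> {z. Re z > 0} \<and>
        (\<forall>z\<in>cball z0 r. \<forall>v\<in>space lborel. norm (exp (w * of_real v - z * of_real (exp v))) \<le> g v)"
      proof (intro exI[of _ "Re z0 / 2"] exI[of _ "\<lambda>v. exp (Re w * v - Re z0 / 2 * exp v)"] conjI ballI)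
        show "integrable lborel (\<lambda>v. exp (Re w * v - Re z0 / 2 * exp v))"
          by (rule integrable_exp_gamma) (use w z0 in auto)
        show "cball z0 (Re z0 / 2) \<subseteq> {z. Re z > 0}" using R z0 by force
        show "norm (exp (w * of_real v - z * of_real (exp v))) \<le> exp (Re w * v - Re z0 / 2 * exp v)"
          if "z \<in> cball z0 (Re z0 / 2)" for z v
          using R[OF that] by (simp add: norm_exp_eq_Re)
      qed (use z0 in auto)
    qed
    show "(\<lambda>b. Gamma w * exp (- w * Ln b)) holomorphic_on {z. Re z > 0}"
      by (intro holomorphic_intros) (auto simp: complex_nonpos_Reals_iff)
  next
    fix x :: real assume x: "x > 0"
    have "(\<integral>v. exp (w * of_real v - of_real x * of_real (exp v)) \<partial>lborel)
        = (\<integral>v. exp (- w * of_real (ln x)) * ?f v \<partial>lborel)"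
      by (subst lborel_integral_real_affine[where c = 1 and t = "- ln x"])
         (use x in \<open>auto simp: exp_diff exp_add exp_minus algebra_simps exp_of_real field_simps\<close>)
    thus "(\<integral>v. exp (w * of_real v - of_real x * of_real (exp v)) \<partial>lborel) = Gamma w * exp (- w * Ln (of_real x))"
      using x by (simp add: one Ln_of_real)
  qed
qed

lemma integrable_gaussian:
  assumes "a > 0"
  shows "integrable lborel (\<lambda>x::real. exp (- a * x\<^sup>2))"
proof -
  have "integrable lborel (\<lambda>x. sqrt (2 * pi * (sqrt (1 / (2*a)))\<^sup>2) * normal_density 0 (sqrt (1 / (2*a))) x)"
    using assms by (intro integrable_mult_right integrable_normal_density) auto
  also have "(\<lambda>x. sqrt (2 * pi * (sqrt (1 / (2*a)))\<^sup>2) * normal_density 0 (sqrt (1 / (2*a))) x) = (\<lambda>x. exp (- a * x\<^sup>2))"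
    using assms by (auto simp: normal_density_def fun_eq_iff field_simps)
  finally show ?thesis .
qed

lemma norm_gaussian_fourier:
  "norm (exp (- t * of_real (x\<^sup>2) + \<i> * of_real (y * x))) = exp (- Re t * x\<^sup>2)"
  by (simp add: norm_exp_eq_Re del: of_real_power of_real_mult)

lemma integrable_gaussian_fourier:
  assumes "Re t > 0"
  shows "integrable lborel (\<lambda>x::real. exp (- t * of_real (x\<^sup>2) + \<i> * of_real (y * x)))"
proof (rule Bochner_Integration.integrable_bound[OF integrable_gaussian[OF assms]])
  show "(\<lambda>x::real. exp (- t * of_real (x\<^sup>2) + \<i> * of_real (y * x))) \<in> borel_measurable lborel"
    by (simp add: borel_measurable_continuous_onI continuous_intros)
qed (simp only: norm_gaussian_fourier, simp)

text \<open>For real t this is the characteristic function of the standard normal distribution after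
  a rescaling. The right-hand side continues it holomorphically because pi / t stays in the right
  half plane, away from the cut of \<open>csqrt\<close>.\<close>

lemma gaussian_fourier:
  assumes t: "Re t > 0"
  shows "(\<integral>x. exp (- t * of_real (x\<^sup>2) + \<i> * of_real (y * x)) \<partial>lborel)
           = csqrt (of_real pi / t) * exp (- of_real (y\<^sup>2) / (4 * t))"
proof (rule holomorphic_right_half_plane_eqI[OF _ _ _ t])
  have Repos: "Re (of_real pi / z) > 0" if "Re z > 0" for z
    using that by (simp add: Re_divide complex_eq_iff zero_less_divide_iff sum_power2_gt_zero_iff)
  have ne: "z \<noteq> 0" if "Re z > 0" for z using that by auto
  show "(\<lambda>t. csqrt (of_real pi / t) * exp (- of_real (y\<^sup>2) / (4 * t))) holomorphic_on {z. Re z > 0}"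
    using Repos by (intro holomorphic_intros) (auto simp: ne complex_nonpos_Reals_iff not_le)
  show "(\<lambda>t. \<integral>x. exp (- t * of_real (x\<^sup>2) + \<i> * of_real (y * x)) \<partial>lborel) holomorphic_on {z. Re z > 0}"
  proof (rule holomorphic_on_integral)
    show "open {z::complex. Re z > 0}" by (simp add: open_halfspace_Re_gt)
    show "(\<lambda>t. exp (- t * of_real (x\<^sup>2) + \<i> * of_real (y * x))) holomorphic_on {z. 0 < Re z}" for x
      by (intro holomorphic_intros)
    show "(\<lambda>x. exp (- z * of_real (x\<^sup>2) + \<i> * of_real (y * x))) \<in> borel_measurable lborel" for z
      by (simp add: borel_measurable_continuous_onI continuous_intros)
  next
    fix z0 :: complex assume "z0 \<in> {z. Re z > 0}"
    hence z0: "Re z0 > 0" by simp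
    have R: "Re z \<ge> Re z0 / 2" if "z \<in> cball z0 (Re z0 / 2)" for z
      using that abs_Re_le_cmod[of "z0 - z"] by (auto simp: dist_norm)
    show "\<exists>r>0. \<exists>g. integrable lborel g \<and> cball z0 r \<subseteq> {z. Re z > 0} \<and>
      (\<forall>z\<in>cball z0 r. \<forall>x\<in>space lborel. norm (exp (- z * of_real (x\<^sup>2) + \<i> * of_real (y * x))) \<le> g x)"
    proof (intro exI[of _ "Re z0 / 2"] exI[of _ "\<lambda>x. exp (- (Re z0 / 2) * x\<^sup>2)"] conjI ballI)
      show "integrable lborel (\<lambda>x. exp (- (Re z0 / 2) * x\<^sup>2))"
        by (rule integrable_gaussian) (use z0 in auto)
      show "cball z0 (Re z0 / 2) \<subseteq> {z. Re z > 0}" using R z0 by force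
      show "norm (exp (- z * of_real (x\<^sup>2) + \<i> * of_real (y * x))) \<le> exp (- (Re z0 / 2) * x\<^sup>2)"
        if "z \<in> cball z0 (Re z0 / 2)" for z x
        unfolding norm_gaussian_fourier using mult_right_mono[OF R[OF that], of "x\<^sup>2"] by simp
    qed (use z0 in auto)
  qed
next
  fix a :: real assume a: "a > 0"
  \<comment> \<open>The scale is chosen so that a c^2 = 1/2, the exponent of the standard normal
    density.\<close>
  define c where "c = 1 / sqrt (2 * a)"
  have c: "c > 0" "a * c\<^sup>2 = 1/2" "c\<^sup>2 = 1 / (2 * a)" using a by (auto simp: c_def power_divide)
  have nd: "(\<integral>u. std_normal_density u *\<^sub>R exp (\<i> * of_real (\<tau> * u)) \<partial>lborel) = exp (- of_real (\<tau>\<^sup>2) / 2)" for \<tau>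
  proof -
    have "char std_normal_distribution \<tau> = (\<integral>u. std_normal_density u *\<^sub>R exp (\<i> * of_real (\<tau> * u)) \<partial>lborel)"
      unfolding char_def by (subst integral_density) auto
    thus ?thesis by (simp add: char_std_normal_distribution flip: exp_of_real)
  qed
  have "(\<integral>x. exp (- of_real a * of_real (x\<^sup>2) + \<i> * of_real (y * x)) \<partial>lborel)
      = c *\<^sub>R (\<integral>u. exp (- of_real a * of_real ((0 + c * u)\<^sup>2) + \<i> * of_real (y * (0 + c * u))) \<partial>lborel)"
    by (subst lborel_integral_real_affine[where c = c and t = 0]) (use c in auto)
  also have "(\<lambda>u. exp (- of_real a * of_real ((0 + c * u)\<^sup>2) + \<i> * of_real (y * (0 + c * u)))) =
             (\<lambda>u. of_real (sqrt (2 * pi)) * (std_normal_density u *\<^sub>R exp (\<i> * of_real ((y * c) * u))))"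
  proof
    fix u :: real
    have e: "- complex_of_real a * of_real ((0 + c * u)\<^sup>2) = of_real (- u\<^sup>2 / 2)"
      using c(2) by (simp add: power_mult_distrib mult.assoc[symmetric] flip: of_real_mult of_real_power of_real_minus)
    show "exp (- of_real a * of_real ((0 + c * u)\<^sup>2) + \<i> * of_real (y * (0 + c * u))) =
          of_real (sqrt (2 * pi)) * (std_normal_density u *\<^sub>R exp (\<i> * of_real ((y * c) * u)))"
      unfolding exp_add e exp_of_real std_normal_density_def scaleR_conv_of_real
      by (simp add: mult_ac flip: exp_of_real of_real_mult)
  qed
  also have "(\<integral>u. of_real (sqrt (2 * pi)) * (std_normal_density u *\<^sub>R exp (\<i> * of_real ((y * c) * u))) \<partial>lborel)
           = of_real (sqrt (2 * pi)) * exp (- of_real ((y * c)\<^sup>2) / 2)"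
    by (simp only: integral_mult_right_zero nd)
  also have "c *\<^sub>R (of_real (sqrt (2 * pi)) * exp (- of_real ((y * c)\<^sup>2) / 2))
       = csqrt (of_real pi / of_real a) * exp (- of_real (y\<^sup>2) / (4 * of_real a))"
  proof -
    have "c * sqrt (2 * pi) = sqrt (pi / a)" using a by (simp add: c_def real_sqrt_mult real_sqrt_divide field_simps)
    moreover have "csqrt (of_real pi / of_real a) = of_real (sqrt (pi / a))"
      using a by (simp add: csqrt_of_real_nonneg flip: of_real_divide)
    moreover have "- complex_of_real ((y * c)\<^sup>2) / 2 = - of_real (y\<^sup>2) / (4 * of_real a)"
    proof -
      have "(y * c)\<^sup>2 / 2 = y\<^sup>2 / (4 * a)" using c(3) by (simp add: power_mult_distrib)
      hence "complex_of_real (- ((y * c)\<^sup>2 / 2)) = of_real (- (y\<^sup>2 / (4 * a)))" by simp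
      thus ?thesis by simp
    qed
    ultimately show ?thesis by (simp add: scaleR_conv_of_real flip: of_real_mult)
  qed
  finally show "(\<integral>x. exp (- of_real a * of_real (x\<^sup>2) + \<i> * of_real (y * x)) \<partial>lborel)
      = csqrt (of_real pi / of_real a) * exp (- of_real (y\<^sup>2) / (4 * of_real a))" .
qed

section \<open>Poisson summation\<close>

lemma summable_on_int_inverse_square:
  fixes \<beta> :: real
  shows "(\<lambda>m::int. 1 / (1 + (real_of_int m + \<beta>)\<^sup>2)) summable_on UNIV"
proof -
  have "summable (\<lambda>n::nat. 1 / (1 + (real n)\<^sup>2))"
  proof (rule summable_comparison_test_ev)
    show "summable (\<lambda>n. inverse (of_nat n ^ 2 :: real))" by (rule inverse_power_summable) simp
    show "\<forall>\<^sub>F n in sequentially. norm (1 / (1 + (real n)\<^sup>2)) \<le> inverse (of_nat n ^ 2)"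
      using eventually_gt_at_top[of 0] by eventually_elim (auto simp: power2_eq_square inverse_eq_divide add_pos_pos intro!: divide_left_mono mult_pos_pos)
  qed
  hence nat: "(\<lambda>n::nat. 1 / (1 + (real n)\<^sup>2)) summable_on UNIV"
    by (subst summable_on_UNIV_nonneg_real_iff) auto
  have "(\<lambda>m::int. 1 / (1 + (real_of_int m)\<^sup>2)) summable_on range int"
    using nat by (subst summable_on_reindex) (auto simp: inj_def o_def)
  moreover have "(\<lambda>m::int. 1 / (1 + (real_of_int m)\<^sup>2)) summable_on range (\<lambda>n. - int n)"
    using nat by (subst summable_on_reindex) (auto simp: inj_def o_def)
  ultimately have "(\<lambda>m::int. 1 / (1 + (real_of_int m)\<^sup>2)) summable_on (range int \<union> range (\<lambda>n. - int n))"
    by (rule summable_on_union)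
  also have "range int \<union> range (\<lambda>n. - int n) = UNIV"
    by (metis (mono_tags, lifting) UNIV_eq_I UnI1 UnI2 int_cases2 rangeI)
  finally have *: "(\<lambda>m::int. 2 * (1 + \<beta>\<^sup>2) * (1 / (1 + (real_of_int m)\<^sup>2))) summable_on UNIV"
    by (rule summable_on_cmult_right)
  show ?thesis
  proof (rule summable_on_comparison_test[OF *])
    fix m :: int
    define q where "q = real_of_int m"
    \<comment> \<open>The difference of the two sides is (q + 2 \<beta>)^2.\<close>
    have "q\<^sup>2 \<le> 2 * (q + \<beta>)\<^sup>2 + 2 * \<beta>\<^sup>2"
      using zero_le_power2[of "q + 2 * \<beta>"] by (simp add: power2_eq_square algebra_simps)
    hence "1 + q\<^sup>2 \<le> 2 * (1 + \<beta>\<^sup>2) * (1 + (q + \<beta>)\<^sup>2)"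
      using mult_nonneg_nonneg[OF zero_le_power2[of \<beta>] zero_le_power2[of "q + \<beta>"]] unfolding distrib_left distrib_right by linarith
    hence "1 / (1 + (q + \<beta>)\<^sup>2) \<le> 2 * (1 + \<beta>\<^sup>2) * (1 / (1 + q\<^sup>2))"
      by (simp add: field_simps add_pos_nonneg)
    thus "1 / (1 + (real_of_int m + \<beta>)\<^sup>2) \<le> 2 * (1 + \<beta>\<^sup>2) * (1 / (1 + (real_of_int m)\<^sup>2))"
      by (simp add: q_def)
  qed auto
qed

section \<open>Fourier coefficients on one period\<close>

definition period_measure :: "real measure" where
  "period_measure = restrict_space lborel {-1/2..<1/2}"

lemma space_period: "space period_measure = {-1/2..<1/2}"
  by (simp add: period_measure_def space_restrict_space)

lemma finite_measure_period: "finite_measure period_measure"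
  by (rule finite_measureI) (simp add: period_measure_def space_restrict_space emeasure_restrict_space)

lemma measurable_period [measurable (raw)]:
  "f \<in> borel_measurable borel \<Longrightarrow> f \<in> borel_measurable period_measure"
  unfolding period_measure_def by (rule measurable_restrict_space1) simp

lemma integral_period:
  fixes f :: "real \<Rightarrow> 'a::{banach, second_countable_topology}"
  shows "(\<integral>x. f x \<partial>period_measure) = (\<integral>x. indicator {-1/2..<1/2} x *\<^sub>R f x \<partial>lborel)"
  unfolding period_measure_def by (subst integral_restrict_space) simp_all

lemma integrable_period_bounded:
  fixes f :: "real \<Rightarrow> complex"
  assumes "f \<in> borel_measurable period_measure" "\<And>x. x \<in> {-1/2..<1/2} \<Longrightarrow> norm (f x) \<le> B"
  shows "integrable period_measure f"
  by (rule finite_measure.integrable_const_bound[OF finite_measure_period, where B = B])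
     (use assms in \<open>auto intro!: AE_I2 simp: space_period\<close>)

definition fourier_char :: "int \<Rightarrow> real \<Rightarrow> complex" where
  "fourier_char n x = exp (\<i> * of_real (2 * pi * of_int n * x))"

lemma norm_fourier_char [simp]: "norm (fourier_char n x) = 1"
  unfolding fourier_char_def by (rule norm_exp_i_times)

lemma fourier_char_mult: "fourier_char m x * fourier_char n x = fourier_char (m + n) x"
  by (simp add: fourier_char_def algebra_simps flip: exp_add)

lemma fourier_char_add: "fourier_char n (x + y) = fourier_char n x * fourier_char n y"
  by (simp add: fourier_char_def algebra_simps flip: exp_add)

lemma fourier_char_0 [simp]: "fourier_char 0 x = 1" "fourier_char n 0 = 1"
  by (simp_all add: fourier_char_def)

lemma cnj_fourier_char: "cnj (fourier_char n x) = fourier_char (- n) x"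
  by (simp add: fourier_char_def exp_cnj)

lemma fourier_char_of_int [simp]: "fourier_char n (of_int m) = 1"
proof -
  have "\<i> * complex_of_real (2 * pi * of_int n * of_int m) = of_real (2 * of_int (n * m) * pi) * \<i>" by simp
  thus ?thesis unfolding fourier_char_def by (simp only: exp_integer_2pi[OF Ints_of_int])
qed

lemma continuous_fourier_char [continuous_intros]: "continuous_on A (fourier_char n)"
  unfolding fourier_char_def by (intro continuous_intros)

lemma measurable_fourier_char [measurable]: "fourier_char n \<in> borel_measurable borel"
  by (intro borel_measurable_continuous_onI continuous_intros)

lemma integral_fourier_char:
  "(\<integral>x. fourier_char n x \<partial>period_measure) = (if n = 0 then 1 else 0)"
proof -
  have eq: "(\<integral>x. fourier_char n x \<partial>period_measure) = (LBINT x=ereal(-1/2)..ereal(1/2). fourier_char n x)"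
    by (subst interval_integral_Ico) (auto simp: integral_period set_lebesgue_integral_def)
  show ?thesis
  proof (cases "n = 0")
    case True
    thus ?thesis unfolding integral_period by simp
  next
    case False
    have fc: "fourier_char n = (\<lambda>x. exp (\<i> * of_real (2 * pi * of_int n) * of_real x))"
      by (simp add: fourier_char_def fun_eq_iff mult.assoc)
    define F where "F = (\<lambda>x. fourier_char n x / (\<i> * of_real (2 * pi * of_int n)))"
    have ne: "\<i> * of_real (2 * pi * of_int n) \<noteq> 0" using False by simp
    have "(LBINT x=ereal(-1/2)..ereal(1/2). fourier_char n x) = F (1/2) - F (-1/2)"
    proof (rule interval_integral_FTC_finite)
      show "(F has_vector_derivative fourier_char n x) (at x within X)" for x X
      proof -
        have "((\<lambda>z. exp (\<i> * of_real (2 * pi * of_int n) * z) / (\<i> * of_real (2 * pi * of_int n))) has_field_derivative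
              exp (\<i> * of_real (2 * pi * of_int n) * of_real x)) (at (of_real x))"
          using ne by (auto intro!: derivative_eq_intros simp del: of_real_mult)
        from has_vector_derivative_real_field[OF this] show ?thesis
          unfolding F_def fc by (rule has_vector_derivative_at_within)
      qed
    qed (intro continuous_intros)
    also have "fourier_char n (1/2) = fourier_char n (-1/2)"
      using fourier_char_add[of n "-1/2" 1] fourier_char_of_int[of n 1] by simp
    hence "F (1/2) - F (-1/2) = 0" by (simp add: F_def)
    finally show ?thesis using eq False by simp
  qed
qed

text \<open>Expand the nonnegative integral of |h - p|^2, where \<open>p\<close> is the
  trigonometric polynomial with the coefficients \<open>c n\<close>, n in \<open>F\<close>. By
  orthonormality the integrals of h cnj p, p cnj h and p cnj p all equal the sum \<open>S\<close> of
  the |c n|^2.\<close>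

lemma bessel_inequality:
  fixes h :: "real \<Rightarrow> complex"
  assumes [measurable]: "h \<in> borel_measurable period_measure"
    and bd: "\<And>x. x \<in> {-1/2..<1/2} \<Longrightarrow> norm (h x) \<le> B"
    and "finite F"
  defines "c \<equiv> \<lambda>n. \<integral>x. h x * fourier_char (- n) x \<partial>period_measure"
  shows "(\<Sum>n\<in>F. (norm (c n))\<^sup>2) \<le> (\<integral>x. (norm (h x))\<^sup>2 \<partial>period_measure)"
proof -
  let ?M = period_measure
  define p where "p = (\<lambda>x. \<Sum>n\<in>F. c n * fourier_char n x)"
  have B: "B \<ge> 0" using bd[of 0] by (auto intro: order_trans[OF norm_ge_zero])
  have [measurable]: "p \<in> borel_measurable ?M" unfolding p_def by measurable
  have int_he: "integrable ?M (\<lambda>x. h x * fourier_char n x)" for n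
    by (rule integrable_period_bounded[where B = B]) (use bd in \<open>auto simp: norm_mult simp del: divide_minus_left\<close>)
  have int_e: "integrable ?M (fourier_char n)" for n
    by (rule integrable_period_bounded[where B = 1]) auto
  have cnjp: "cnj (p x) = (\<Sum>n\<in>F. cnj (c n) * fourier_char (- n) x)" for x
    by (simp add: p_def cnj_fourier_char)
  have hp: "h x * cnj (p x) = (\<Sum>n\<in>F. cnj (c n) * (h x * fourier_char (- n) x))" for x
    by (simp add: cnjp sum_distrib_left mult_ac)
  have pp: "p x * cnj (p x) = (\<Sum>n\<in>F. \<Sum>k\<in>F. c n * cnj (c k) * fourier_char (n - k) x)" for x
    unfolding cnjp unfolding p_def sum_product
    by (intro sum.cong refl) (metis fourier_char_mult mult.assoc mult.left_commute uminus_add_conv_diff add.commute)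
  have int_hp: "integrable ?M (\<lambda>x. h x * cnj (p x))"
    unfolding hp by (intro Bochner_Integration.integrable_sum integrable_mult_right int_he)
  have int_pp: "integrable ?M (\<lambda>x. p x * cnj (p x))"
    unfolding pp by (intro Bochner_Integration.integrable_sum integrable_mult_right int_e)
  have int_hh: "integrable ?M (\<lambda>x. h x * cnj (h x))"
  proof (rule integrable_period_bounded[where B = "B * B"])
    show "(\<lambda>x. h x * cnj (h x)) \<in> borel_measurable period_measure"
      using borel_measurable_times[OF assms(1) measurable_compose[OF assms(1), of cnj borel]]
      by (simp add: borel_measurable_continuous_onI continuous_intros)
  qed (use bd B in \<open>auto simp: norm_mult intro!: mult_mono\<close>)
  have int_ph: "integrable ?M (\<lambda>x. p x * cnj (h x))"
    using integrable_cnj[OF int_hp] by (simp add: mult.commute)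
  define S where "S = (\<Sum>n\<in>F. complex_of_real ((norm (c n))\<^sup>2))"
  have Ihp: "(\<integral>x. h x * cnj (p x) \<partial>?M) = S"
  proof -
    have "(\<integral>x. h x * cnj (p x) \<partial>?M) = (\<Sum>n\<in>F. cnj (c n) * c n)"
      unfolding hp c_def by (subst Bochner_Integration.integral_sum) (auto intro!: integrable_mult_right int_he)
    thus ?thesis unfolding S_def complex_norm_square by (simp add: mult.commute)
  qed
  have Iph: "(\<integral>x. p x * cnj (h x) \<partial>?M) = S"
  proof -
    have "(\<integral>x. p x * cnj (h x) \<partial>?M) = (\<integral>x. cnj (h x * cnj (p x)) \<partial>?M)"
      by (simp add: mult.commute)
    also have "\<dots> = cnj S" by (simp only: Bochner_Integration.integral_cnj Ihp)
    finally show ?thesis by (simp add: S_def)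
  qed
  have Ipp: "(\<integral>x. p x * cnj (p x) \<partial>?M) = S"
  proof -
    have "(\<integral>x. p x * cnj (p x) \<partial>?M) = (\<Sum>n\<in>F. \<Sum>k\<in>F. c n * cnj (c k) * (if n = k then 1 else 0))"
      unfolding pp
      by (subst Bochner_Integration.integral_sum, (intro Bochner_Integration.integrable_sum integrable_mult_right int_e)[],
          rule sum.cong[OF refl], subst Bochner_Integration.integral_sum, (intro integrable_mult_right int_e)[],
          rule sum.cong[OF refl]) (simp add: integral_fourier_char)
    also have "\<dots> = (\<Sum>n\<in>F. \<Sum>k\<in>F. if n = k then c n * cnj (c k) else 0)"
      by (intro sum.cong refl) simp
    also have "\<dots> = S" unfolding S_def complex_norm_square using \<open>finite F\<close> by (simp add: sum.delta)
    finally show ?thesis .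
  qed
  \<comment> \<open>Written as f cnj f, the squared modulus can be expanded by linearity of the
    complex integral; the real identity is recovered at the end.\<close>
  have of_real_eq2: "complex_of_real (\<integral>x. (norm (f x))\<^sup>2 \<partial>?M) = (\<integral>x. f x * cnj (f x) \<partial>?M)" for f
    by (simp only: integral_complex_of_real[symmetric] complex_norm_square)
  have "complex_of_real (\<integral>x. (norm (h x - p x))\<^sup>2 \<partial>?M) =
        (\<integral>x. h x * cnj (h x) - h x * cnj (p x) - p x * cnj (h x) + p x * cnj (p x) \<partial>?M)"
    unfolding of_real_eq2 by (intro Bochner_Integration.integral_cong refl) (simp add: algebra_simps)
  also have "\<dots> = (\<integral>x. h x * cnj (h x) \<partial>?M) - S"
    using int_hh int_hp int_ph int_pp by (simp add: Ihp Iph Ipp)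
  also have "(\<integral>x. h x * cnj (h x) \<partial>?M) = complex_of_real (\<integral>x. (norm (h x))\<^sup>2 \<partial>?M)"
    unfolding of_real_eq2 ..
  finally have E: "complex_of_real (\<integral>x. (norm (h x - p x))\<^sup>2 \<partial>?M) = of_real (\<integral>x. (norm (h x))\<^sup>2 \<partial>?M) - S" .
  have "(\<integral>x. (norm (h x - p x))\<^sup>2 \<partial>?M) = (\<integral>x. (norm (h x))\<^sup>2 \<partial>?M) - (\<Sum>n\<in>F. (norm (c n))\<^sup>2)"
    using E unfolding S_def of_real_sum[symmetric] of_real_diff[symmetric] of_real_eq_iff .
  moreover have "(\<integral>x. (norm (h x - p x))\<^sup>2 \<partial>?M) \<ge> 0" by simp
  ultimately show ?thesis by simp
qed

text \<open>By Bessel's inequality the |c n|^2 are summable, hence null along every injective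
  sequence of indices. A general \<open>g\<close> covers both ends of the telescoping sum in Poisson
  summation.\<close>

lemma riemann_lebesgue:
  fixes h :: "real \<Rightarrow> complex"
  assumes "h \<in> borel_measurable period_measure"
    and "\<And>x. x \<in> {-1/2..<1/2} \<Longrightarrow> norm (h x) \<le> B"
    and "inj g"
  defines "c \<equiv> \<lambda>n. \<integral>x. h x * fourier_char (- n) x \<partial>period_measure"
  shows "(\<lambda>N::nat. c (g N)) \<longlonglongrightarrow> 0"
proof -
  have "(\<lambda>n. (norm (c n))\<^sup>2) summable_on UNIV"
    by (rule nonneg_bounded_partial_sums_imp_summable_on[where C = "\<integral>x. (norm (h x))\<^sup>2 \<partial>period_measure"])
       (use bessel_inequality[OF assms(1,2)] in \<open>auto simp: c_def eventually_finite_subsets_at_top\<close>)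
  hence "(\<lambda>n. (norm (c n))\<^sup>2) summable_on range g"
    by (rule summable_on_subset_banach) auto
  hence "(\<lambda>N. (norm (c (g N)))\<^sup>2) summable_on UNIV"
    by (subst (asm) summable_on_reindex[OF \<open>inj g\<close>]) (simp add: o_def)
  hence "summable (\<lambda>N. (norm (c (g N)))\<^sup>2)"
    by (subst (asm) summable_on_UNIV_nonneg_real_iff) auto
  hence "(\<lambda>N. sqrt ((norm (c (g N)))\<^sup>2)) \<longlonglongrightarrow> sqrt 0"
    by (intro tendsto_intros summable_LIMSEQ_zero)
  thus ?thesis by (simp add: tendsto_norm_zero_iff)
qed

text \<open>The period is half-open, so its integer translates tile the line without overlap. At
  each point exactly one indicator is 1, and the integral may be cut into tiles.\<close>

lemma integral_unfold_period:
  fixes k :: "real \<Rightarrow> complex"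
  assumes k: "integrable lborel k"
    and sum: "(\<lambda>m::int. \<integral>x. norm (k (x + of_int m)) \<partial>period_measure) summable_on UNIV"
  shows "(\<integral>x. k x \<partial>lborel) = (\<Sum>\<^sub>\<infinity>m::int. \<integral>x. k (x + of_int m) \<partial>period_measure)"
proof -
  define I where "I = (\<lambda>m::int. {of_int m - 1/2 ..< of_int m + 1/2 :: real})"
  \<comment> \<open>Tiles are centred at the integers, so the tile of x is the one of the nearest
    integer, with ties rounded up.\<close>
  have mem: "x \<in> I m \<longleftrightarrow> m = \<lfloor>x + 1/2\<rfloor>" for x m
    unfolding I_def by (auto simp: floor_eq_iff[symmetric] eq_commute) linarith+
  have shift: "(\<integral>x. F (x + of_int m) \<partial>period_measure) = (\<integral>x. indicator (I m) x *\<^sub>R F x \<partial>lborel)"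
    for F :: "real \<Rightarrow> 'b :: {banach, second_countable_topology}" and m
  proof -
    have "(\<integral>x. indicator (I m) x *\<^sub>R F x \<partial>lborel) =
        \<bar>1\<bar> *\<^sub>R (\<integral>x. indicator (I m) (of_int m + 1 * x) *\<^sub>R F (of_int m + 1 * x) \<partial>lborel)"
      by (rule lborel_integral_real_affine) simp
    also have "\<dots> = (\<integral>x. F (x + of_int m) \<partial>period_measure)"
      unfolding integral_period by (auto simp: I_def indicator_def add.commute intro!: Bochner_Integration.integral_cong)
    finally show ?thesis by simp
  qed
  have *: "indicat_real (I m) x *\<^sub>R k x = (if m = \<lfloor>x + 1/2\<rfloor> then k x else 0)" for x m
    using mem[of x m] by (auto simp: indicator_def)
  have sing: "(\<Sum>\<^sub>\<infinity>m. indicat_real (I m) x *\<^sub>R k x) = k x" for x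
    unfolding * by (subst infsum_cong_neutral[where T = "{\<lfloor>x + 1/2\<rfloor>}" and g = "\<lambda>_. k x"]) auto
  have "(\<integral>x. k x \<partial>lborel) = (\<integral>x. (\<Sum>\<^sub>\<infinity>m. indicat_real (I m) x *\<^sub>R k x) \<partial>lborel)"
    by (simp add: sing)
  also have "\<dots> = (\<Sum>\<^sub>\<infinity>m. \<integral>x. indicat_real (I m) x *\<^sub>R k x \<partial>lborel)"
  proof (rule integral_infsum)
    show "integrable lborel (\<lambda>x. indicat_real (I m) x *\<^sub>R k x)" for m
      by (rule integrable_mult_indicator[OF _ k]) (auto simp: I_def)
    show "(\<lambda>m. norm (indicat_real (I m) x *\<^sub>R k x)) summable_on UNIV" for x
      unfolding * by (rule summable_on_cong_neutral[where T = "{\<lfloor>x + 1/2\<rfloor>}" and g = "\<lambda>_. norm (k x)", THEN iffD2]) auto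
    show "(\<lambda>m. \<integral>x. norm (indicat_real (I m) x *\<^sub>R k x) \<partial>lborel) summable_on UNIV"
      using sum unfolding shift[of "\<lambda>x. norm (k x)"] by simp
  qed auto
  also have "\<dots> = (\<Sum>\<^sub>\<infinity>m::int. \<integral>x. k (x + of_int m) \<partial>period_measure)"
    unfolding shift ..
  finally show ?thesis .
qed

text \<open>The quotient of the difference by x, continued by 2 pi i at 0, is continuous and without
  zeros on the compact interval; c is its minimal modulus. The bound controls the division by
  \<open>fourier_char 1 x - 1\<close> in Poisson summation.\<close>

lemma fourier_char_1_minus_1_lower_bound:
  "\<exists>c>0. \<forall>x\<in>{-1/2..1/2}. c * \<bar>x\<bar> \<le> norm (fourier_char 1 x - 1)"
proof -
  define k where "k = (\<lambda>x::real. if x = 0 then 2 * of_real pi * \<i> else (fourier_char 1 x - 1) / of_real x)"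
  have "continuous_on {-1/2..1/2} k"
  proof (rule continuous_at_imp_continuous_on, rule ballI)
    fix x :: real
    show "isCont k x"
    proof (cases "x = 0")
      case True
      have "((\<lambda>z. exp (2 * of_real pi * \<i> * z)) has_field_derivative 2 * of_real pi * \<i>) (at (of_real 0))"
        by (auto intro!: derivative_eq_intros)
      hence "((\<lambda>z. (exp (2 * of_real pi * \<i> * z) - 1) / z) \<longlongrightarrow> 2 * of_real pi * \<i>) (at 0)"
        by (simp add: DERIV_def)
      moreover have "filterlim complex_of_real (at 0) (at 0)"
        by (auto simp: filterlim_at eventually_at_filter intro!: tendsto_eq_intros)
      ultimately have "((\<lambda>x. (exp (2 * of_real pi * \<i> * of_real x) - 1) / of_real x) \<longlongrightarrow> 2 * of_real pi * \<i>) (at (0::real))"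
        by (rule filterlim_compose)
      hence "(k \<longlongrightarrow> 2 * of_real pi * \<i>) (at 0)"
        by (rule Lim_transform_eventually) (auto simp: k_def fourier_char_def eventually_at_filter mult_ac)
      hence "(k \<longlongrightarrow> k 0) (at 0)" by (simp add: k_def)
      thus ?thesis using True by (simp add: isCont_def)
    next
      case False
      have "isCont (\<lambda>x. (fourier_char 1 x - 1) / of_real x) x"
        using False by (auto simp: fourier_char_def intro!: continuous_intros)
      thus ?thesis
        by (rule continuous_transform_within[where \<delta> = "\<bar>x\<bar>"]) (use False in \<open>auto simp: k_def dist_real_def\<close>)
    qed
  qed
  hence "continuous_on {-1/2..1/2} (\<lambda>x. norm (k x))" by (intro continuous_intros)
  then obtain x0 where x0: "x0 \<in> {-1/2..1/2}" "\<And>x. x \<in> {-1/2..1/2} \<Longrightarrow> norm (k x0) \<le> norm (k x)"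
    using continuous_attains_inf[of "{-1/2..1/2::real}" "\<lambda>x. norm (k x)"] by auto
  have "k x0 \<noteq> 0"
  proof (cases "x0 = 0")
    case False
    have "fourier_char 1 x0 \<noteq> 1"
    proof
      assume "fourier_char 1 x0 = 1"
      hence "\<exists>n::int. 2 * pi * x0 = of_int (2 * n) * pi" unfolding fourier_char_def exp_eq_1 by auto
      then obtain n :: int where n: "2 * pi * x0 = of_int (2 * n) * pi" by blast
      hence "x0 = of_int n" by simp
      \<comment> \<open>A zero of the difference is an integer, and 0 is the only integer in this
        interval.\<close>
      with x0(1) False have "- 1 < real_of_int n" "real_of_int n < 1" "n \<noteq> 0" by auto
      thus False by linarith
    qed
    thus ?thesis using False by (simp add: k_def)
  qed (simp add: k_def)
  show ?thesis
  proof (intro exI[of _ "norm (k x0)"] conjI ballI)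
    fix x :: real assume "x \<in> {-1/2..1/2}"
    from x0(2)[OF this] show "norm (k x0) * \<bar>x\<bar> \<le> norm (fourier_char 1 x - 1)"
      by (cases "x = 0") (auto simp: k_def norm_divide field_simps)
  qed (use \<open>k x0 \<noteq> 0\<close> in auto)
qed


text \<open>The shift by \<beta> is built into the periodization \<open>f\<close>, so its Fourier
  series has to be summed only at the point 0. There a Lipschitz estimate suffices for convergence
  of the symmetric partial sums, and absolute summability of \<open>G\<close> identifies their limit
  with the unordered sum.\<close>

lemma poisson_summation:
  fixes g g' :: "real \<Rightarrow> complex"
  assumes deriv: "\<And>u. (g has_vector_derivative g' u) (at u)"
    and g_le: "\<And>u. norm (g u) \<le> C / (1 + u\<^sup>2)"
    and g'_le: "\<And>u. norm (g' u) \<le> C / (1 + u\<^sup>2)"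
  defines "G \<equiv> \<lambda>n. \<integral>u. g u * fourier_char (- n) u \<partial>lborel"
  assumes G: "(\<lambda>n. norm (G n)) summable_on UNIV"
  shows "(\<Sum>\<^sub>\<infinity>m. g (of_int m + \<beta>)) = (\<Sum>\<^sub>\<infinity>n. fourier_char n \<beta> * G n)"
proof -
  let ?M = period_measure
  \<comment> \<open>A majorant for \<open>g\<close> and \<open>g'\<close> at m + \<beta> + x,
    uniform in |x| <= 1/2. The factor 2 absorbs x, because q^2 <= 2 (q + x)^2 + 2 x^2 and 2 x^2 <=
    1/2.\<close>
  define A where "A = (\<lambda>m::int. 2 * C * (1 / (1 + (of_int m + \<beta>)\<^sup>2)))"
  have C: "C \<ge> 0" using order_trans[OF norm_ge_zero g_le[of 0]] by simp
  have A: "A summable_on UNIV"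
    unfolding A_def by (intro summable_on_cmult_right summable_on_int_inverse_square)
  have A_ge: "C / (1 + (of_int m + \<beta> + x)\<^sup>2) \<le> A m" if "\<bar>x\<bar> \<le> 1/2" for m x
  proof -
    define q where "q = of_int m + \<beta>"
    have "q\<^sup>2 \<le> 2 * (q + x)\<^sup>2 + 2 * x\<^sup>2"
      using zero_le_power2[of "q + 2 * x"] by (simp add: power2_eq_square algebra_simps)
    moreover have "x\<^sup>2 \<le> 1/4" using power_mono[OF that, of 2] by (simp add: power_divide)
    ultimately have "1 + q\<^sup>2 \<le> 2 * (1 + (q + x)\<^sup>2)" by simp
    hence "1 / (1 + (q + x)\<^sup>2) \<le> 2 * (1 / (1 + q\<^sup>2))"
      by (simp add: field_simps add_pos_nonneg)
    from mult_left_mono[OF this C] show ?thesis by (simp add: A_def q_def mult.commute)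
  qed
  have contg: "continuous_on UNIV g"
    using deriv by (meson continuous_at_imp_continuous_on has_vector_derivative_continuous)
  have mg [measurable]: "g \<in> borel_measurable borel"
    by (rule borel_measurable_continuous_onI[OF contg])
  have "integrable lborel (\<lambda>u. C * inverse (1 + u\<^sup>2))"
    using integrable_inverse_1_plus_square by (simp add: set_integrable_def)
  hence intg: "integrable lborel g"
    by (rule Bochner_Integration.integrable_bound) (use g_le C in \<open>auto simp: divide_inverse\<close>)
  define f where "f = (\<lambda>x. \<Sum>\<^sub>\<infinity>m. g (of_int m + \<beta> + x))"
  have sg: "(\<lambda>m. norm (g (of_int m + \<beta> + x))) summable_on UNIV" if "\<bar>x\<bar> \<le> 1/2" for x
    by (rule summable_on_comparison_test[OF A]) (use g_le A_ge[OF that] in \<open>auto intro: order_trans\<close>)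
  have sg0: "(\<lambda>m. g (of_int m + \<beta> + x)) summable_on UNIV" if "\<bar>x\<bar> \<le> 1/2" for x
    using sg[OF that] by (rule abs_summable_summable)
  have intM: "integrable ?M (\<lambda>x. g (of_int m + \<beta> + x) * fourier_char n x)" for m n
    by (rule integrable_period_bounded[where B = "A m"])
       (use order_trans[OF g_le A_ge] in \<open>auto simp: norm_mult abs_le_iff\<close>)
  have intM0: "integrable ?M (\<lambda>x. g (of_int m + \<beta> + x))" for m
    using intM[of m 0] by simp
  have sgM: "(\<lambda>m. \<integral>x. norm (g (of_int m + \<beta> + x)) \<partial>?M) summable_on UNIV"
  proof (rule summable_on_comparison_test[OF A])
    fix m
    have "(\<integral>x. norm (g (of_int m + \<beta> + x)) \<partial>?M) \<le> (\<integral>x. A m \<partial>?M)"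
      by (rule integral_mono)
         (use intM0 order_trans[OF g_le A_ge] finite_measure.integrable_const[OF finite_measure_period]
           in \<open>auto simp: space_period abs_le_iff intro!: integrable_norm\<close>)
    also have "\<dots> = A m" unfolding integral_period by simp
    finally show "(\<integral>x. norm (g (of_int m + \<beta> + x)) \<partial>?M) \<le> A m" .
  qed (auto intro!: integral_nonneg_AE)
  have [measurable]: "f \<in> borel_measurable ?M"
    unfolding f_def
    by (rule borel_measurable_integrable[OF integrable_infsum]) (use intM0 sg sgM in \<open>auto simp: space_period abs_le_iff\<close>)
  have coeff: "(\<integral>x. f x * fourier_char (- n) x \<partial>?M) = fourier_char n \<beta> * G n" for n
  proof -
    have "(\<integral>x. f x * fourier_char (- n) x \<partial>?M) = (\<integral>x. (\<Sum>\<^sub>\<infinity>m. g (of_int m + \<beta> + x) * fourier_char (- n) x) \<partial>?M)"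
      unfolding f_def
      by (intro Bochner_Integration.integral_cong refl infsum_cmult_left[symmetric] sg0) (auto simp: space_period abs_le_iff)
    also have "\<dots> = (\<Sum>\<^sub>\<infinity>m. \<integral>x. g (of_int m + \<beta> + x) * fourier_char (- n) x \<partial>?M)"
      by (rule integral_infsum) (use intM sg sgM in \<open>auto simp: space_period abs_le_iff norm_mult\<close>)
    also have "\<dots> = (\<Sum>\<^sub>\<infinity>m. \<integral>x. (\<lambda>y. g (\<beta> + y) * fourier_char (- n) y) (x + of_int m) \<partial>?M)"
      by (simp add: fourier_char_add add_ac)
    also have "\<dots> = (\<integral>y. g (\<beta> + y) * fourier_char (- n) y \<partial>lborel)"
    proof (rule integral_unfold_period[symmetric])
      have "integrable lborel (\<lambda>y. g (\<beta> + 1 * y))"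
        by (rule lborel_integrable_real_affine[OF intg]) simp
      thus "integrable lborel (\<lambda>y. g (\<beta> + y) * fourier_char (- n) y)"
        by (rule Bochner_Integration.integrable_bound) (auto simp: norm_mult)
      show "(\<lambda>m::int. \<integral>x. norm (g (\<beta> + (x + of_int m)) * fourier_char (- n) (x + of_int m)) \<partial>?M) summable_on UNIV"
        using sgM by (simp add: norm_mult add_ac)
    qed
    \<comment> \<open>Moving the variable back by \<beta> turns the translate of \<open>g\<close>
      into \<open>g\<close> itself and produces the phase
      \<open>fourier_char n \<beta>\<close>.\<close>
    also have "\<dots> = (\<integral>y. fourier_char n \<beta> * (g (\<beta> + 1 * y) * fourier_char (- n) (\<beta> + 1 * y)) \<partial>lborel)"
    proof (intro Bochner_Integration.integral_cong refl)
      fix y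
      have "fourier_char (- n) y = fourier_char n \<beta> * fourier_char (- n) (\<beta> + 1 * y)"
        by (simp add: fourier_char_add fourier_char_mult flip: mult.assoc)
      thus "g (\<beta> + y) * fourier_char (- n) y = fourier_char n \<beta> * (g (\<beta> + 1 * y) * fourier_char (- n) (\<beta> + 1 * y))"
        by simp
    qed
    also have "\<dots> = fourier_char n \<beta> * G n"
      unfolding G_def integral_mult_right_zero
      by (subst (2) lborel_integral_real_affine[where c = 1 and t = \<beta>]) auto
    finally show ?thesis .
  qed
  define L where "L = (\<Sum>\<^sub>\<infinity>m. A m)"
  \<comment> \<open>The mean value inequality is applied to each summand and the bounds are added,
    which is why \<open>g'\<close> needs a summable majorant as well.\<close>
  have lip: "norm (f x - f 0) \<le> L * \<bar>x\<bar>" if "\<bar>x\<bar> \<le> 1/2" for x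
  proof -
    have each: "norm (g (of_int m + \<beta> + x) - g (of_int m + \<beta> + 0)) \<le> A m * \<bar>x\<bar>" for m
    proof -
      have "norm (g (of_int m + \<beta> + x) - g (of_int m + \<beta> + 0)) \<le> A m * norm (x - 0)"
      proof (rule differentiable_bound[where S = "{-1/2..1/2}" and f' = "\<lambda>y h. h *\<^sub>R g' (of_int m + \<beta> + y)"])
        show "((\<lambda>y. g (of_int m + \<beta> + y)) has_derivative (\<lambda>h. h *\<^sub>R g' (of_int m + \<beta> + y))) (at y within {-1/2..1/2})" for y
        proof -
          have shift: "((\<lambda>y. a + y) has_vector_derivative (1::real)) (at y)" for a
            by (auto intro!: derivative_eq_intros simp flip: has_real_derivative_iff_has_vector_derivative)
          have "((\<lambda>y. g (of_int m + \<beta> + y)) has_vector_derivative 1 *\<^sub>R g' (of_int m + \<beta> + y)) (at y)"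
            using vector_diff_chain_at[OF shift[of "of_int m + \<beta>"] deriv]
            by (simp add: o_def)
          thus ?thesis by (simp add: has_vector_derivative_def has_derivative_at_withinI)
        qed
        show "onorm (\<lambda>h. h *\<^sub>R g' (of_int m + \<beta> + y)) \<le> A m" if "y \<in> {-1/2..1/2}" for y
        proof (rule onorm_le)
          have "norm (g' (of_int m + \<beta> + y)) \<le> A m"
            using that by (intro order_trans[OF g'_le A_ge]) (auto simp: abs_le_iff)
          thus "norm (h *\<^sub>R g' (of_int m + \<beta> + y)) \<le> A m * norm h" for h :: real
            by (simp add: mult.commute[of "A m"] mult_left_mono)
        qed
      qed (use that in \<open>auto simp: abs_le_iff\<close>)
      thus ?thesis by simp
    qed
    have "((\<lambda>m. g (of_int m + \<beta> + x) + - g (of_int m + \<beta> + 0)) has_sum (f x + - f 0)) UNIV"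
      unfolding f_def
      by (intro has_sum_add has_sum_uminusI has_sum_infsum sg0 that) simp
    hence "norm (f x + - f 0) \<le> (\<Sum>\<^sub>\<infinity>m. A m * \<bar>x\<bar>)"
      by (rule norm_infsum_le[OF _ has_sum_infsum[OF summable_on_cmult_left[OF A]]]) (use each in simp)
    also have "\<dots> = L * \<bar>x\<bar>" unfolding L_def by (rule infsum_cmult_left) (rule A)
    finally show ?thesis by simp
  qed
  obtain c where c: "c > 0" "\<And>x. x \<in> {-1/2..1/2} \<Longrightarrow> c * \<bar>x\<bar> \<le> norm (fourier_char 1 x - 1)"
    using fourier_char_1_minus_1_lower_bound by blast
  text \<open>Chernoff's argument: the Fourier coefficients of \<open>f - f 0\<close> telescope in those of the bounded function \<open>h\<close>.\<close>
  define h where "h = (\<lambda>x. (f x - f 0) / (fourier_char 1 x - 1))"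
  have mh: "h \<in> borel_measurable ?M" unfolding h_def by measurable
  have nz: "fourier_char 1 x \<noteq> 1" if "x \<in> {-1/2..1/2}" "x \<noteq> 0" for x
    using c(2)[OF that(1)] c(1) that(2) by (auto simp: mult_le_0_iff)
  have h_le: "norm (h x) \<le> L / c" if "x \<in> {-1/2..<1/2}" for x
  proof (cases "x = 0")
    \<comment> \<open>Numerator and denominator both vanish at 0, so h 0 = 0 by the convention for
      division by zero.\<close>
    case True
    have "L \<ge> 0" unfolding L_def by (rule infsum_nonneg) (use C in \<open>auto simp: A_def\<close>)
    thus ?thesis using True c(1) by (simp add: h_def)
  next
    case False
    have 1: "norm (f x - f 0) \<le> L * \<bar>x\<bar>" by (rule lip) (use that in \<open>auto simp: abs_le_iff\<close>)
    have 2: "c * \<bar>x\<bar> \<le> norm (fourier_char 1 x - 1)" by (rule c(2)) (use that in auto)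
    have "L \<ge> 0" unfolding L_def by (rule infsum_nonneg) (use C in \<open>auto simp: A_def\<close>)
    have "norm (h x) = norm (f x - f 0) / norm (fourier_char 1 x - 1)" by (simp add: h_def norm_divide)
    also have "\<dots> \<le> (L * \<bar>x\<bar>) / (c * \<bar>x\<bar>)"
      by (rule frac_le) (use 1 2 c(1) False \<open>L \<ge> 0\<close> in auto)
    finally show ?thesis using False by simp
  qed
  have int_h: "integrable ?M (\<lambda>x. h x * fourier_char n x)" for n
    by (rule integrable_period_bounded[where B = "L / c"]) (use mh h_le in \<open>auto simp: norm_mult\<close>)
  have int_f: "integrable ?M (\<lambda>x. f x * fourier_char n x)" for n
  proof (rule integrable_period_bounded[where B = "norm (f 0) + L * (1/2)"])
    fix x :: real assume x: "x \<in> {-1/2..<1/2}"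
    have "L \<ge> 0" unfolding L_def by (rule infsum_nonneg) (use C in \<open>auto simp: A_def\<close>)
    have "norm (f x) \<le> norm (f 0) + norm (f x - f 0)" by (metis add.commute diff_add_cancel norm_triangle_ineq)
    also have "norm (f x - f 0) \<le> L * \<bar>x\<bar>" by (rule lip) (use x in \<open>auto simp: abs_le_iff\<close>)
    also have "\<dots> \<le> L * (1/2)" by (rule mult_left_mono) (use x \<open>L \<ge> 0\<close> in \<open>auto simp: abs_le_iff\<close>)
    finally show "norm (f x * fourier_char n x) \<le> norm (f 0) + L * (1/2)" by (simp add: norm_mult)
  qed measurable
  define d where "d = (\<lambda>n. \<integral>x. h x * fourier_char (- n) x \<partial>?M)"
  \<comment> \<open>f - f 0 equals (fourier_char 1 - 1) h, also at 0. Multiplication by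
    \<open>fourier_char 1\<close> shifts the index of a coefficient by one, and the constant f 0
    contributes to index 0 only.\<close>
  have tel: "fourier_char n \<beta> * G n = (if n = 0 then f 0 else 0) + d (n - 1) - d n" for n
  proof -
    have "fourier_char n \<beta> * G n - (if n = 0 then f 0 else 0)
        = (\<integral>x. f x * fourier_char (- n) x \<partial>?M) - f 0 * (\<integral>x. fourier_char (- n) x \<partial>?M)"
      by (simp add: coeff integral_fourier_char)
    also have "\<dots> = (\<integral>x. f x * fourier_char (- n) x - f 0 * fourier_char (- n) x \<partial>?M)"
      using int_f integrable_period_bounded[of "fourier_char (- n)" 1] by simp
    also have "\<dots> = (\<integral>x. h x * fourier_char (- (n - 1)) x - h x * fourier_char (- n) x \<partial>?M)"
    proof (rule Bochner_Integration.integral_cong[OF refl])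
      fix x assume "x \<in> space ?M"
      hence x: "x \<in> {-1/2..1/2}" by (simp add: space_period)
      have "fourier_char (- (n - 1)) x = fourier_char 1 x * fourier_char (- n) x"
        by (simp add: fourier_char_mult)
      hence "h x * fourier_char (- (n - 1)) x - h x * fourier_char (- n) x = h x * (fourier_char 1 x - 1) * fourier_char (- n) x"
        by (simp add: algebra_simps)
      also have "h x * (fourier_char 1 x - 1) = f x - f 0"
        using nz[OF x] by (cases "x = 0") (auto simp: h_def)
      finally show "f x * fourier_char (- n) x - f 0 * fourier_char (- n) x
          = h x * fourier_char (- (n - 1)) x - h x * fourier_char (- n) x"
        by (simp add: algebra_simps)
    qed
    also have "\<dots> = d (n - 1) - d n" unfolding d_def using int_h by simp
    finally show ?thesis by (simp add: algebra_simps)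
  qed
  have partial: "(\<Sum>n\<in>{- int N..int N}. fourier_char n \<beta> * G n) = f 0 + d (- int N - 1) - d (int N)" for N
  proof -
    have "(\<Sum>n\<in>{- int N..int N}. d (n - 1) - d n) = d (- int N - 1) - d (int N)" for N
    proof (induction N)
      case (Suc N)
      define a where "a = int N"
      have a: "a \<ge> 0" "int (Suc N) = a + 1" by (auto simp: a_def)
      have "{- (a + 1)..a + 1} = insert (- (a + 1)) (insert (a + 1) {- a..a})" using a(1) by auto
      hence "(\<Sum>n\<in>{- (a + 1)..a + 1}. d (n - 1) - d n)
           = (d (- (a + 1) - 1) - d (- (a + 1))) + ((d a - d (a + 1)) + (\<Sum>n\<in>{- a..a}. d (n - 1) - d n))"
        using a(1) by simp
      also have "(\<Sum>n\<in>{- a..a}. d (n - 1) - d n) = d (- (a + 1)) - d a"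
        using Suc by (simp add: a_def)
      finally show ?case unfolding a(2) by simp
    qed simp
    thus ?thesis by (simp add: tel sum.distrib sum_subtractf diff_add_eq[symmetric] flip: add_diff_eq)
  qed
  \<comment> \<open>Both boundary coefficients of the telescoped sum are Fourier coefficients of the
    bounded function \<open>h\<close>, so Riemann-Lebesgue removes them.\<close>
  have "(\<lambda>N. f 0 + d (- int N - 1) - d (int N)) \<longlonglongrightarrow> f 0 + 0 - 0"
    unfolding d_def
    by (intro tendsto_intros riemann_lebesgue[OF mh h_le, where g = "\<lambda>N. - int N - 1"]
              riemann_lebesgue[OF mh h_le, where g = int]) (auto simp: inj_def)
  moreover have "(\<lambda>N. \<Sum>n\<in>{- int N..int N}. fourier_char n \<beta> * G n) \<longlonglongrightarrow> (\<Sum>\<^sub>\<infinity>n. fourier_char n \<beta> * G n)"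
  proof -
    have "(\<lambda>n. fourier_char n \<beta> * G n) summable_on UNIV"
      by (rule abs_summable_summable) (use G in \<open>simp add: norm_mult\<close>)
    hence lim: "(sum (\<lambda>n. fourier_char n \<beta> * G n) \<longlongrightarrow> (\<Sum>\<^sub>\<infinity>n. fourier_char n \<beta> * G n)) (finite_subsets_at_top UNIV)"
      using has_sum_infsum unfolding has_sum_def by blast
    \<comment> \<open>Every finite set of integers lies in some symmetric interval, so the unordered
      sum is also the limit along these intervals.\<close>
    have "filterlim (\<lambda>N. {- int N..int N}) (finite_subsets_at_top UNIV) sequentially"
      unfolding filterlim_finite_subsets_at_top
    proof safe
      fix X :: "int set" assume X: "finite X"
      then obtain b where b: "\<And>x. x \<in> X \<Longrightarrow> \<bar>x\<bar> \<le> b"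
        using finite_imageI[of X abs] by (metis bdd_above_finite bdd_above_def imageI)
      show "\<forall>\<^sub>F N in sequentially. finite {- int N..int N} \<and> X \<subseteq> {- int N..int N} \<and> {- int N..int N} \<subseteq> UNIV"
        using eventually_ge_at_top[of "nat b"] by eventually_elim (auto dest!: b)
    qed
    from filterlim_compose[OF lim this] show ?thesis .
  qed
  ultimately have "f 0 + 0 - 0 = (\<Sum>\<^sub>\<infinity>n. fourier_char n \<beta> * G n)"
    unfolding partial by (rule LIMSEQ_unique)
  thus ?thesis by (simp add: f_def)
qed

section \<open>Theta inversion on the lattice\<close>

text \<open>Raise y / N <= exp (y / N) to the N-th power and invert. The free exponent N is what
  later makes Mellin integrals converge for Mellin variables of arbitrarily negative real
  part.\<close>

lemma exp_minus_le_power: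
  fixes y :: real
  assumes "y > 0"
  shows "exp (- y) \<le> (real N / y) ^ N"
proof (cases "N = 0")
  case False
  have "(y / real N) ^ N \<le> exp (y / real N) ^ N"
  proof (rule power_mono)
    show "y / real N \<le> exp (y / real N)"
      using exp_ge_add_one_self[of "y / real N"] by linarith
  qed (use assms in auto)
  also have "\<dots> = exp y" using False by (simp flip: exp_of_nat_mult)
  finally have "inverse (exp y) \<le> inverse ((y / real N) ^ N)"
    by (rule le_imp_inverse_le) (use assms False in auto)
  thus ?thesis by (simp add: exp_minus power_divide inverse_eq_divide)
qed (use assms in auto)

text \<open>The previous bound at a (1 + q) instead of a q: the shift keeps the denominator away
  from 0 and costs the factor exp a.\<close>

lemma exp_minus_le_inverse_power:
  fixes a q :: real
  assumes "a > 0" "q \<ge> 0"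
  shows "exp (- a * q) \<le> exp a * (real N / a) ^ N * (1 / (1 + q) ^ N)"
proof -
  have "exp (- (a * (1 + q))) \<le> (real N / (a * (1 + q))) ^ N"
    by (rule exp_minus_le_power) (use assms in auto)
  hence "exp a * exp (- (a * (1 + q))) \<le> exp a * (real N / (a * (1 + q))) ^ N" by simp
  also have "exp a * exp (- (a * (1 + q))) = exp (- a * q)"
    by (simp flip: exp_add add: algebra_simps)
  finally show ?thesis by (simp add: power_divide power_mult_distrib)
qed

lemma summable_on_int_gaussian:
  fixes a \<beta> :: real
  assumes "a > 0"
  shows "(\<lambda>m::int. exp (- a * (of_int m + \<beta>)\<^sup>2)) summable_on UNIV"
proof (rule summable_on_comparison_test)
  show "(\<lambda>m::int. exp a * (1 / a) * (1 / (1 + (real_of_int m + \<beta>)\<^sup>2))) summable_on UNIV"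
    by (intro summable_on_cmult_right summable_on_int_inverse_square)
  show "exp (- a * (of_int m + \<beta>)\<^sup>2) \<le> exp a * (1 / a) * (1 / (1 + (real_of_int m + \<beta>)\<^sup>2))" for m :: int
    using exp_minus_le_inverse_power[OF assms, of "(real_of_int m + \<beta>)\<^sup>2" 1] by simp
qed auto

lemma Re_inverse_pos: "Re (1 / t) > 0" if "Re t > 0"
  using that by (simp add: Re_divide zero_less_divide_iff sum_power2_gt_zero_iff)

lemma theta_inversion_1:
  assumes t: "Re t > 0"
  shows "(\<Sum>\<^sub>\<infinity>m::int. exp (- t * of_real ((of_int m + \<beta>)\<^sup>2))) =
           csqrt (of_real pi / t) * (\<Sum>\<^sub>\<infinity>n. fourier_char n \<beta> * exp (- of_real (pi\<^sup>2 * (of_int n)\<^sup>2) / t))"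
proof -
  define g where "g = (\<lambda>u::real. exp (- t * of_real (u\<^sup>2)))"
  define g' where "g' = (\<lambda>u::real. - 2 * t * of_real u * g u)"
  \<comment> \<open>The constant of \<open>exp_minus_le_inverse_power\<close> for N = 2. The second
    power of 1 + u^2 is spent on the factor u in \<open>g'\<close>, via 2 |u| <= 1 + u^2.\<close>
  define K where "K = exp (Re t) * (2 / Re t)\<^sup>2"
  have ng: "norm (g u) = exp (- Re t * u\<^sup>2)" for u
    by (simp add: g_def norm_exp_eq_Re del: of_real_power)
  have K: "(1 + u\<^sup>2) * norm (g u) \<le> K / (1 + u\<^sup>2)" for u
  proof -
    have pos: "1 + u\<^sup>2 > 0" by (simp add: add_pos_nonneg)
    have "norm (g u) \<le> K * (1 / (1 + u\<^sup>2)\<^sup>2)"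
      unfolding ng K_def using exp_minus_le_inverse_power[OF t, of "u\<^sup>2" 2] by simp
    hence "(1 + u\<^sup>2) * norm (g u) \<le> (1 + u\<^sup>2) * (K * (1 / (1 + u\<^sup>2)\<^sup>2))"
      by (rule mult_left_mono) auto
    also have "\<dots> = K / (1 + u\<^sup>2)" using pos by (simp add: power2_eq_square)
    finally show ?thesis .
  qed
  have fG: "(\<integral>u. g u * fourier_char (- n) u \<partial>lborel) = csqrt (of_real pi / t) * exp (- of_real (pi\<^sup>2 * (of_int n)\<^sup>2) / t)" for n
  proof -
    have "(\<integral>u. g u * fourier_char (- n) u \<partial>lborel) =
          (\<integral>u. exp (- t * of_real (u\<^sup>2) + \<i> * of_real ((- (2 * pi * of_int n)) * u)) \<partial>lborel)"
      by (simp add: g_def fourier_char_def flip: exp_add)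
    also have "\<dots> = csqrt (of_real pi / t) * exp (- of_real ((- (2 * pi * of_int n))\<^sup>2) / (4 * t))"
      by (rule gaussian_fourier[OF t])
    also have "- complex_of_real ((- (2 * pi * of_int n))\<^sup>2) / (4 * t) = - of_real (pi\<^sup>2 * (of_int n)\<^sup>2) / t"
      by (simp add: power_mult_distrib)
    finally show ?thesis .
  qed
  have "(\<Sum>\<^sub>\<infinity>m. g (of_int m + \<beta>)) = (\<Sum>\<^sub>\<infinity>n. fourier_char n \<beta> * (\<integral>u. g u * fourier_char (- n) u \<partial>lborel))"
  proof (rule poisson_summation)
    show "(g has_vector_derivative g' u) (at u)" for u
    proof -
      have "((\<lambda>z. exp (- t * z\<^sup>2)) has_field_derivative - 2 * t * of_real u * exp (- t * (of_real u)\<^sup>2)) (at (of_real u))"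
        by (auto intro!: derivative_eq_intros)
      from has_vector_derivative_real_field[OF this] show ?thesis by (simp add: g_def g'_def)
    qed
    have KK: "K \<ge> 0" by (simp add: K_def)
    show "norm (g u) \<le> ((1 + norm t) * K) / (1 + u\<^sup>2)" for u
    proof -
      have "norm (g u) \<le> (1 + u\<^sup>2) * norm (g u)" by (simp add: mult_le_cancel_right1)
      also have "\<dots> \<le> K / (1 + u\<^sup>2)" by (rule K)
      also have "\<dots> \<le> ((1 + norm t) * K) / (1 + u\<^sup>2)"
        by (rule divide_right_mono) (use KK in \<open>auto simp: algebra_simps\<close>)
      finally show ?thesis .
    qed
    show "norm (g' u) \<le> ((1 + norm t) * K) / (1 + u\<^sup>2)" for u
    proof -
      have "2 * \<bar>u\<bar> \<le> 1 + u\<^sup>2"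
        using zero_le_power2[of "\<bar>u\<bar> - 1"] by (simp add: power2_diff)
      hence "norm t * (2 * \<bar>u\<bar> * norm (g u)) \<le> norm t * ((1 + u\<^sup>2) * norm (g u))"
        by (intro mult_left_mono mult_right_mono) auto
      hence "norm (g' u) \<le> norm t * ((1 + u\<^sup>2) * norm (g u))"
        by (simp add: g'_def norm_mult mult_ac)
      also have "\<dots> \<le> norm t * (K / (1 + u\<^sup>2))" by (intro mult_left_mono K) auto
      also have "\<dots> = (norm t * K) / (1 + u\<^sup>2)" by simp
      also have "\<dots> \<le> ((1 + norm t) * K) / (1 + u\<^sup>2)"
        by (rule divide_right_mono) (use KK in \<open>auto simp: algebra_simps\<close>)
      finally show ?thesis .
    qed
    have "(\<lambda>n::int. norm (csqrt (of_real pi / t)) * exp (- (pi\<^sup>2 * Re (1 / t)) * (of_int n + 0)\<^sup>2)) summable_on UNIV"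
      by (intro summable_on_cmult_right summable_on_int_gaussian) (use Re_inverse_pos[OF t] in auto)
    also have "(\<lambda>n::int. norm (csqrt (of_real pi / t)) * exp (- (pi\<^sup>2 * Re (1 / t)) * (of_int n + 0)\<^sup>2)) =
       (\<lambda>n. norm (\<integral>u. g u * fourier_char (- n) u \<partial>lborel))"
      unfolding fG norm_mult norm_exp_eq_Re
      by (simp add: Re_divide fun_eq_iff del: of_real_mult of_real_power)
    finally show "(\<lambda>n. norm (\<integral>u. g u * fourier_char (- n) u \<partial>lborel)) summable_on UNIV" .
  qed
  also have "\<dots> = (\<Sum>\<^sub>\<infinity>n. csqrt (of_real pi / t) * (fourier_char n \<beta> * exp (- of_real (pi\<^sup>2 * (of_int n)\<^sup>2) / t)))"
    unfolding fG by (simp add: mult_ac)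
  also have "\<dots> = csqrt (of_real pi / t) * (\<Sum>\<^sub>\<infinity>n. fourier_char n \<beta> * exp (- of_real (pi\<^sup>2 * (of_int n)\<^sup>2) / t))"
    by (rule infsum_cmult_right')
  finally show ?thesis by (simp add: g_def)
qed

section \<open>Lattice sums as products over the coordinates\<close>

lemma bij_betw_lattice:
  "bij_betw (\<lambda>m. restrict m {..<\<nu>}) (lattice \<nu>) (PiE {..<\<nu>} (\<lambda>_. UNIV))"
proof (rule bij_betw_byWitness[where f' = "\<lambda>m j. if j < \<nu> then m j else 0"])
  show "\<forall>m\<in>lattice \<nu>. (\<lambda>j. if j < \<nu> then restrict m {..<\<nu>} j else 0) = m"
    by (auto simp: lattice_def fun_eq_iff)
  show "\<forall>m\<in>PiE {..<\<nu>} (\<lambda>_. UNIV :: int set). restrict (\<lambda>j. if j < \<nu> then m j else 0) {..<\<nu>} = m"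
    by (auto simp: fun_eq_iff restrict_def PiE_def extensional_def)
  show "(\<lambda>m. restrict m {..<\<nu>}) ` lattice \<nu> \<subseteq> PiE {..<\<nu>} (\<lambda>_. UNIV)"
    by (simp add: image_subset_iff PiE_def)
  show "(\<lambda>m j. if j < \<nu> then m j else 0) ` PiE {..<\<nu>} (\<lambda>_. UNIV) \<subseteq> lattice \<nu>"
    by (simp add: image_subset_iff lattice_def)
qed

lemma countable_lattice: "countable (lattice \<nu>)"
proof -
  have "countable (PiE {..<\<nu>} (\<lambda>_. UNIV :: int set))" by (rule countable_PiE) auto
  thus ?thesis using bij_betw_lattice[of \<nu>]
    by (metis bij_betw_imp_inj_on bij_betw_imp_surj_on countable_image_inj_on)
qed

lemma infsum_lattice_prod:
  fixes f :: "nat \<Rightarrow> int \<Rightarrow> 'c :: {banach, real_normed_div_algebra, comm_semiring_1}"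
  assumes "\<And>j. j < \<nu> \<Longrightarrow> (\<lambda>k. norm (f j k)) summable_on UNIV"
  shows "(\<Sum>\<^sub>\<infinity>m\<in>lattice \<nu>. \<Prod>j<\<nu>. f j (m j)) = (\<Prod>j<\<nu>. \<Sum>\<^sub>\<infinity>k. f j k)"
proof -
  have "(\<Sum>\<^sub>\<infinity>m\<in>lattice \<nu>. \<Prod>j<\<nu>. f j (m j)) = (\<Sum>\<^sub>\<infinity>m\<in>lattice \<nu>. (\<lambda>m. \<Prod>j<\<nu>. f j (m j)) (restrict m {..<\<nu>}))"
    by (intro infsum_cong prod.cong) auto
  also have "\<dots> = (\<Sum>\<^sub>\<infinity>m\<in>PiE {..<\<nu>} (\<lambda>_. UNIV). \<Prod>j<\<nu>. f j (m j))"
    by (rule infsum_reindex_bij_betw[OF bij_betw_lattice])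
  also have "\<dots> = (\<Prod>j<\<nu>. \<Sum>\<^sub>\<infinity>k. f j k)"
    by (rule infsum_prod_PiE_abs) (use assms in auto)
  finally show ?thesis .
qed

lemma sqnorm_shift_nonneg: "sqnorm_shift \<nu> m \<alpha> \<ge> 0"
  by (simp add: sqnorm_shift_def sum_nonneg)

text \<open>Each factor 1 + x_j^2 is at most 1 + |x|^2, so a product of one-dimensional convergent
  series is a majorant. This crude comparison already yields a half plane of absolute convergence
  for the zeta function.\<close>

lemma summable_on_lattice_inverse_power:
  assumes N: "N \<ge> \<nu>"
  shows "(\<lambda>m. 1 / (1 + sqnorm_shift \<nu> m \<alpha>) ^ N) summable_on lattice \<nu>"
proof -
  define f where "f = (\<lambda>j k. 1 / (1 + (real_of_int k + \<alpha> j)\<^sup>2))"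
  have s: "f j summable_on UNIV" for j unfolding f_def by (rule summable_on_int_inverse_square)
  have pos: "f j k > 0" for j k by (simp add: f_def add_pos_nonneg)
  have "infsum (f j) UNIV > 0" for j
  proof -
    have "f j 0 \<le> infsum (f j) UNIV"
      using finite_sum_le_infsum[OF s, of "{0}"] pos by (auto simp: less_imp_le)
    thus ?thesis using pos[of j 0] by linarith
  qed
  hence "(\<Prod>j<\<nu>. infsum (f j) UNIV) \<noteq> 0" by (simp add: order_less_imp_not_eq2)
  moreover have "(\<Sum>\<^sub>\<infinity>m\<in>lattice \<nu>. \<Prod>j<\<nu>. f j (m j)) = (\<Prod>j<\<nu>. \<Sum>\<^sub>\<infinity>k. f j k)"
    by (rule infsum_lattice_prod) (use s pos in \<open>simp add: less_imp_le\<close>)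
  \<comment> \<open>the infinite sum of a family that is not summable is 0\<close>
  ultimately have sum: "(\<lambda>m. \<Prod>j<\<nu>. f j (m j)) summable_on lattice \<nu>"
    using infsum_not_exists[of "\<lambda>m. \<Prod>j<\<nu>. f j (m j)" "lattice \<nu>"] by auto
  show ?thesis
  proof (rule summable_on_comparison_test[OF sum])
    fix m
    have le: "(real_of_int (m j) + \<alpha> j)\<^sup>2 \<le> sqnorm_shift \<nu> m \<alpha>" if "j < \<nu>" for j
      unfolding sqnorm_shift_def using that by (intro member_le_sum) auto
    have "(\<Prod>j<\<nu>. 1 + (real_of_int (m j) + \<alpha> j)\<^sup>2) \<le> (\<Prod>j<\<nu>. 1 + sqnorm_shift \<nu> m \<alpha>)"
      by (rule prod_mono) (use le in auto)
    also have "\<dots> \<le> (1 + sqnorm_shift \<nu> m \<alpha>) ^ N"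
      using N sqnorm_shift_nonneg[of \<nu> m \<alpha>] by (simp add: power_increasing)
    finally have "1 / (1 + sqnorm_shift \<nu> m \<alpha>) ^ N \<le> 1 / (\<Prod>j<\<nu>. 1 + (real_of_int (m j) + \<alpha> j)\<^sup>2)"
      using sqnorm_shift_nonneg[of \<nu> m \<alpha>]
      by (intro divide_left_mono mult_pos_pos prod_pos zero_less_power add_pos_nonneg) simp_all
    thus "1 / (1 + sqnorm_shift \<nu> m \<alpha>) ^ N \<le> (\<Prod>j<\<nu>. f j (m j))"
      by (simp add: f_def prod_dividef)
  qed (use sqnorm_shift_nonneg[of \<nu> _ \<alpha>] in \<open>auto intro!: divide_nonneg_nonneg zero_le_power add_nonneg_nonneg\<close>)
qed

lemma lnorm_power2: "(lnorm \<nu> n)\<^sup>2 = sqnorm_shift \<nu> n (\<lambda>_. 0)"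
  by (simp add: lnorm_def sqnorm_shift_def sum_nonneg)

lemma theta_inversion:
  assumes t: "Re t > 0"
  shows "(\<Sum>\<^sub>\<infinity>m\<in>lattice \<nu>. exp (- t * of_real (sqnorm_shift \<nu> m \<alpha>))) =
           csqrt (of_real pi / t) ^ \<nu> * (\<Sum>\<^sub>\<infinity>n\<in>lattice \<nu>.
              exp (\<i> * of_real (2 * pi * ldot \<nu> n \<alpha>)) * exp (- of_real (pi\<^sup>2 * (lnorm \<nu> n)\<^sup>2) / t))"
proof -
  have "(\<Sum>\<^sub>\<infinity>m\<in>lattice \<nu>. exp (- t * of_real (sqnorm_shift \<nu> m \<alpha>))) =
        (\<Sum>\<^sub>\<infinity>m\<in>lattice \<nu>. \<Prod>j<\<nu>. exp (- t * of_real ((of_int (m j) + \<alpha> j)\<^sup>2)))"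
    unfolding sqnorm_shift_def of_real_sum sum_distrib_left exp_sum[OF finite_lessThan] ..
  also have "\<dots> = (\<Prod>j<\<nu>. \<Sum>\<^sub>\<infinity>k::int. exp (- t * of_real ((of_int k + \<alpha> j)\<^sup>2)))"
  proof (rule infsum_lattice_prod)
    fix j
    have "norm (exp (- t * complex_of_real ((of_int k + \<alpha> j)\<^sup>2))) = exp (- Re t * (of_int k + \<alpha> j)\<^sup>2)" for k :: int
      by (simp add: norm_exp_eq_Re del: of_real_power)
    thus "(\<lambda>k::int. norm (exp (- t * complex_of_real ((of_int k + \<alpha> j)\<^sup>2)))) summable_on UNIV"
      using summable_on_int_gaussian[OF t, of "\<alpha> j"] by simp
  qed
  also have "\<dots> = csqrt (of_real pi / t) ^ \<nu> *
      (\<Prod>j<\<nu>. \<Sum>\<^sub>\<infinity>n. fourier_char n (\<alpha> j) * exp (- of_real (pi\<^sup>2 * (of_int n)\<^sup>2) / t))"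
    unfolding theta_inversion_1[OF t] prod.distrib by simp
  also have "(\<Prod>j<\<nu>. \<Sum>\<^sub>\<infinity>n. fourier_char n (\<alpha> j) * exp (- of_real (pi\<^sup>2 * (of_int n)\<^sup>2) / t)) =
     (\<Sum>\<^sub>\<infinity>n\<in>lattice \<nu>. \<Prod>j<\<nu>. fourier_char (n j) (\<alpha> j) * exp (- of_real (pi\<^sup>2 * (of_int (n j))\<^sup>2) / t))"
  proof (rule infsum_lattice_prod[symmetric])
    fix j
    have "norm (fourier_char n (\<alpha> j) * exp (- of_real (pi\<^sup>2 * (of_int n)\<^sup>2) / t)) = exp (- (pi\<^sup>2 * Re (1 / t)) * (of_int n + 0)\<^sup>2)" for n
      unfolding norm_mult norm_exp_eq_Re by (simp add: Re_divide del: of_real_mult of_real_power)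
    thus "(\<lambda>n. norm (fourier_char n (\<alpha> j) * exp (- of_real (pi\<^sup>2 * (of_int n)\<^sup>2) / t))) summable_on UNIV"
      using summable_on_int_gaussian[of "pi\<^sup>2 * Re (1 / t)" 0] Re_inverse_pos[OF t] by simp
  qed
  also have "\<dots> = (\<Sum>\<^sub>\<infinity>n\<in>lattice \<nu>.
              exp (\<i> * of_real (2 * pi * ldot \<nu> n \<alpha>)) * exp (- of_real (pi\<^sup>2 * (lnorm \<nu> n)\<^sup>2) / t))"
    unfolding lnorm_power2 sqnorm_shift_def ldot_def prod.distrib fourier_char_def exp_sum[OF finite_lessThan, symmetric]
    by (intro infsum_cong arg_cong2[where f = "(*)"] arg_cong[where f = exp])
       (simp_all add: sum_distrib_left sum_divide_distrib sum_negf mult_ac)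
  finally show ?thesis .
qed

section \<open>Continuation of the zeta function\<close>

text \<open>A competing continuation lives on an unknown connected open set S, and two connected
  domains may meet in a disconnected set. If \<open>Z\<close> is holomorphic off a closed countable
  set C, then S - C is still connected and contains both 0 and a half plane, so the identity theorem
  reaches a neighbourhood of 0.\<close>

lemma
  assumes hol: "Z holomorphic_on - C" and C: "closed C" "countable C" "0 \<notin> C"
    and half: "\<And>w. Re w > \<sigma> \<Longrightarrow> w \<notin> C"
    and a: "\<And>n. n \<in> A \<Longrightarrow> a n \<notin> complex_of_real ` {..0}"
    and summ: "\<And>w. Re w > \<sigma> \<Longrightarrow> (\<lambda>n. norm (a n powr (-w))) summable_on A"
    and eq: "\<And>w. Re w > \<sigma> \<Longrightarrow> Z w = (\<Sum>\<^sub>\<infinity>n\<in>A. a n powr (-w))"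
  shows zeta_regularizableI: "zeta_regularizable A a"
    and zeta_reg_prod_eqI: "zeta_reg_prod A a = exp (- deriv Z 0)"
proof -
  have Z: "zeta_cont A a Z"
    unfolding zeta_cont_def
  proof (intro exI conjI)
    show "open (- C)" using C by auto
    show "connected (- C)" unfolding Compl_eq_Diff_UNIV
      by (rule connected_open_diff_countable) (use C in auto)
    show "{w. Re w > \<sigma>} \<subseteq> - C" using half by auto
    show "0 \<in> - C" using C by auto
    show "\<forall>w. \<sigma> < Re w \<longrightarrow> (\<lambda>n. norm (a n powr - w)) summable_on A \<and> Z w = (\<Sum>\<^sub>\<infinity>n\<in>A. a n powr - w)"
      using summ eq by auto
  qed (rule hol)
  have uniq: "deriv Z1 0 = deriv Z 0" if "zeta_cont A a Z1" for Z1
  proof -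
    from that obtain S \<sigma>1 where S: "open S" "connected S" "0 \<in> S" "{w. Re w > \<sigma>1} \<subseteq> S" "Z1 holomorphic_on S"
      and Z1: "\<And>w. Re w > \<sigma>1 \<Longrightarrow> Z1 w = (\<Sum>\<^sub>\<infinity>n\<in>A. a n powr (-w))"
      unfolding zeta_cont_def by blast
    define T where "T = S - C"
    have T: "open T" "connected T" "0 \<in> T"
      unfolding T_def using S C by (auto intro!: connected_open_diff_countable open_Diff)
    define U where "U = {w::complex. Re w > max \<sigma> \<sigma>1}"
    have "complex_of_real (max \<sigma> \<sigma>1 + 1) \<in> U" by (auto simp: U_def max_def)
    hence U: "open U" "U \<noteq> {}" unfolding U_def by (blast intro: open_halfspace_Re_gt)+
    have UT: "U \<subseteq> T" using S(4) half by (auto simp: U_def T_def)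
    have "Z1 w = Z w" if "w \<in> T" for w
    proof (rule analytic_continuation_open[OF U(1) T(1) U(2) T(2) UT _ _ _ that])
      show "Z1 holomorphic_on T" using S(5) by (rule holomorphic_on_subset) (auto simp: T_def)
      show "Z holomorphic_on T" using hol by (rule holomorphic_on_subset) (auto simp: T_def)
      show "Z1 w = Z w" if "w \<in> U" for w using that Z1 eq by (auto simp: U_def)
    qed
    hence "eventually (\<lambda>w. Z1 w = Z w) (nhds 0)"
      using eventually_nhds_in_open[OF T(1) T(3)] by (auto elim: eventually_mono)
    thus ?thesis by (rule deriv_cong_ev) simp
  qed
  show "zeta_regularizable A a"
    unfolding zeta_regularizable_def using a Z uniq by metis
  have "zeta_cont A a (SOME Z. zeta_cont A a Z)" by (rule someI[of "zeta_cont A a", OF Z])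
  from uniq[OF this] show "zeta_reg_prod A a = exp (- deriv Z 0)"
    by (simp add: zeta_reg_prod_def)
qed

section \<open>The dual theta series and its Mellin transform\<close>

lemma integral_exp_gamma:
  fixes p x :: real
  assumes "p > 0" "x > 0"
  shows "(\<integral>v. exp (p * v - x * exp v) \<partial>lborel) = Gamma p * x powr (- p)"
proof -
  have "complex_of_real (\<integral>v. exp (p * v - x * exp v) \<partial>lborel)
      = (\<integral>v. exp (of_real p * of_real v - of_real x * of_real (exp v)) \<partial>lborel)"
    unfolding integral_complex_of_real[symmetric]
    by (simp flip: exp_of_real)
  also have "\<dots> = Gamma (of_real p) * exp (- of_real p * Ln (of_real x))"
    by (rule Gamma_integral_exp) (use assms in auto)
  also have "\<dots> = complex_of_real (Gamma p * x powr (- p))"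
    using assms by (simp add: Gamma_complex_of_real Ln_of_real powr_def flip: exp_of_real)
  finally show ?thesis by (simp only: of_real_eq_iff)
qed

text \<open>The n-th term of the dual theta series at t = exp v / s, the point of the ray through
  1/s with parameter v.\<close>

definition theta_term :: "nat \<Rightarrow> (nat \<Rightarrow> real) \<Rightarrow> complex \<Rightarrow> (nat \<Rightarrow> int) \<Rightarrow> real \<Rightarrow> complex" where
  "theta_term \<nu> \<alpha> s n v = exp (\<i> * of_real (2 * pi * ldot \<nu> n \<alpha>)) * exp (- s * of_real (pi\<^sup>2 * (lnorm \<nu> n)\<^sup>2 * exp (- v)))"

definition punctured_theta :: "nat \<Rightarrow> (nat \<Rightarrow> real) \<Rightarrow> complex \<Rightarrow> real \<Rightarrow> complex" where
  "punctured_theta \<nu> \<alpha> s v = (\<Sum>\<^sub>\<infinity>n\<in>lattice \<nu> - {\<lambda>_. 0}. theta_term \<nu> \<alpha> s n v)"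

lemma lnorm_ge_1:
  assumes "n \<in> lattice \<nu> - {\<lambda>_. 0}"
  shows "lnorm \<nu> n \<ge> 1"
proof -
  from assms obtain j where j: "n j \<noteq> 0" by (auto simp: fun_eq_iff)
  with assms have "j < \<nu>" by (auto simp: lattice_def not_less[symmetric])
  hence "(real_of_int (n j))\<^sup>2 \<le> (\<Sum>j<\<nu>. (real_of_int (n j))\<^sup>2)"
    by (intro member_le_sum) auto
  moreover have "1 \<le> (real_of_int (n j))\<^sup>2"
  proof -
    have "1 \<le> (n j)\<^sup>2" using j by (simp add: int_one_le_iff_zero_less)
    hence "real_of_int 1 \<le> real_of_int ((n j)\<^sup>2)" by (simp only: of_int_le_iff)
    thus ?thesis by simp
  qed
  ultimately have "1 \<le> (\<Sum>j<\<nu>. (real_of_int (n j))\<^sup>2)" by linarith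
  thus ?thesis by (simp add: lnorm_def)
qed

lemma minus_half_odd_notin_nonpos_Ints:
  assumes "odd \<nu>"
  shows "- (of_nat \<nu> / 2) \<notin> (\<int>\<^sub>\<le>\<^sub>0 :: complex set)"
proof
  assume "- (of_nat \<nu> / 2) \<in> (\<int>\<^sub>\<le>\<^sub>0 :: complex set)"
  then obtain k :: int where k: "- (of_nat \<nu> / 2) = complex_of_int k" by (auto elim: nonpos_Ints_cases)
  have "of_nat \<nu> = - 2 * (- (of_nat \<nu> / 2) :: complex)" by simp
  also have "\<dots> = of_int (2 * (- k))" unfolding k by simp
  finally have "int \<nu> = 2 * (- k)" by (metis of_int_eq_iff of_int_of_nat_eq)
  hence "even \<nu>" by presburger
  thus False using assms by simp
qed

context
  fixes \<nu> :: nat and \<alpha> :: "nat \<Rightarrow> real" and s :: complex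
  assumes s: "Re s > 0"
begin

text \<open>One application of \<open>exp_minus_le_power\<close> provides both decay as v tends to
  minus infinity, at any rate N, and a factor summable over the lattice once N >= \<nu>. Removing n
  = 0 gives |n| >= 1, which allows 1 / q <= 2 / (1 + q) for q = |n|^2.\<close>

lemma norm_theta_term_le:
  assumes n: "n \<in> lattice \<nu> - {\<lambda>_. 0}"
  shows "norm (theta_term \<nu> \<alpha> s n v) \<le>
           (2 * real N / (Re s * pi\<^sup>2)) ^ N * (1 / (1 + sqnorm_shift \<nu> n (\<lambda>_. 0)) ^ N) * exp (real N * v)"
proof -
  define q where "q = (lnorm \<nu> n)\<^sup>2"
  have q: "q \<ge> 1" unfolding q_def using lnorm_ge_1[OF n] by simp
  define c where "c = Re s * pi\<^sup>2"
  have c: "c > 0" using s by (simp add: c_def)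
  have "norm (theta_term \<nu> \<alpha> s n v) = exp (- (c * q * exp (- v)))"
    by (simp add: theta_term_def norm_mult norm_exp_eq_Re q_def c_def mult_ac del: of_real_mult of_real_power)
  also have "\<dots> \<le> (real N / (c * q * exp (- v))) ^ N"
    by (rule exp_minus_le_power) (use q c in auto)
  also have "real N / (c * q * exp (- v)) = (real N / c) * (1 / q) * exp v"
    by (simp add: exp_minus field_simps)
  also have "((real N / c) * (1 / q) * exp v) ^ N \<le> ((real N / c) * (2 / (1 + q)) * exp v) ^ N"
  proof (intro power_mono mult_right_mono mult_left_mono)
    show "1 / q \<le> 2 / (1 + q)" using q by (simp add: field_simps)
  qed (use q c in auto)
  also have "\<dots> = (2 * real N / c) ^ N * (1 / (1 + q) ^ N) * exp (real N * v)"
    by (simp add: power_mult_distrib power_divide exp_of_nat_mult)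
  finally show ?thesis by (simp add: c_def q_def lnorm_power2)
qed

lemma summable_theta_term: "(\<lambda>n. norm (theta_term \<nu> \<alpha> s n v)) summable_on (lattice \<nu> - {\<lambda>_. 0})"
proof (rule summable_on_comparison_test)
  show "(\<lambda>n. (2 * real \<nu> / (Re s * pi\<^sup>2)) ^ \<nu> * (1 / (1 + sqnorm_shift \<nu> n (\<lambda>_. 0)) ^ \<nu>) * exp (real \<nu> * v)) summable_on (lattice \<nu> - {\<lambda>_. 0})"
    by (intro summable_on_cmult_left summable_on_cmult_right summable_on_subset_banach[OF summable_on_lattice_inverse_power[OF order_refl]]) auto
qed (use norm_theta_term_le[where N = \<nu>] in auto)

lemma norm_punctured_theta_le:
  assumes "N \<ge> \<nu>"
  shows "\<exists>D\<ge>0. \<forall>v. norm (punctured_theta \<nu> \<alpha> s v) \<le> D * exp (real N * v)"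
proof (intro exI conjI allI)
  let ?B = "\<lambda>n. (2 * real N / (Re s * pi\<^sup>2)) ^ N * (1 / (1 + sqnorm_shift \<nu> n (\<lambda>_. 0)) ^ N)"
  have B: "?B summable_on (lattice \<nu> - {\<lambda>_. 0})"
    by (intro summable_on_cmult_right summable_on_subset_banach[OF summable_on_lattice_inverse_power[OF assms]]) auto
  show "norm (punctured_theta \<nu> \<alpha> s v) \<le> (\<Sum>\<^sub>\<infinity>n\<in>lattice \<nu> - {\<lambda>_. 0}. ?B n) * exp (real N * v)" for v
    unfolding punctured_theta_def infsum_cmult_left'[symmetric]
    by (rule norm_infsum_le[OF has_sum_infsum[OF abs_summable_summable[OF summable_theta_term]]
          has_sum_infsum[OF summable_on_cmult_left[OF B]] norm_theta_term_le])
  show "(\<Sum>\<^sub>\<infinity>n\<in>lattice \<nu> - {\<lambda>_. 0}. ?B n) \<ge> 0"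
    by (rule infsum_nonneg) (use s sqnorm_shift_nonneg in \<open>auto intro!: mult_nonneg_nonneg divide_nonneg_nonneg\<close>)
qed

lemma measurable_theta_term [measurable]: "theta_term \<nu> \<alpha> s n \<in> borel_measurable borel"
  unfolding theta_term_def by (intro borel_measurable_continuous_onI continuous_intros)

lemma measurable_kernel: "(\<lambda>v::real. exp (\<mu> * of_real v - s * of_real (exp v))) \<in> borel_measurable borel"
  by (intro borel_measurable_continuous_onI continuous_intros)

lemma integrable_kernel_theta_term:
  assumes n: "n \<in> lattice \<nu> - {\<lambda>_. 0}" and N: "Re \<mu> + real N > 0"
  shows "integrable lborel (\<lambda>v. exp (\<mu> * of_real v - s * of_real (exp v)) * theta_term \<nu> \<alpha> s n v)" (is ?thesis1)
    and "(\<integral>v. norm (exp (\<mu> * of_real v - s * of_real (exp v)) * theta_term \<nu> \<alpha> s n v) \<partial>lborel)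
      \<le> (2 * real N / (Re s * pi\<^sup>2)) ^ N * (1 / (1 + sqnorm_shift \<nu> n (\<lambda>_. 0)) ^ N) *
          (\<integral>v. exp ((Re \<mu> + real N) * v - Re s * exp v) \<partial>lborel)" (is ?thesis2)
proof -
  let ?B = "(2 * real N / (Re s * pi\<^sup>2)) ^ N * (1 / (1 + sqnorm_shift \<nu> n (\<lambda>_. 0)) ^ N)"
  let ?f = "\<lambda>v. exp (\<mu> * of_real v - s * of_real (exp v)) * theta_term \<nu> \<alpha> s n v"
  have i: "integrable lborel (\<lambda>v. ?B * exp ((Re \<mu> + real N) * v - Re s * exp v))"
    by (intro integrable_mult_right integrable_exp_gamma N s)
  have le: "norm (?f v) \<le> ?B * exp ((Re \<mu> + real N) * v - Re s * exp v)" for v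
  proof -
    have "norm (?f v) \<le> exp (Re \<mu> * v - Re s * exp v) * (?B * exp (real N * v))"
      unfolding norm_mult norm_exp_eq_Re by (intro mult_mono norm_theta_term_le[OF n]) auto
    also have "\<dots> = ?B * (exp (real N * v) * exp (Re \<mu> * v - Re s * exp v))" by (simp only: mult_ac)
    also have "exp (real N * v) * exp (Re \<mu> * v - Re s * exp v) = exp ((Re \<mu> + real N) * v - Re s * exp v)"
      by (simp add: algebra_simps flip: exp_add)
    finally show ?thesis .
  qed
  have m: "?f \<in> borel_measurable lborel" using measurable_kernel by simp
  show th: ?thesis1
    by (rule Bochner_Integration.integrable_bound[OF i m]) (use order_trans[OF le abs_ge_self] in auto)
  have "(\<integral>v. norm (?f v) \<partial>lborel) \<le> (\<integral>v. ?B * exp ((Re \<mu> + real N) * v - Re s * exp v) \<partial>lborel)"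
    by (rule integral_mono[OF integrable_norm[OF th] i le])
  thus ?thesis2 by (simp only: integral_mult_right_zero)
qed

lemma
  shows integrable_kernel_punctured_theta:
      "integrable lborel (\<lambda>v. exp (\<mu> * of_real v - s * of_real (exp v)) * punctured_theta \<nu> \<alpha> s v)"
    and integral_kernel_punctured_theta:
      "(\<integral>v. exp (\<mu> * of_real v - s * of_real (exp v)) * punctured_theta \<nu> \<alpha> s v \<partial>lborel) =
       (\<Sum>\<^sub>\<infinity>n\<in>lattice \<nu> - {\<lambda>_. 0}. \<integral>v. exp (\<mu> * of_real v - s * of_real (exp v)) * theta_term \<nu> \<alpha> s n v \<partial>lborel)"
proof -
  let ?f = "\<lambda>n v. exp (\<mu> * of_real v - s * of_real (exp v)) * theta_term \<nu> \<alpha> s n v"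
  \<comment> \<open>N >= \<nu> serves the sum over the lattice, and N > - Re \<mu> serves the
    integral near minus infinity.\<close>
  define N where "N = max \<nu> (nat \<lceil>1 - Re \<mu>\<rceil>)"
  have N: "N \<ge> \<nu>" "Re \<mu> + real N > 0" unfolding N_def by linarith+
  have eq: "exp (\<mu> * of_real v - s * of_real (exp v)) * punctured_theta \<nu> \<alpha> s v = (\<Sum>\<^sub>\<infinity>n\<in>lattice \<nu> - {\<lambda>_. 0}. ?f n v)" for v
    unfolding punctured_theta_def by (rule infsum_cmult_right'[symmetric])
  have cnt: "countable (lattice \<nu> - {\<lambda>_. 0})" using countable_lattice by auto
  have pw: "(\<lambda>n. norm (?f n v)) summable_on lattice \<nu> - {\<lambda>_. 0}" for v
    unfolding norm_mult by (intro summable_on_cmult_right summable_theta_term)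
  have sums: "(\<lambda>n. \<integral>v. norm (?f n v) \<partial>lborel) summable_on lattice \<nu> - {\<lambda>_. 0}"
  proof (rule summable_on_comparison_test)
    show "(\<lambda>n. (2 * real N / (Re s * pi\<^sup>2)) ^ N * (1 / (1 + sqnorm_shift \<nu> n (\<lambda>_. 0)) ^ N) *
          (\<integral>v. exp ((Re \<mu> + real N) * v - Re s * exp v) \<partial>lborel)) summable_on (lattice \<nu> - {\<lambda>_. 0})"
      by (intro summable_on_cmult_left summable_on_cmult_right summable_on_subset_banach[OF summable_on_lattice_inverse_power[OF N(1)]]) auto
  qed (use integrable_kernel_theta_term(2)[OF _ N(2)] in auto)
  show "integrable lborel (\<lambda>v. exp (\<mu> * of_real v - s * of_real (exp v)) * punctured_theta \<nu> \<alpha> s v)"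
    unfolding eq by (rule integrable_infsum[OF cnt integrable_kernel_theta_term(1)[OF _ N(2)] pw sums])
  show "(\<integral>v. exp (\<mu> * of_real v - s * of_real (exp v)) * punctured_theta \<nu> \<alpha> s v \<partial>lborel) =
       (\<Sum>\<^sub>\<infinity>n\<in>lattice \<nu> - {\<lambda>_. 0}. \<integral>v. ?f n v \<partial>lborel)"
    unfolding eq by (rule integral_infsum[OF cnt integrable_kernel_theta_term(1)[OF _ N(2)] pw sums])
qed

definition theta_mellin :: "complex \<Rightarrow> complex" where
  "theta_mellin \<mu> = (\<integral>v. exp (\<mu> * of_real v - s * of_real (exp v)) * punctured_theta \<nu> \<alpha> s v \<partial>lborel)"

text \<open>The factor exp (- s exp v) controls plus infinity. Without the term n = 0 the theta
  series decays at minus infinity faster than every exponential, so no restriction on \<mu>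
  arises.\<close>

lemma holomorphic_theta_mellin: "theta_mellin holomorphic_on UNIV"
  unfolding theta_mellin_def
proof (rule holomorphic_on_integral)
  show "(\<lambda>v. exp (\<mu> * of_real v - s * of_real (exp v)) * punctured_theta \<nu> \<alpha> s v) \<in> borel_measurable lborel" for \<mu>
    by (rule borel_measurable_integrable[OF integrable_kernel_punctured_theta])
  show "(\<lambda>\<mu>. exp (\<mu> * of_real v - s * of_real (exp v)) * punctured_theta \<nu> \<alpha> s v) holomorphic_on UNIV" for v
    by (intro holomorphic_intros)
next
  fix \<mu>0 :: complex
  define p where "p = Re \<mu>0"
  define N where "N = max \<nu> (nat \<lceil>2 - p\<rceil>)"
  have N: "N \<ge> \<nu>" "p - 1 + real N > 0" "p + 1 + real N > 0" unfolding N_def by linarith+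
  obtain D where D: "D \<ge> 0" "\<And>v. norm (punctured_theta \<nu> \<alpha> s v) \<le> D * exp (real N * v)"
    using norm_punctured_theta_le[OF N(1)] by blast
  \<comment> \<open>For |Re \<mu> - p| <= 1, exp (Re \<mu> v) is at most exp ((p + 1) v) if v >= 0
    and at most exp ((p - 1) v) otherwise. The sum of the two serves both signs.\<close>
  define g where "g = (\<lambda>v. D * (exp ((p - 1 + real N) * v - Re s * exp v) + exp ((p + 1 + real N) * v - Re s * exp v)))"
  have g: "integrable lborel g"
    unfolding g_def by (intro integrable_mult_right Bochner_Integration.integrable_add integrable_exp_gamma N s)
  have le: "norm (exp (\<mu> * of_real v - s * of_real (exp v)) * punctured_theta \<nu> \<alpha> s v) \<le> g v"
    if "\<mu> \<in> cball \<mu>0 1" for \<mu> v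
  proof -
    have "\<bar>Re \<mu> - p\<bar> \<le> 1"
      using that abs_Re_le_cmod[of "\<mu> - \<mu>0"] by (auto simp: p_def dist_norm norm_minus_commute)
    hence "Re \<mu> * v \<le> (p - 1) * v \<or> Re \<mu> * v \<le> (p + 1) * v"
      by (cases "v \<ge> 0") (simp_all add: mult_right_mono mult_right_mono_neg abs_le_iff)
    hence e: "exp (Re \<mu> * v) \<le> exp ((p - 1) * v) + exp ((p + 1) * v)"
      by (auto intro: add_increasing add_increasing2)
    have "norm (exp (\<mu> * of_real v - s * of_real (exp v)) * punctured_theta \<nu> \<alpha> s v)
        \<le> exp (Re \<mu> * v - Re s * exp v) * (D * exp (real N * v))"
      unfolding norm_mult norm_exp_eq_Re by (intro mult_mono D) auto
    also have "\<dots> = (D * exp (real N * v - Re s * exp v)) * exp (Re \<mu> * v)"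
      by (simp add: exp_diff mult_ac)
    also have "\<dots> \<le> (D * exp (real N * v - Re s * exp v)) * (exp ((p - 1) * v) + exp ((p + 1) * v))"
      by (rule mult_left_mono[OF e]) (use D in auto)
    also have "\<dots> = g v"
      unfolding g_def by (simp add: algebra_simps flip: exp_add)
    finally show ?thesis .
  qed
  show "\<exists>r>0. \<exists>g. integrable lborel g \<and> cball \<mu>0 r \<subseteq> UNIV \<and> (\<forall>z\<in>cball \<mu>0 r. \<forall>v\<in>space lborel.
      norm (exp (z * of_real v - s * of_real (exp v)) * punctured_theta \<nu> \<alpha> s v) \<le> g v)"
    using g le by (intro exI[of _ 1] conjI exI[of _ g]) auto
qed auto

text \<open>Each eigenvalue is \<open>s\<close> times a number that also lies in the right half plane, so the principal
  logarithms add up. Pulling out \<open>s\<close> turns the Mellin transform along the positive axis into one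
  along the ray through \<open>1 / s\<close>, which converges even if \<open>Re (s\<^sup>2) \<le> 0\<close>.\<close>
definition rotated_eigenvalue :: "(nat \<Rightarrow> int) \<Rightarrow> complex" where
  "rotated_eigenvalue m = of_real (sqnorm_shift \<nu> m \<alpha>) / s + s"

lemma Re_rotated_eigenvalue: "Re (rotated_eigenvalue m) = sqnorm_shift \<nu> m \<alpha> * Re (1 / s) + Re s"
  by (simp add: rotated_eigenvalue_def Re_divide)

lemma Re_rotated_eigenvalue_pos: "Re (rotated_eigenvalue m) > 0"
  unfolding Re_rotated_eigenvalue using s Re_inverse_pos[OF s] sqnorm_shift_nonneg
  by (intro add_nonneg_pos mult_nonneg_nonneg) auto

lemma eigenvalue_powr:
  "(complex_of_real (sqnorm_shift \<nu> m \<alpha>) + s\<^sup>2) powr (- w) = exp (- w * Ln s) * exp (- w * Ln (rotated_eigenvalue m))"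
proof -
  have ne: "s \<noteq> 0" "rotated_eigenvalue m \<noteq> 0" using s Re_rotated_eigenvalue_pos[of m] by auto
  have "complex_of_real (sqnorm_shift \<nu> m \<alpha>) + s\<^sup>2 = s * rotated_eigenvalue m"
    using ne by (simp add: rotated_eigenvalue_def field_simps power2_eq_square)
  moreover have "Ln (s * rotated_eigenvalue m) = Ln s + Ln (rotated_eigenvalue m)"
    using ne Re_Ln_pos_lt_imp[OF s] Re_Ln_pos_lt_imp[OF Re_rotated_eigenvalue_pos[of m]]
    by (intro Ln_times_simple) auto
  ultimately show ?thesis using ne by (simp add: powr_def algebra_simps flip: exp_add)
qed

text \<open>Such a value would make s^2 real and nonpositive, hence s purely imaginary, contrary to
  Re s > 0.\<close>

lemma eigenvalue_not_nonpos:
  "complex_of_real (sqnorm_shift \<nu> m \<alpha>) + s\<^sup>2 \<notin> complex_of_real ` {..0}"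
proof
  assume "complex_of_real (sqnorm_shift \<nu> m \<alpha>) + s\<^sup>2 \<in> complex_of_real ` {..0}"
  then obtain x where x: "x \<le> 0" "complex_of_real (sqnorm_shift \<nu> m \<alpha>) + s\<^sup>2 = of_real x" by auto
  hence "Im (s\<^sup>2) = 0" "Re (s\<^sup>2) \<le> 0"
    using sqnorm_shift_nonneg[of \<nu> m \<alpha>] by (auto simp: complex_eq_iff simp del: Re_power2 Im_power2)
  thus False using s by (auto simp: Im_power2 Re_power2 zero_less_power power2_eq_square mult_le_0_iff)
qed

text \<open>Half of the assumption on w already makes the n = 0 integral converge, since then Re (w
  - \<nu>/2) > 0. The full strength gives the comparison with
  \<open>summable_on_lattice_inverse_power\<close>.\<close>

lemma
  assumes w: "Re w > real \<nu>"
  shows summable_eigenvalue_powr: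
      "(\<lambda>m. norm ((complex_of_real (sqnorm_shift \<nu> m \<alpha>) + s\<^sup>2) powr (- w))) summable_on lattice \<nu>"
    and infsum_eigenvalue_powr:
      "(\<Sum>\<^sub>\<infinity>m\<in>lattice \<nu>. (complex_of_real (sqnorm_shift \<nu> m \<alpha>) + s\<^sup>2) powr (- w)) =
       rGamma w * exp (- w * Ln s) * (of_real (sqrt pi) * csqrt s) ^ \<nu> *
         (Gamma (w - of_nat \<nu> / 2) * exp (- (w - of_nat \<nu> / 2) * Ln s) + theta_mellin (w - of_nat \<nu> / 2))"
proof -
  let ?b = rotated_eigenvalue
  let ?f = "\<lambda>m v. exp (w * of_real v - ?b m * of_real (exp v))"
  have w0: "Re w > 0" using w by linarith
  have G: "Gamma w \<noteq> 0" using w0 by (intro Gamma_nonzero) (auto elim!: nonpos_Ints_cases)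
  \<comment> \<open>The real part of a rotated eigenvalue is a combination of |m + \<alpha>|^2 and 1
    with the positive coefficients Re (1 / s) and Re s; \<kappa> is the smaller one.\<close>
  define \<kappa> where "\<kappa> = min (Re (1 / s)) (Re s)"
  have \<kappa>: "\<kappa> > 0" using s Re_inverse_pos[OF s] by (simp add: \<kappa>_def)
  have b_ge: "Re (?b m) \<ge> \<kappa> * (1 + sqnorm_shift \<nu> m \<alpha>)" for m
  proof -
    have "\<kappa> * sqnorm_shift \<nu> m \<alpha> \<le> Re (1 / s) * sqnorm_shift \<nu> m \<alpha>"
      by (rule mult_right_mono) (use sqnorm_shift_nonneg in \<open>auto simp: \<kappa>_def\<close>)
    moreover have "\<kappa> \<le> Re s" by (simp add: \<kappa>_def)
    ultimately show ?thesis unfolding Re_rotated_eigenvalue distrib_left by (simp add: mult.commute)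
  qed
  have int: "integrable lborel (?f m)" for m
    by (rule integrable_cexp_gamma[OF w0 Re_rotated_eigenvalue_pos])
  have intnorm: "(\<integral>v. norm (?f m v) \<partial>lborel) = Gamma (Re w) * Re (?b m) powr (- Re w)" for m
    using integral_exp_gamma[OF w0 Re_rotated_eigenvalue_pos[of m]] by (simp add: norm_exp_eq_Re)
  have sums: "(\<lambda>m. \<integral>v. norm (?f m v) \<partial>lborel) summable_on lattice \<nu>"
  proof (rule summable_on_comparison_test)
    show "(\<lambda>m. Gamma (Re w) * \<kappa> powr (- Re w) * (1 / (1 + sqnorm_shift \<nu> m \<alpha>) ^ \<nu>)) summable_on lattice \<nu>"
      by (intro summable_on_cmult_right summable_on_lattice_inverse_power order_refl)
    fix m
    define q where "q = 1 + sqnorm_shift \<nu> m \<alpha>"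
    have q: "q \<ge> 1" using sqnorm_shift_nonneg[of \<nu> m \<alpha>] by (simp add: q_def)
    have "Re (?b m) powr (- Re w) \<le> (\<kappa> * q) powr (- Re w)"
      using b_ge[of m] \<kappa> q w0 by (intro powr_mono2') (auto simp: q_def)
    also have "\<dots> = \<kappa> powr (- Re w) * q powr (- Re w)" using \<kappa> q by (simp add: powr_mult)
    also have "\<dots> \<le> \<kappa> powr (- Re w) * q powr (- real \<nu>)"
      by (intro mult_left_mono powr_mono) (use q w in auto)
    also have "q powr (- real \<nu>) = 1 / q ^ \<nu>" using q by (simp add: powr_minus powr_realpow inverse_eq_divide)
    finally have "Gamma (Re w) * Re (?b m) powr (- Re w) \<le> Gamma (Re w) * (\<kappa> powr (- Re w) * (1 / q ^ \<nu>))"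
      by (rule mult_left_mono) (use w0 Gamma_real_pos[of "Re w"] in auto)
    thus "(\<integral>v. norm (?f m v) \<partial>lborel) \<le> Gamma (Re w) * \<kappa> powr (- Re w) * (1 / (1 + sqnorm_shift \<nu> m \<alpha>) ^ \<nu>)"
      by (simp only: intnorm q_def mult.assoc)
  qed (auto intro!: integral_nonneg_AE)
  have pw: "(\<lambda>m. norm (?f m v)) summable_on lattice \<nu>" for v
  proof (rule summable_on_comparison_test)
    define a where "a = \<kappa> * exp v"
    have a: "a > 0" using \<kappa> by (simp add: a_def)
    show "(\<lambda>m. exp (Re w * v) * (exp a * (real \<nu> / a) ^ \<nu> * (1 / (1 + sqnorm_shift \<nu> m \<alpha>) ^ \<nu>))) summable_on lattice \<nu>"
      by (intro summable_on_cmult_right summable_on_lattice_inverse_power order_refl)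
    fix m
    have "\<kappa> * sqnorm_shift \<nu> m \<alpha> \<le> Re (?b m)" using b_ge[of m] \<kappa> by (simp add: algebra_simps)
    hence "\<kappa> * sqnorm_shift \<nu> m \<alpha> * exp v \<le> Re (?b m) * exp v" by (rule mult_right_mono) auto
    hence "norm (?f m v) \<le> exp (Re w * v + (- a * sqnorm_shift \<nu> m \<alpha>))"
      by (simp add: norm_exp_eq_Re a_def mult_ac)
    also have "\<dots> = exp (Re w * v) * exp (- a * sqnorm_shift \<nu> m \<alpha>)" by (rule exp_add)
    also have "\<dots> \<le> exp (Re w * v) * (exp a * (real \<nu> / a) ^ \<nu> * (1 / (1 + sqnorm_shift \<nu> m \<alpha>) ^ \<nu>))"
      by (intro mult_left_mono exp_minus_le_inverse_power a sqnorm_shift_nonneg) auto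
    finally show "norm (?f m v) \<le> exp (Re w * v) * (exp a * (real \<nu> / a) ^ \<nu> * (1 / (1 + sqnorm_shift \<nu> m \<alpha>) ^ \<nu>))" .
  qed auto
  have term_eq: "(complex_of_real (sqnorm_shift \<nu> m \<alpha>) + s\<^sup>2) powr (- w) = exp (- w * Ln s) * rGamma w * (\<integral>v. ?f m v \<partial>lborel)" for m
    unfolding eigenvalue_powr Gamma_integral_exp[OF w0 Re_rotated_eigenvalue_pos]
    using G by (simp add: rGamma_inverse_Gamma)
  show "(\<lambda>m. norm ((complex_of_real (sqnorm_shift \<nu> m \<alpha>) + s\<^sup>2) powr (- w))) summable_on lattice \<nu>"
    unfolding term_eq norm_mult
    by (intro summable_on_cmult_right summable_on_comparison_test[OF sums] integral_norm_bound) auto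
  \<comment> \<open>For odd \<nu> the sign of the root matters. \<open>csqrt s\<close> has positive
    real part, so each positive multiple of it is again a principal root.\<close>
  have csq: "csqrt (of_real pi / (of_real (exp v) / s)) = (of_real (sqrt pi) * csqrt s) * exp (- of_real v / 2)" for v
  proof -
    define r where "r = sqrt (pi * exp (- v))"
    have r: "r > 0" "r\<^sup>2 = pi * exp (- v)" by (auto simp: r_def)
    have "exp (- v / 2) = sqrt (exp (- v))"
      by (rule real_sqrt_unique[symmetric]) (auto simp flip: exp_of_nat_mult)
    hence re: "r = sqrt pi * exp (- v / 2)" by (simp add: r_def real_sqrt_mult)
    have "csqrt (of_real pi / (of_real (exp v) / s)) = of_real r * csqrt s"
    proof (rule csqrt_unique)
      show "(of_real r * csqrt s)\<^sup>2 = of_real pi / (of_real (exp v) / s)"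
        unfolding power_mult_distrib power2_csqrt of_real_power[symmetric] r(2)
        by (simp add: exp_minus field_simps del: of_real_exp exp_of_real)
      have "Re s = (Re (csqrt s))\<^sup>2 - (Im (csqrt s))\<^sup>2" by (metis Re_power2 power2_csqrt)
      hence "(Re (csqrt s))\<^sup>2 > 0" using s zero_le_power2[of "Im (csqrt s)"] by linarith
      hence "Re (csqrt s) > 0" using csqrt_principal[of s] by (metis less_irrefl zero_power2)
      thus "0 < Re (of_real r * csqrt s) \<or> Re (of_real r * csqrt s) = 0 \<and> 0 \<le> Im (of_real r * csqrt s)"
        using r(1) by simp
    qed
    thus ?thesis unfolding re by (simp add: mult_ac flip: exp_of_real)
  qed
  have inner: "(\<Sum>\<^sub>\<infinity>m\<in>lattice \<nu>. ?f m v) = (of_real (sqrt pi) * csqrt s) ^ \<nu> *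
      (exp ((w - of_nat \<nu> / 2) * of_real v - s * of_real (exp v)) +
       exp ((w - of_nat \<nu> / 2) * of_real v - s * of_real (exp v)) * punctured_theta \<nu> \<alpha> s v)" for v
  proof -
    define t where "t = complex_of_real (exp v) / s"
    have "Re t = exp v * Re (1 / s)" by (simp add: t_def Re_divide)
    hence t: "Re t > 0" using Re_inverse_pos[OF s] by simp
    have ne: "s \<noteq> 0" using s by auto
    have "(\<Sum>\<^sub>\<infinity>m\<in>lattice \<nu>. ?f m v) =
        (\<Sum>\<^sub>\<infinity>m\<in>lattice \<nu>. exp (w * of_real v - s * of_real (exp v)) * exp (- t * of_real (sqnorm_shift \<nu> m \<alpha>)))"
      by (intro infsum_cong) (simp add: t_def rotated_eigenvalue_def algebra_simps flip: exp_add)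
    also have "\<dots> = exp (w * of_real v - s * of_real (exp v)) * (\<Sum>\<^sub>\<infinity>m\<in>lattice \<nu>. exp (- t * of_real (sqnorm_shift \<nu> m \<alpha>)))"
      by (rule infsum_cmult_right')
    also have "(\<Sum>\<^sub>\<infinity>m\<in>lattice \<nu>. exp (- t * of_real (sqnorm_shift \<nu> m \<alpha>))) = csqrt (of_real pi / t) ^ \<nu> *
        (\<Sum>\<^sub>\<infinity>n\<in>lattice \<nu>. theta_term \<nu> \<alpha> s n v)"
      unfolding theta_inversion[OF t] theta_term_def
      by (intro arg_cong2[where f = "(*)"] infsum_cong refl arg_cong[where f = exp]) (simp_all add: t_def exp_minus field_simps del: of_real_exp exp_of_real)
    also have "(\<Sum>\<^sub>\<infinity>n\<in>lattice \<nu>. theta_term \<nu> \<alpha> s n v) = 1 + punctured_theta \<nu> \<alpha> s v"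
    proof -
      have "lattice \<nu> = insert (\<lambda>_. 0) (lattice \<nu> - {\<lambda>_. 0})" by (auto simp: lattice_def)
      hence "(\<Sum>\<^sub>\<infinity>n\<in>lattice \<nu>. theta_term \<nu> \<alpha> s n v) = (\<Sum>\<^sub>\<infinity>n\<in>insert (\<lambda>_. 0) (lattice \<nu> - {\<lambda>_. 0}). theta_term \<nu> \<alpha> s n v)"
        by simp
      also have "\<dots> = theta_term \<nu> \<alpha> s (\<lambda>_. 0) v + punctured_theta \<nu> \<alpha> s v"
        unfolding punctured_theta_def by (rule infsum_insert[OF abs_summable_summable[OF summable_theta_term]]) simp
      also have "theta_term \<nu> \<alpha> s (\<lambda>_. 0) v = 1" by (simp add: theta_term_def ldot_def lnorm_def)
      finally show ?thesis .
    qed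
    \<comment> \<open>The factor exp (- \<nu> v / 2) is what moves the Mellin variable from w to w -
      \<nu>/2.\<close>
    also have "csqrt (of_real pi / t) ^ \<nu> = (of_real (sqrt pi) * csqrt s) ^ \<nu> * exp (- (of_nat \<nu> / 2) * of_real v)"
      unfolding t_def csq power_mult_distrib by (simp flip: exp_of_nat_mult)
    also have "exp (w * of_real v - s * of_real (exp v)) * ((of_real (sqrt pi) * csqrt s) ^ \<nu> * exp (- (of_nat \<nu> / 2) * of_real v) * (1 + punctured_theta \<nu> \<alpha> s v))
      = (of_real (sqrt pi) * csqrt s) ^ \<nu> * ((exp (w * of_real v - s * of_real (exp v)) * exp (- (of_nat \<nu> / 2) * of_real v)) * (1 + punctured_theta \<nu> \<alpha> s v))"
      by (simp only: mult_ac)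
    also have "exp (w * of_real v - s * of_real (exp v)) * exp (- (of_nat \<nu> / 2) * of_real v) = exp ((w - of_nat \<nu> / 2) * of_real v - s * of_real (exp v))"
      unfolding exp_add[symmetric] by (rule arg_cong[where f = exp]) (simp add: algebra_simps)
    finally show ?thesis by (simp only: distrib_left mult_1_right)
  qed
  have "(\<Sum>\<^sub>\<infinity>m\<in>lattice \<nu>. (complex_of_real (sqnorm_shift \<nu> m \<alpha>) + s\<^sup>2) powr (- w)) =
        exp (- w * Ln s) * rGamma w * (\<Sum>\<^sub>\<infinity>m\<in>lattice \<nu>. \<integral>v. ?f m v \<partial>lborel)"
    unfolding term_eq by (rule infsum_cmult_right')
  also have "(\<Sum>\<^sub>\<infinity>m\<in>lattice \<nu>. \<integral>v. ?f m v \<partial>lborel) = (\<integral>v. (\<Sum>\<^sub>\<infinity>m\<in>lattice \<nu>. ?f m v) \<partial>lborel)"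
    by (rule integral_infsum[OF countable_lattice int pw sums, symmetric])
  also have "\<dots> = (of_real (sqrt pi) * csqrt s) ^ \<nu> *
    ((\<integral>v. exp ((w - of_nat \<nu> / 2) * of_real v - s * of_real (exp v)) \<partial>lborel) + theta_mellin (w - of_nat \<nu> / 2))"
  proof -
    have "integrable lborel (\<lambda>v::real. exp ((w - of_nat \<nu> / 2) * of_real v - s * of_real (exp v)))"
      by (rule integrable_cexp_gamma[OF _ s]) (use w in simp)
    thus ?thesis unfolding inner integral_mult_right_zero theta_mellin_def
      by (subst Bochner_Integration.integral_add[OF _ integrable_kernel_punctured_theta]) auto
  qed
  also have "(\<integral>v. exp ((w - of_nat \<nu> / 2) * of_real v - s * of_real (exp v)) \<partial>lborel) =
      Gamma (w - of_nat \<nu> / 2) * exp (- (w - of_nat \<nu> / 2) * Ln s)"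
    by (rule Gamma_integral_exp[OF _ s]) (use w in simp)
  finally show "(\<Sum>\<^sub>\<infinity>m\<in>lattice \<nu>. (complex_of_real (sqnorm_shift \<nu> m \<alpha>) + s\<^sup>2) powr (- w)) =
       rGamma w * exp (- w * Ln s) * (of_real (sqrt pi) * csqrt s) ^ \<nu> *
         (Gamma (w - of_nat \<nu> / 2) * exp (- (w - of_nat \<nu> / 2) * Ln s) + theta_mellin (w - of_nat \<nu> / 2))"
    by (simp only: mult_ac)
qed

text \<open>Z = rGamma H, where rGamma 0 = 0 and rGamma has derivative 1 at 0, so the product rule
  leaves H 0. The exceptional set \<open>C\<close> consists of the poles of Gamma (w - \<nu>/2); it
  misses 0 because \<nu>/2 is not an integer.\<close>

lemma
  assumes odd: "odd \<nu>"
  shows zeta_regularizable_lattice: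
      "zeta_regularizable (lattice \<nu>) (\<lambda>m. complex_of_real (sqnorm_shift \<nu> m \<alpha>) + s\<^sup>2)"
    and zeta_reg_prod_lattice:
      "zeta_reg_prod (lattice \<nu>) (\<lambda>m. complex_of_real (sqnorm_shift \<nu> m \<alpha>) + s\<^sup>2) =
         exp (- ((of_real (sqrt pi) * csqrt s) ^ \<nu> *
           (Gamma (- (of_nat \<nu> / 2)) * csqrt s ^ \<nu> + theta_mellin (- (of_nat \<nu> / 2)))))"
proof -
  let ?a = "\<lambda>m. complex_of_real (sqnorm_shift \<nu> m \<alpha>) + s\<^sup>2"
  define H where "H = (\<lambda>w. exp (- w * Ln s) * (of_real (sqrt pi) * csqrt s) ^ \<nu> *
         (Gamma (w - of_nat \<nu> / 2) * exp (- (w - of_nat \<nu> / 2) * Ln s) + theta_mellin (w - of_nat \<nu> / 2)))"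
  define Z where "Z = (\<lambda>w. rGamma w * H w)"
  define C :: "complex set" where "C = (\<lambda>z. of_nat \<nu> / 2 + z) ` \<int>\<^sub>\<le>\<^sub>0"
  have inC: "w \<in> C \<longleftrightarrow> w - of_nat \<nu> / 2 \<in> \<int>\<^sub>\<le>\<^sub>0" for w
    unfolding C_def by (auto simp: image_iff intro!: bexI[of _ "w - of_nat \<nu> / 2"])
  have C: "closed C" "countable C"
    unfolding C_def
    by (rule closed_translation, simp, intro countable_image countable_subset[OF nonpos_Ints_subset_Ints countable_int])
  have C0: "0 \<notin> C"
    using minus_half_odd_notin_nonpos_Ints[OF odd] by (simp add: inC)
  have half: "w \<notin> C" if "Re w > real \<nu>" for w
    using that by (auto simp: inC complex_eq_iff elim!: nonpos_Ints_cases)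
  have mell: "(\<lambda>w. theta_mellin (w - of_nat \<nu> / 2)) holomorphic_on A" for A
    by (rule holomorphic_on_compose_gen[OF _ holomorphic_theta_mellin, unfolded o_def]) (auto intro!: holomorphic_intros)
  have H: "H holomorphic_on - C"
    unfolding H_def by (intro holomorphic_intros mell) (auto simp: inC)
  have Z: "Z holomorphic_on - C"
    unfolding Z_def by (intro holomorphic_intros H)
  have Zeq: "Z w = (\<Sum>\<^sub>\<infinity>m\<in>lattice \<nu>. ?a m powr (- w))" if "Re w > real \<nu>" for w
    unfolding infsum_eigenvalue_powr[OF that] Z_def H_def by (simp only: mult_ac)
  show "zeta_regularizable (lattice \<nu>) ?a"
    by (rule zeta_regularizableI[OF Z C C0 half eigenvalue_not_nonpos summable_eigenvalue_powr Zeq])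
  have "(H has_field_derivative deriv H 0) (at 0)"
    by (rule holomorphic_derivI[OF H]) (use C C0 in auto)
  moreover have "(rGamma has_field_derivative 1) (at (0::complex))"
    using has_field_derivative_rGamma_nonpos_int[of 0 UNIV] by simp
  ultimately have "(Z has_field_derivative 1 * H 0 + deriv H 0 * rGamma 0) (at 0)"
    unfolding Z_def by (rule DERIV_mult[rotated])
  hence "deriv Z 0 = H 0" by (simp add: DERIV_imp_deriv)
  also have "H 0 = (of_real (sqrt pi) * csqrt s) ^ \<nu> *
      (Gamma (- (of_nat \<nu> / 2)) * csqrt s ^ \<nu> + theta_mellin (- (of_nat \<nu> / 2)))"
  proof -
    have "s \<noteq> 0" using s by auto
    hence "csqrt s ^ \<nu> = exp (of_nat \<nu> / 2 * Ln s)" by (simp add: csqrt_exp_Ln flip: exp_of_nat_mult)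
    thus ?thesis by (simp add: H_def)
  qed
  finally show "zeta_reg_prod (lattice \<nu>) ?a =
         exp (- ((of_real (sqrt pi) * csqrt s) ^ \<nu> *
           (Gamma (- (of_nat \<nu> / 2)) * csqrt s ^ \<nu> + theta_mellin (- (of_nat \<nu> / 2)))))"
    using zeta_reg_prod_eqI[OF Z C C0 half eigenvalue_not_nonpos summable_eigenvalue_powr Zeq] by simp
qed

end

section \<open>Bessel integrals of half-integral order\<close>

definition bessel_kernel :: "complex \<Rightarrow> complex \<Rightarrow> real \<Rightarrow> complex" where
  "bessel_kernel \<mu> z v = exp (\<mu> * of_real v - z * of_real (exp v + exp (- v)))"

text \<open>In the usual notation this is twice the modified Bessel function \<open>K\<^sub>\<mu>(2 z)\<close>.\<close>
definition bessel_integral :: "complex \<Rightarrow> complex \<Rightarrow> complex" where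
  "bessel_integral \<mu> z = (\<integral>v. bessel_kernel \<mu> z v \<partial>lborel)"

lemma bessel_kernel_eq: "bessel_kernel \<mu> z v = exp (\<mu> * of_real v) * exp (- z * of_real (exp v + exp (- v)))"
  by (simp add: bessel_kernel_def del: of_real_add flip: exp_add)

lemma continuous_bessel_kernel: "continuous_on A (bessel_kernel \<mu> z)"
  unfolding bessel_kernel_def by (intro continuous_intros)

lemma norm_bessel_kernel: "norm (bessel_kernel \<mu> z v) = exp (Re \<mu> * v - Re z * (exp v + exp (- v)))"
  by (simp add: bessel_kernel_def norm_exp_eq_Re del: of_real_add)

text \<open>The factor exp (- z exp (- v)) is traded for exp (N v) with N large. What remains is a
  Gamma integrand of positive order, whatever the sign of Re \<mu>.\<close>

lemma integrable_bessel_kernel: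
  assumes z: "Re z > 0"
  shows "integrable lborel (bessel_kernel \<mu> z)"
proof -
  define N where "N = nat \<lceil>1 - Re \<mu>\<rceil>"
  have N: "Re \<mu> + real N > 0" unfolding N_def by linarith
  have le: "norm (bessel_kernel \<mu> z v) \<le> (real N / Re z) ^ N * exp ((Re \<mu> + real N) * v - Re z * exp v)" for v
  proof -
    have "exp (- (Re z * exp (- v))) \<le> (real N / (Re z * exp (- v))) ^ N"
      by (rule exp_minus_le_power) (use z in auto)
    also have "real N / (Re z * exp (- v)) = real N / Re z * exp v" by (simp add: exp_minus field_simps)
    also have "\<dots> ^ N = (real N / Re z) ^ N * exp (real N * v)"
      by (simp only: power_mult_distrib exp_of_nat_mult)
    finally have "exp (Re \<mu> * v - Re z * exp v) * exp (- (Re z * exp (- v))) \<le>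
        exp (Re \<mu> * v - Re z * exp v) * ((real N / Re z) ^ N * exp (real N * v))"
      by (rule mult_left_mono) auto
    also have "exp (Re \<mu> * v - Re z * exp v) * exp (- (Re z * exp (- v))) = norm (bessel_kernel \<mu> z v)"
      unfolding norm_bessel_kernel by (simp add: algebra_simps flip: exp_add)
    also have "exp (Re \<mu> * v - Re z * exp v) * ((real N / Re z) ^ N * exp (real N * v)) =
        (real N / Re z) ^ N * (exp (Re \<mu> * v - Re z * exp v) * exp (real N * v))" by (simp only: mult_ac)
    also have "exp (Re \<mu> * v - Re z * exp v) * exp (real N * v) = exp ((Re \<mu> + real N) * v - Re z * exp v)"
      by (simp add: algebra_simps flip: exp_add)
    finally show ?thesis .
  qed
  show ?thesis
  proof (rule Bochner_Integration.integrable_bound)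
    show "integrable lborel (\<lambda>v. (real N / Re z) ^ N * exp ((Re \<mu> + real N) * v - Re z * exp v))"
      by (intro integrable_mult_right integrable_exp_gamma N z)
    show "bessel_kernel \<mu> z \<in> borel_measurable lborel"
      using borel_measurable_continuous_onI[OF continuous_bessel_kernel] by simp
  qed (use order_trans[OF le abs_ge_self] in auto)
qed

lemma bessel_integral_minus: "bessel_integral (- \<mu>) z = bessel_integral \<mu> z"
  unfolding bessel_integral_def
  by (subst lborel_integral_real_affine[where c = "-1" and t = 0])
     (auto simp: bessel_kernel_def[abs_def] add.commute)

text \<open>Substitute y = 2 sinh (v/2) in a Gaussian integral: y^2 + 2 = 2 cosh v and dy = cosh
  (v/2) dv. The result is the mean of the integrals of orders 1/2 and -1/2, which agree by
  reflection.\<close>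

lemma bessel_integral_half:
  assumes z: "Re z > 0"
  shows "bessel_integral (1/2) z = csqrt (of_real pi / z) * exp (- 2 * z)"
proof -
  define g :: "real \<Rightarrow> real" where "g = (\<lambda>v. exp (v / 2) - exp (- v / 2))"
  define g' :: "real \<Rightarrow> real" where "g' = (\<lambda>v. (exp (v / 2) + exp (- v / 2)) / 2)"
  define f where "f = (\<lambda>y::real. exp (- 2 * z) * exp (- z * of_real (y\<^sup>2)))"
  have kern: "g' v *\<^sub>R f (g v) = (bessel_kernel (1/2) z v + bessel_kernel (- (1/2)) z v) / 2" for v
  proof -
    have "exp (v / 2) * exp (v / 2) = exp v" "exp (- v / 2) * exp (- v / 2) = exp (- v)" "exp (v / 2) * exp (- v / 2) = 1"
      by (simp_all flip: exp_add)
    hence E: "exp v + exp (- v) = (g v)\<^sup>2 + 2"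
      unfolding g_def power2_diff by (simp add: power2_eq_square)
    have f: "f (g v) = exp (- z * of_real (exp v + exp (- v)))"
      unfolding f_def exp_add[symmetric] E by (intro arg_cong[where f = exp]) (simp add: algebra_simps)
    have "exp (1/2 * complex_of_real v) = of_real (exp (v / 2))" "exp (- (1/2) * complex_of_real v) = of_real (exp (- v / 2))"
      by (simp_all flip: exp_of_real)
    thus ?thesis
      unfolding f g'_def bessel_kernel_eq by (simp add: scaleR_conv_of_real distrib_right)
  qed
  have intf: "integrable lborel f"
    unfolding f_def using integrable_gaussian_fourier[OF z, of 0] by simp
  have intk: "integrable lborel (\<lambda>v. g' v *\<^sub>R f (g v))"
    unfolding kern by (intro integrable_divide Bochner_Integration.integrable_add integrable_bessel_kernel z)
  have "(\<integral>y. f y \<partial>lborel) = (LBINT y=-\<infinity>..\<infinity>. f y)"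
    by (simp add: interval_lebesgue_integral_def set_lebesgue_integral_def einterval_def)
  also have "\<dots> = (LBINT v=-\<infinity>..\<infinity>. g' v *\<^sub>R f (g v))"
  proof (rule interval_integral_substitution_integrable)
    show "(g has_field_derivative g' v) (at v)" for v
      unfolding g_def g'_def by (auto intro!: derivative_eq_intros simp: field_simps)
    show "isCont f (g v)" "isCont g' v" "0 \<le> g' v" for v
      unfolding f_def g'_def by (auto intro!: continuous_intros add_nonneg_nonneg)
    have "filterlim g at_bot at_bot" unfolding g_def by real_asymp
    thus "((ereal \<circ> g \<circ> real_of_ereal) \<longlongrightarrow> -\<infinity>) (at_right (-\<infinity>))"
      by (simp add: ereal_tendsto_simps)
    have "filterlim g at_top at_top" unfolding g_def by real_asymp
    thus "((ereal \<circ> g \<circ> real_of_ereal) \<longlongrightarrow> \<infinity>) (at_left \<infinity>)"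
      by (simp add: ereal_tendsto_simps)
    show "set_integrable lborel (einterval (-\<infinity>) \<infinity>) f" using intf by (simp add: set_integrable_def)
    show "set_integrable lborel (einterval (-\<infinity>) \<infinity>) (\<lambda>v. g' v *\<^sub>R f (g v))"
      using intk by (simp add: set_integrable_def)
  qed auto
  also have "\<dots> = (\<integral>v. g' v *\<^sub>R f (g v) \<partial>lborel)"
    by (simp add: interval_lebesgue_integral_def set_lebesgue_integral_def einterval_def)
  also have "\<dots> = (bessel_integral (1/2) z + bessel_integral (- (1/2)) z) / 2"
    unfolding kern bessel_integral_def using integrable_bessel_kernel[OF z] by simp
  also have "\<dots> = bessel_integral (1/2) z" by (simp only: bessel_integral_minus) simp
  also have "(\<integral>y. f y \<partial>lborel) = csqrt (of_real pi / z) * exp (- 2 * z)"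
    unfolding f_def integral_mult_right_zero using gaussian_fourier[OF z, of 0] by simp
  finally show ?thesis by (rule sym)
qed

text \<open>The derivative of \<open>bessel_kernel \<mu> z\<close> combines the kernels of orders
  \<mu> and \<mu> +- 1, and its integral vanishes because the kernel tends to 0 at both ends.
  Classically, K_(\<mu>+1)(x) - K_(\<mu>-1)(x) = (2 \<mu> / x) K_\<mu>(x) at x = 2 z.\<close>

lemma bessel_integral_recurrence:
  assumes z: "Re z > 0"
  shows "bessel_integral (\<mu> + 1) z = bessel_integral (\<mu> - 1) z + \<mu> / z * bessel_integral \<mu> z"
proof -
  define F where "F = bessel_kernel \<mu> z"
  define f where "f = (\<lambda>v. \<mu> * bessel_kernel \<mu> z v - z * bessel_kernel (\<mu> + 1) z v + z * bessel_kernel (\<mu> - 1) z v)"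
  have int: "integrable lborel (bessel_kernel \<mu> z)" for \<mu> by (rule integrable_bessel_kernel[OF z])
  have intf: "integrable lborel f"
    unfolding f_def by (intro Bochner_Integration.integrable_add Bochner_Integration.integrable_diff integrable_mult_right int)
  have lim: "((\<lambda>v. exp (Re \<mu> * v - Re z * (exp v + exp (- v)))) \<longlongrightarrow> 0) at_top"
            "((\<lambda>v. exp (Re \<mu> * v - Re z * (exp v + exp (- v)))) \<longlongrightarrow> 0) at_bot"
    using z by real_asymp+
  have "(LBINT v=-\<infinity>..\<infinity>. f v) = 0 - 0"
  proof (rule interval_integral_FTC_integrable)
    show "(F has_vector_derivative f v) (at v)" for v
    proof -
      have "exp ((\<mu> + 1) * of_real v) = exp (\<mu> * of_real v) * exp (of_real v)"
           "exp ((\<mu> - 1) * of_real v) = exp (\<mu> * of_real v) * exp (- of_real v)"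
        by (simp_all add: algebra_simps flip: exp_add)
      hence "f v = (\<mu> - z * (exp (of_real v) - exp (- of_real v))) * bessel_kernel \<mu> z v"
        unfolding f_def bessel_kernel_eq by (simp add: algebra_simps)
      hence fv: "f v = (\<mu> - z * (exp (of_real v) - exp (- of_real v))) * exp (\<mu> * of_real v - z * (exp (of_real v) + exp (- of_real v)))"
        by (simp add: bessel_kernel_def flip: exp_of_real)
      have "((\<lambda>x. exp (\<mu> * x - z * (exp x + exp (- x)))) has_field_derivative f v) (at (of_real v))"
        unfolding fv by (auto intro!: derivative_eq_intros)
      from has_vector_derivative_real_field[OF this] show ?thesis
        by (simp add: F_def bessel_kernel_def[abs_def] exp_of_real[symmetric] flip: of_real_minus)
    qed
    show "isCont f v" for v
      unfolding f_def using continuous_bessel_kernel[of UNIV]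
      by (intro continuous_intros) (auto simp: continuous_on_eq_continuous_at)
    show "set_integrable lborel (einterval (-\<infinity>) \<infinity>) f" using intf by (simp add: set_integrable_def)
    show "((F \<circ> real_of_ereal) \<longlongrightarrow> 0) (at_left \<infinity>)" "((F \<circ> real_of_ereal) \<longlongrightarrow> 0) (at_right (-\<infinity>))"
      unfolding ereal_tendsto_simps F_def
      by (rule tendsto_norm_zero_cancel, unfold norm_bessel_kernel, rule lim)+
  qed auto
  hence "(\<integral>v. f v \<partial>lborel) = 0"
    by (simp add: interval_lebesgue_integral_def set_lebesgue_integral_def einterval_def)
  also have "(\<integral>v. f v \<partial>lborel) = \<mu> * bessel_integral \<mu> z - z * bessel_integral (\<mu> + 1) z + z * bessel_integral (\<mu> - 1) z"
    unfolding f_def bessel_integral_def using int by simp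
  finally have "z * bessel_integral (\<mu> + 1) z = z * bessel_integral (\<mu> - 1) z + \<mu> * bessel_integral \<mu> z"
    by (simp add: algebra_simps)
  hence "z * bessel_integral (\<mu> + 1) z / z = (z * bessel_integral (\<mu> - 1) z + \<mu> * bessel_integral \<mu> z) / z" by simp
  moreover have "z \<noteq> 0" using z by auto
  ultimately show ?thesis by (simp add: add_divide_distrib)
qed

text \<open>As an interval product the coefficient needs no case distinction: the interval is empty
  for k = 0, and for k > l it contains 0. For k <= l the value is (l+k)! / ((l-k)! k! 2^k), a
  coefficient of the l-th Bessel polynomial.\<close>

lemma cco_eq_prod: "cco l k = (\<Prod>i\<in>{int l + 1 - int k..int l + int k}. real_of_int i) / (2 ^ k * fact k)"
proof -
  have "(\<Prod>j\<in>{1 - int k..int k}. real_of_int (int l + j)) = (\<Prod>i\<in>{int l + 1 - int k..int l + int k}. real_of_int i)"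
    by (rule prod.reindex_bij_witness[of _ "\<lambda>i. i - int l" "\<lambda>j. int l + j"]) auto
  thus ?thesis by (cases "k = 0") (simp_all add: cco_def)
qed

lemma cco_0 [simp]: "cco l 0 = 1"
  by (simp add: cco_def)

lemma cco_eq_0: "k > l \<Longrightarrow> cco l k = 0"
  unfolding cco_eq_prod by (auto intro!: bexI[of _ 0])

text \<open>All three products share the factors from \<open>a\<close> to \<open>b\<close>. The two
  extra factors on either side are related by (b+2)(b+1) - (a-2)(a-1) = 2 (k+1) (2l+3), and 2 (k+1)
  is the quotient of the denominators.\<close>

lemma cco_recurrence: "cco (l + 2) (Suc k) = cco l (Suc k) + real (2 * l + 3) * cco (l + 1) k"
proof -
  define a b where "a = int l + 2 - int k" and "b = int l + 1 + int k"
  define A where "A = (\<Prod>i\<in>{a..b}. real_of_int i)"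
  \<comment> \<open>For k = 0 the common interval is empty and a = b + 1. This inequality is just
    enough for the interval decompositions below.\<close>
  have ab: "a \<le> b + 1" by (simp add: a_def b_def)
  have A0: "cco (l + 1) k = A / (2 ^ k * fact k)"
    by (simp add: cco_eq_prod A_def a_def b_def algebra_simps)
  have "{a..b + 2} = insert (b + 2) (insert (b + 1) {a..b})" using ab by auto
  hence "(\<Prod>i\<in>{a..b + 2}. real_of_int i) = real_of_int (b + 2) * (real_of_int (b + 1) * A)"
    by (simp add: A_def)
  moreover have "cco (l + 2) (Suc k) = (\<Prod>i\<in>{a..b + 2}. real_of_int i) / (2 ^ Suc k * fact (Suc k))"
    by (simp only: cco_eq_prod) (simp add: a_def b_def algebra_simps)
  ultimately have 1: "cco (l + 2) (Suc k) = real_of_int ((b + 2) * (b + 1)) * A / (2 ^ Suc k * fact (Suc k))"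
    by simp
  have "{a - 2..b} = insert (a - 2) (insert (a - 1) {a..b})" using ab by auto
  hence "(\<Prod>i\<in>{a - 2..b}. real_of_int i) = real_of_int (a - 2) * (real_of_int (a - 1) * A)"
    by (simp add: A_def)
  moreover have "cco l (Suc k) = (\<Prod>i\<in>{a - 2..b}. real_of_int i) / (2 ^ Suc k * fact (Suc k))"
    by (simp only: cco_eq_prod) (simp add: a_def b_def algebra_simps)
  ultimately have 2: "cco l (Suc k) = real_of_int ((a - 2) * (a - 1)) * A / (2 ^ Suc k * fact (Suc k))"
    by simp
  have "(b + 2) * (b + 1) = (a - 2) * (a - 1) + int (2 * l + 3) * (2 * int (Suc k))"
    by (simp add: a_def b_def algebra_simps)
  hence "real_of_int ((b + 2) * (b + 1)) = real_of_int ((a - 2) * (a - 1)) + real (2 * l + 3) * (2 * real (Suc k))"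
    by (metis (mono_tags) of_int_add of_int_mult of_int_numeral of_int_of_nat_eq)
  moreover have "A / (2 ^ k * fact k) = 2 * real (Suc k) * A / (2 ^ Suc k * fact (Suc k))"
    by (simp del: of_nat_Suc)
  moreover have "(x + y * (2 * t)) * A / d = x * A / d + y * (2 * t * A / d)" for x y t d :: real
    by (simp add: distrib_right add_divide_distrib)
  ultimately show ?thesis unfolding A0 1 2 by metis
qed

text \<open>The recurrence y_(l+2) = y_l + (2l+3) x y_(l+1) of the Bessel polynomials, compared
  coefficientwise; y_l is padded with its vanishing coefficients so that all sums have the same
  range.\<close>

lemma sum_cco_recurrence:
  fixes x :: complex
  shows "(\<Sum>k\<le>l + 2. of_real (cco (l + 2) k) * x ^ k) =
           (\<Sum>k\<le>l. of_real (cco l k) * x ^ k) + of_nat (2 * l + 3) * x * (\<Sum>k\<le>l + 1. of_real (cco (l + 1) k) * x ^ k)"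
proof -
  have ext: "(\<Sum>k\<le>l. of_real (cco l k) * x ^ k) = 1 + (\<Sum>k\<le>l + 1. of_real (cco l (Suc k)) * x ^ Suc k)"
  proof -
    have "(\<Sum>k\<le>l. of_real (cco l k) * x ^ k) = (\<Sum>k\<le>Suc (l + 1). of_real (cco l k) * x ^ k)"
      by (rule sum.mono_neutral_left) (auto simp: cco_eq_0)
    also have "\<dots> = 1 + (\<Sum>k\<le>l + 1. of_real (cco l (Suc k)) * x ^ Suc k)"
      by (subst sum.atMost_Suc_shift) simp
    finally show ?thesis .
  qed
  have "(\<Sum>k\<le>l + 2. of_real (cco (l + 2) k) * x ^ k) = 1 + (\<Sum>k\<le>l + 1. of_real (cco (l + 2) (Suc k)) * x ^ Suc k)"
    using sum.atMost_Suc_shift[of "\<lambda>k. of_real (cco (l + 2) k) * x ^ k" "l + 1"] by simp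
  also have "(\<Sum>k\<le>l + 1. of_real (cco (l + 2) (Suc k)) * x ^ Suc k) =
     (\<Sum>k\<le>l + 1. of_real (cco l (Suc k)) * x ^ Suc k) + of_nat (2 * l + 3) * x * (\<Sum>k\<le>l + 1. of_real (cco (l + 1) k) * x ^ k)"
    unfolding cco_recurrence sum_distrib_left sum.distrib[symmetric]
    by (intro sum.cong refl) (simp add: algebra_simps)
  finally show ?thesis unfolding ext by simp
qed

text \<open>The recurrence in the order \<mu> = l + 3/2 is the recurrence of the Bessel polynomials
  at x = 1 / (2 z). The base case 3/2 uses that the orders -1/2 and 1/2 give the same
  integral.\<close>

lemma bessel_integral_half_odd:
  assumes z: "Re z > 0"
  shows "bessel_integral (of_nat l + 1/2) z =
           csqrt (of_real pi / z) * exp (- 2 * z) * (\<Sum>k\<le>l. of_real (cco l k) * (1 / (2 * z)) ^ k)"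
proof (induction l rule: induct_nat_012)
  case 0
  show ?case using bessel_integral_half[OF z] by simp
next
  case 1
  have c: "cco 1 1 = 1"
  proof -
    have "{1..2::int} = {1, 2}" by auto
    thus ?thesis by (simp add: cco_eq_prod)
  qed
  have "bessel_integral (1/2 + 1) z = bessel_integral (1/2 - 1) z + (1/2) / z * bessel_integral (1/2) z"
    by (rule bessel_integral_recurrence[OF z])
  also have "bessel_integral (1/2 - 1) z = bessel_integral (1/2) z"
    using bessel_integral_minus[of "1/2" z] by simp
  finally have "bessel_integral (1/2 + 1) z = bessel_integral (1/2) z * (1 + 1 / (2 * z))"
    by (simp add: algebra_simps)
  thus ?case using c by (simp add: bessel_integral_half[OF z] add.commute)
next
  case (ge2 l)
  let ?C = "csqrt (of_real pi / z) * exp (- 2 * z)"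
  let ?x = "1 / (2 * z)"
  have "bessel_integral (of_nat (Suc l) + 1/2 + 1) z = bessel_integral (of_nat (Suc l) + 1/2 - 1) z +
      (of_nat (Suc l) + 1/2) / z * bessel_integral (of_nat (Suc l) + 1/2) z"
    by (rule bessel_integral_recurrence[OF z])
  also have "of_nat (Suc l) + 1/2 - 1 = (of_nat l + 1/2 :: complex)" by simp
  also have "(of_nat (Suc l) + 1/2) / z = of_nat (2 * l + 3) * ?x"
    by (simp add: field_simps)
  also have "of_nat (Suc l) + 1/2 + 1 = (of_nat (Suc (Suc l)) + 1/2 :: complex)" by simp
  finally have "bessel_integral (of_nat (Suc (Suc l)) + 1/2) z =
      ?C * ((\<Sum>k\<le>l. of_real (cco l k) * ?x ^ k) + of_nat (2 * l + 3) * ?x * (\<Sum>k\<le>l + 1. of_real (cco (l + 1) k) * ?x ^ k))"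
    unfolding ge2 by (simp only: distrib_left mult_ac Suc_eq_plus1)
  thus ?case unfolding sum_cco_recurrence[symmetric] by simp
qed

text \<open>Descend from Gamma (1/2) = sqrt pi by Gamma (x + 1) = x Gamma x. In the induction step
  two more factors sqrt pi give pi, and 1 / x gives -2 / (2l+3).\<close>

lemma Gamma_minus_half_odd:
  "of_real (sqrt pi) ^ (2 * l + 1) * Gamma (- (of_nat (2 * l + 1) / 2)) = complex_of_real ((- 2 * pi) ^ (l + 1) / odd_dfact l)"
proof (induction l)
  case 0
  have p2: "complex_of_real (sqrt pi) * of_real (sqrt pi) = of_real pi" by (simp flip: of_real_mult)
  have "Gamma (- (1/2) + 1 :: complex) = - (1/2) * Gamma (- (1/2))"
    using minus_half_odd_notin_nonpos_Ints[of 1] by (intro Gamma_plus1) simp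
  hence "Gamma (- (1/2) :: complex) = - 2 * of_real (sqrt pi)"
    using Gamma_one_half_complex by simp
  thus ?case using p2 by (simp add: odd_dfact_def mult.left_commute)
next
  case (Suc l)
  have p2: "complex_of_real (sqrt pi) * (of_real (sqrt pi) * w) = of_real pi * w" for w
    by (simp flip: of_real_mult mult.assoc)
  let ?x = "- (of_nat (2 * Suc l + 1) / 2) :: complex"
  have x: "?x = of_real (- (real (2 * l + 3) / 2))" by simp
  have "?x \<notin> \<int>\<^sub>\<le>\<^sub>0"
    using minus_half_odd_notin_nonpos_Ints[of "2 * Suc l + 1"] by simp
  hence "Gamma (?x + 1) = ?x * Gamma ?x" by (rule Gamma_plus1)
  moreover have "?x + 1 = - (of_nat (2 * l + 1) / 2)" by (simp add: field_simps)
  moreover have x0: "?x \<noteq> 0" unfolding x of_real_eq_0_iff by simp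
  ultimately have G: "Gamma ?x = Gamma (- (of_nat (2 * l + 1) / 2)) / ?x" by simp
  have "of_real (sqrt pi) ^ (2 * Suc l + 1) * Gamma ?x =
     of_real ((sqrt pi)\<^sup>2) * (of_real (sqrt pi) ^ (2 * l + 1) * Gamma (- (of_nat (2 * l + 1) / 2))) / ?x"
    unfolding G by (simp add: p2 power2_eq_square power_add mult_ac)
  also have "\<dots> = of_real (pi * ((- 2 * pi) ^ (l + 1) / odd_dfact l) / (- (real (2 * l + 3) / 2)))"
    unfolding Suc.IH x of_real_divide of_real_mult by simp
  also have "pi * ((- 2 * pi) ^ (l + 1) / odd_dfact l) / (- (real (2 * l + 3) / 2)) = (- 2 * pi) ^ (Suc l + 1) / odd_dfact (Suc l)"
    by (simp add: odd_dfact_def divide_simps)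
  finally show ?case .
qed

text \<open>Translating v by ln c balances the two exponentials: exp v and c^2 exp (- v) become c
  exp v and c exp (- v).\<close>

lemma integral_kernel_eq_bessel_integral:
  assumes c: "c > 0"
  shows "(\<integral>v. exp (\<mu> * of_real v - s * of_real (exp v)) * exp (- s * of_real (c\<^sup>2 * exp (- v))) \<partial>lborel)
           = exp (\<mu> * of_real (ln c)) * bessel_integral \<mu> (s * of_real c)"
proof -
  have "(\<integral>v. exp (\<mu> * of_real v - s * of_real (exp v)) * exp (- s * of_real (c\<^sup>2 * exp (- v))) \<partial>lborel)
      = \<bar>1\<bar> *\<^sub>R (\<integral>v. exp (\<mu> * of_real (ln c + 1 * v) - s * of_real (exp (ln c + 1 * v))) * exp (- s * of_real (c\<^sup>2 * exp (- (ln c + 1 * v)))) \<partial>lborel)"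
    by (rule lborel_integral_real_affine) simp
  also have "\<dots> = (\<integral>v. exp (\<mu> * of_real (ln c)) * bessel_kernel \<mu> (s * of_real c) v \<partial>lborel)"
  proof -
    have "- ln c - v = - v - ln c" for v by simp
    hence "exp (- ln c - v) = exp (- v) / c" for v by (simp only: exp_diff exp_ln[OF c])
    hence e: "exp (ln c + 1 * v) = c * exp v" "c\<^sup>2 * exp (- (ln c + 1 * v)) = c * exp (- v)" for v
      using c by (simp_all add: exp_add power2_eq_square)
    show ?thesis
      unfolding e bessel_kernel_def exp_add[symmetric] abs_one scaleR_one
      by (intro Bochner_Integration.integral_cong arg_cong[where f = exp] refl) (simp add: algebra_simps)
  qed
  finally show ?thesis unfolding bessel_integral_def integral_mult_right_zero .
qed

text \<open>With c = pi |n|, each dual term is a Bessel integral at s c, of order -\<nu>/2 and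
  hence, by reflection, of order l + 1/2. The roots of s cancel, and the roots of c combine to an
  integral power, so that s^l / |n|^(l+1) times a Bessel polynomial remains.\<close>

lemma zeta_reg_prod_odd_lattice:
  fixes l :: nat and \<alpha> :: "nat \<Rightarrow> real" and s :: complex
  assumes s: "Re s > 0"
  defines "\<nu> \<equiv> 2 * l + 1"
  shows "zeta_reg_prod (lattice \<nu>) (\<lambda>m. complex_of_real (sqnorm_shift \<nu> m \<alpha>) + s\<^sup>2) =
     exp (- complex_of_real ((-2*pi)^(l+1) / odd_dfact l) * s^\<nu>
        - (\<Sum>\<^sub>\<infinity>n\<in>lattice \<nu> - {\<lambda>_. 0}.
             complex_of_real (1 / lnorm \<nu> n ^ (l+1)) *
             (\<Sum>k\<le>l. complex_of_real (cco l k / (2*pi*lnorm \<nu> n)^k) * s^(l-k))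
             * exp (\<i> * complex_of_real (2*pi*ldot \<nu> n \<alpha>))
             * exp (- complex_of_real (2*pi*lnorm \<nu> n) * s)))"
    (is "_ = exp (_ - (\<Sum>\<^sub>\<infinity>n\<in>?L. ?T n))")
proof -
  have ne: "s \<noteq> 0" using s by auto
  let ?h = "of_real (sqrt pi) * csqrt s"
  let ?\<mu> = "- (of_nat \<nu> / 2) :: complex"
  have sq: "csqrt s ^ \<nu> * csqrt s ^ \<nu> = s ^ \<nu>"
    by (metis power2_csqrt power2_eq_square power_mult_distrib)
  have term_eq: "?h ^ \<nu> * (\<integral>v. exp (?\<mu> * of_real v - s * of_real (exp v)) * theta_term \<nu> \<alpha> s n v \<partial>lborel) = ?T n"
    if n: "n \<in> ?L" for n
  proof -
    define r where "r = lnorm \<nu> n"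
    have r: "r > 0" using lnorm_ge_1[OF n] by (simp add: r_def)
    define c where "c = pi * r"
    have c: "c > 0" using r by (simp add: c_def)
    define \<epsilon> where "\<epsilon> = exp (\<i> * complex_of_real (2*pi*ldot \<nu> n \<alpha>))"
    define Q where "Q = (\<Sum>k\<le>l. of_real (cco l k) * (1 / (2 * (s * of_real c))) ^ k)"
    define E where "E = exp (- 2 * (s * of_real c))"
    have sc: "Re (s * of_real c) > 0" using s c by simp
    have "(\<integral>v. exp (?\<mu> * of_real v - s * of_real (exp v)) * theta_term \<nu> \<alpha> s n v \<partial>lborel)
        = (\<integral>v. \<epsilon> * (exp (?\<mu> * of_real v - s * of_real (exp v)) * exp (- s * of_real (c\<^sup>2 * exp (- v)))) \<partial>lborel)"
      by (simp add: theta_term_def c_def \<epsilon>_def r_def power_mult_distrib mult_ac)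
    also have "\<dots> = \<epsilon> * (exp (?\<mu> * of_real (ln c)) * bessel_integral ?\<mu> (s * of_real c))"
      unfolding integral_mult_right_zero integral_kernel_eq_bessel_integral[OF c] ..
    also have "bessel_integral ?\<mu> (s * of_real c) = bessel_integral (of_nat l + 1/2) (s * of_real c)"
    proof -
      have "of_nat \<nu> / 2 = (of_nat l + 1/2 :: complex)" by (simp add: \<nu>_def field_simps)
      thus ?thesis by (simp only: bessel_integral_minus)
    qed
    also have "\<dots> = csqrt (of_real pi / (s * of_real c)) * E * Q"
      unfolding bessel_integral_half_odd[OF sc] E_def Q_def ..
    finally have J: "(\<integral>v. exp (?\<mu> * of_real v - s * of_real (exp v)) * theta_term \<nu> \<alpha> s n v \<partial>lborel)
        = \<epsilon> * (exp (?\<mu> * of_real (ln c)) * (csqrt (of_real pi / (s * of_real c)) * E * Q))" .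
    \<comment> \<open>Since Re (1 / csqrt s) > 0, the principal root of pi / (s c) is sqrt (pi / c)
      / csqrt s, so the roots of s cancel without a sign.\<close>
    have hcsq: "?h * csqrt (of_real pi / (s * of_real c)) = of_real (pi / sqrt c)"
    proof -
      have "Re s = (Re (csqrt s))\<^sup>2 - (Im (csqrt s))\<^sup>2" by (metis Re_power2 power2_csqrt)
      hence "(Re (csqrt s))\<^sup>2 > 0" using s zero_le_power2[of "Im (csqrt s)"] by linarith
      hence "Re (csqrt s) > 0" using csqrt_principal[of s] by (metis less_irrefl zero_power2)
      hence pos: "Re (1 / csqrt s) > 0" by (rule Re_inverse_pos)
      have "csqrt (of_real pi / (s * of_real c)) = of_real (sqrt (pi / c)) * (1 / csqrt s)"
      proof (rule csqrt_unique)
        have "(of_real (sqrt (pi / c)))\<^sup>2 = complex_of_real (pi / c)"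
          using c by (simp flip: of_real_power)
        thus "(of_real (sqrt (pi / c)) * (1 / csqrt s))\<^sup>2 = of_real pi / (s * of_real c)"
          by (simp add: power_mult_distrib power_divide mult_ac)
        have "sqrt (pi / c) > 0" using c by simp
        thus "0 < Re (of_real (sqrt (pi / c)) * (1 / csqrt s)) \<or>
          Re (of_real (sqrt (pi / c)) * (1 / csqrt s)) = 0 \<and> 0 \<le> Im (of_real (sqrt (pi / c)) * (1 / csqrt s))"
          using pos by (metis Re_complex_of_real mult_pos_pos times_complex.simps(1) Im_complex_of_real mult_zero_left diff_zero)
      qed
      hence "?h * csqrt (of_real pi / (s * of_real c)) = of_real (sqrt pi * sqrt (pi / c))"
        using ne by simp
      also have "sqrt pi * sqrt (pi / c) = pi / sqrt c" using c by (simp add: real_sqrt_divide)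
      finally show ?thesis .
    qed
    have h\<nu>: "?h ^ \<nu> = (of_real pi * s) ^ l * ?h"
      unfolding \<nu>_def by (simp add: power_mult power_mult_distrib flip: of_real_power)
    have "exp (ln c * (real l + 1/2)) = exp (real l * ln c) * exp (1/2 * ln c)"
      by (simp add: algebra_simps flip: exp_add)
    also have "\<dots> = c ^ l * sqrt c"
      using c by (simp add: powr_half_sqrt[symmetric] powr_realpow[symmetric] powr_def)
    finally have lnc: "exp (ln c * (real l + 1/2)) = c ^ l * sqrt c" .
    have expc: "exp (?\<mu> * of_real (ln c)) = of_real (1 / (c ^ l * sqrt c))"
    proof -
      have "?\<mu> * of_real (ln c) = of_real (- (ln c * (real l + 1/2)))"
        by (simp add: \<nu>_def field_simps)
      thus ?thesis by (simp only: exp_of_real exp_minus inverse_eq_divide lnc)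
    qed
    have "?h ^ \<nu> * (\<epsilon> * (exp (?\<mu> * of_real (ln c)) * (csqrt (of_real pi / (s * of_real c)) * E * Q)))
       = (of_real pi * s) ^ l * of_real (1 / (c ^ l * sqrt c)) * (?h * csqrt (of_real pi / (s * of_real c))) * Q * \<epsilon> * E"
      unfolding h\<nu> expc by (simp only: mult_ac)
    also have "(of_real pi * s) ^ l * of_real (1 / (c ^ l * sqrt c)) * (?h * csqrt (of_real pi / (s * of_real c)))
       = of_real (pi ^ l * (1 / (c ^ l * sqrt c)) * (pi / sqrt c)) * s ^ l"
      unfolding hcsq by (simp add: power_mult_distrib)
    also have "pi ^ l * (1 / (c ^ l * sqrt c)) * (pi / sqrt c) = 1 / r ^ (l + 1)"
    proof -
      have "pi ^ l * (1 / (c ^ l * sqrt c)) * (pi / sqrt c) = pi ^ (l + 1) / (c ^ l * (sqrt c * sqrt c))"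
      proof -
        have "x * (1 / (y * t)) * (u / t) = x * u / (y * (t * t))" for x y t u :: real by simp
        thus ?thesis by (simp only: power_add power_one_right)
      qed
      also have "sqrt c * sqrt c = c" using c by simp
      also have "pi ^ (l + 1) / (c ^ l * c) = 1 / r ^ (l + 1)" using r by (simp add: c_def power_mult_distrib)
      finally show ?thesis .
    qed
    also have "of_real (1 / r ^ (l + 1)) * s ^ l * Q = of_real (1 / r ^ (l + 1)) *
        (\<Sum>k\<le>l. complex_of_real (cco l k / (2*pi*r)^k) * s^(l-k))"
    proof -
      have "s ^ l * Q = (\<Sum>k\<le>l. complex_of_real (cco l k / (2*pi*r)^k) * s^(l-k))"
        unfolding Q_def sum_distrib_left
      proof (rule sum.cong[OF refl])
        fix k assume "k \<in> {..l}"
        hence "s ^ l = s ^ (l - k) * s ^ k" by (simp flip: power_add)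
        thus "s ^ l * (of_real (cco l k) * (1 / (2 * (s * of_real c))) ^ k) = complex_of_real (cco l k / (2*pi*r)^k) * s^(l-k)"
          using ne by (simp add: c_def power_divide power_mult_distrib mult_ac)
      qed
      thus ?thesis by (simp only: mult.assoc)
    qed
    finally have fin: "?h ^ \<nu> * (\<epsilon> * (exp (?\<mu> * of_real (ln c)) * (csqrt (of_real pi / (s * of_real c)) * E * Q)))
      = of_real (1 / r ^ (l + 1)) * (\<Sum>k\<le>l. complex_of_real (cco l k / (2*pi*r)^k) * s^(l-k)) * \<epsilon> * E" .
    have "E = exp (- complex_of_real (2*pi*r) * s)"
      by (simp add: E_def c_def mult_ac)
    thus ?thesis using fin unfolding J \<epsilon>_def r_def by simp
  qed
  have odd: "odd \<nu>" by (simp add: \<nu>_def)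
  have first: "?h ^ \<nu> * (Gamma ?\<mu> * csqrt s ^ \<nu>) = complex_of_real ((-2*pi)^(l+1) / odd_dfact l) * s ^ \<nu>"
  proof -
    have "?h ^ \<nu> * (Gamma ?\<mu> * csqrt s ^ \<nu>) = (of_real (sqrt pi) ^ \<nu> * Gamma ?\<mu>) * (csqrt s ^ \<nu> * csqrt s ^ \<nu>)"
      by (simp only: power_mult_distrib mult_ac)
    also have "of_real (sqrt pi) ^ \<nu> * Gamma ?\<mu> = complex_of_real ((-2*pi)^(l+1) / odd_dfact l)"
      unfolding \<nu>_def by (rule Gamma_minus_half_odd)
    finally show ?thesis unfolding sq .
  qed
  have second: "?h ^ \<nu> * theta_mellin \<nu> \<alpha> s ?\<mu> = (\<Sum>\<^sub>\<infinity>n\<in>?L. ?T n)"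
    unfolding theta_mellin_def[OF s] integral_kernel_punctured_theta[OF s] infsum_cmult_right'[symmetric]
    by (rule infsum_cong) (rule term_eq)
  show ?thesis
    unfolding zeta_reg_prod_lattice[OF s odd] distrib_left first second
    by (rule arg_cong[where f = exp]) simp
qed

section \<open>The one-dimensional case\<close>

lemma zeta_cont_reindex:
  assumes "bij_betw h B A"
  shows "zeta_cont A a Z \<longleftrightarrow> zeta_cont B (\<lambda>x. a (h x)) Z"
  unfolding zeta_cont_def
  using summable_on_reindex_bij_betw[OF assms, of "\<lambda>n. norm (a n powr - w)" for w]
        infsum_reindex_bij_betw[OF assms, of "\<lambda>n. a n powr - w" for w]
  by simp

lemma bij_betw_lattice_1: "bij_betw (\<lambda>k j. if j = 0 then k else 0) (UNIV :: int set) (lattice 1)"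
  by (rule bij_betw_byWitness[where f' = "\<lambda>m. m 0"]) (auto simp: lattice_def fun_eq_iff)

lemma log_series:
  fixes q :: complex
  assumes "norm q < 1"
  shows "(\<lambda>n. q ^ Suc n / of_nat (Suc n)) sums (- Ln (1 - q))"
    and "(\<lambda>n. norm (q ^ Suc n / of_nat (Suc n))) summable_on UNIV"
proof -
  have "(\<lambda>n. - ((- (- q)) ^ n) / of_nat n) sums ln (1 + - q)"
    by (rule Ln_series') (use assms in simp)
  from sums_minus[OF this] have "(\<lambda>n. q ^ n / of_nat n) sums (- Ln (1 - q))" by simp
  thus "(\<lambda>n. q ^ Suc n / of_nat (Suc n)) sums (- Ln (1 - q))"
    \<comment> \<open>The term at n = 0 is 1 / 0 = 0 by convention, so the shifted series has the
      same sum.\<close>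
    by (subst sums_Suc_iff) simp
  have "summable (\<lambda>n. norm (q ^ Suc n / of_nat (Suc n)))"
  proof (rule summable_comparison_test)
    show "summable (\<lambda>n. norm q ^ n)" using assms by (simp add: summable_geometric)
    show "\<exists>N. \<forall>n\<ge>N. norm (norm (q ^ Suc n / of_nat (Suc n))) \<le> norm q ^ n"
    proof (intro exI allI impI)
      fix n
      have "norm (q ^ Suc n) / real (Suc n) \<le> norm (q ^ Suc n) / 1"
        by (rule divide_left_mono) auto
      also have "\<dots> \<le> norm q ^ n" using assms by (simp add: norm_mult norm_power mult_left_le_one_le)
      finally show "norm (norm (q ^ Suc n / of_nat (Suc n))) \<le> norm q ^ n"
        by (simp add: norm_divide del: of_nat_Suc)
    qed
  qed
  thus "(\<lambda>n. norm (q ^ Suc n / of_nat (Suc n))) summable_on UNIV"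
    by (subst summable_on_UNIV_nonneg_real_iff) auto
qed

text \<open>Positive and negative n give the logarithmic series in \<open>p\<close> and in
  \<open>q\<close>, both of modulus exp (- 2 pi Re z). Pairing n with -n instead gives the cosine
  series, since exp (i x) + exp (- i x) = 2 cos x.\<close>

lemma lattice_1_sum:
  fixes \<beta> :: real and z :: complex
  assumes z: "Re z > 0"
  defines "p \<equiv> exp (2*complex_of_real pi*\<i>*complex_of_real \<beta>) * exp (-2*complex_of_real pi*z)"
    and "q \<equiv> exp (-2*complex_of_real pi*\<i>*complex_of_real \<beta>) * exp (-2*complex_of_real pi*z)"
  shows "(\<Sum>\<^sub>\<infinity>n\<in>lattice 1 - {\<lambda>_. 0}.
             complex_of_real (1 / lnorm 1 n) * exp (\<i> * complex_of_real (2*pi*ldot 1 n (\<lambda>_. \<beta>)))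
             * exp (- complex_of_real (2*pi*lnorm 1 n) * z)) = - Ln (1 - p) - Ln (1 - q)" (is "infsum ?T _ = _")
    and "2 * (\<Sum>n. complex_of_real (cos (2*pi*real (Suc n)*\<beta>) / real (Suc n))
                                  * exp (- 2*complex_of_real pi* of_nat (Suc n)*z)) = - Ln (1 - p) - Ln (1 - q)"
    and "norm p < 1" "norm q < 1"
proof -
  have np: "norm p < 1" and nq: "norm q < 1"
    unfolding p_def q_def norm_mult norm_exp_eq_Re using z by auto
  show "norm p < 1" "norm q < 1" by (fact np nq)+
  have pn: "p ^ n = exp (\<i> * of_real (2 * pi * (real n * \<beta>))) * exp (- of_real (2 * pi * real n) * z)" for n
    unfolding p_def power_mult_distrib exp_of_nat_mult[symmetric] by (simp add: mult_ac)
  have qn: "q ^ n = exp (\<i> * of_real (2 * pi * (- real n * \<beta>))) * exp (- of_real (2 * pi * real n) * z)" for n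
    unfolding q_def power_mult_distrib exp_of_nat_mult[symmetric] by (simp add: mult_ac)
  let ?e = "\<lambda>k j. if j = 0 then k else 0 :: int"
  have bij: "bij_betw ?e (UNIV - {0}) (lattice 1 - {\<lambda>_. 0})"
    by (rule bij_betw_DiffI[OF bij_betw_lattice_1]) (auto simp: bij_betw_def lattice_def)
  have split: "UNIV - {0::int} = range (\<lambda>n. int (Suc n)) \<union> range (\<lambda>n. - int (Suc n))"
  proof -
    have "k \<in> range (\<lambda>n. int (Suc n)) \<union> range (\<lambda>n. - int (Suc n))" if "k \<noteq> 0" for k :: int
    proof (cases "k > 0")
      case True
      hence "k = int (Suc (nat k - 1))" by simp
      thus ?thesis by blast
    next
      case False
      hence "k = - int (Suc (nat (- k) - 1))" using that by simp
      thus ?thesis by blast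
    qed
    thus ?thesis by auto
  qed
  have Tp: "?T (?e (int (Suc n))) = p ^ Suc n / of_nat (Suc n)" for n
    unfolding pn by (simp add: lnorm_def ldot_def)
  have Tq: "?T (?e (- int (Suc n))) = q ^ Suc n / of_nat (Suc n)" for n
    unfolding qn by (simp add: lnorm_def ldot_def add.commute)
  have inj: "inj (\<lambda>n. int (Suc n))" "inj (\<lambda>n. - int (Suc n))" by (auto simp: inj_def)
  have sp: "((\<lambda>k. ?T (?e k)) has_sum (- Ln (1 - p))) (range (\<lambda>n. int (Suc n)))"
    unfolding has_sum_reindex[OF inj(1)] o_def Tp
    by (rule norm_summable_imp_has_sum[OF _ log_series(1)[OF np]])
       (use log_series(2)[OF np] in \<open>simp add: summable_on_UNIV_nonneg_real_iff\<close>)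
  have sq: "((\<lambda>k. ?T (?e k)) has_sum (- Ln (1 - q))) (range (\<lambda>n. - int (Suc n)))"
    unfolding has_sum_reindex[OF inj(2)] o_def Tq
    by (rule norm_summable_imp_has_sum[OF _ log_series(1)[OF nq]])
       (use log_series(2)[OF nq] in \<open>simp add: summable_on_UNIV_nonneg_real_iff\<close>)
  have "((\<lambda>k. ?T (?e k)) has_sum (- Ln (1 - p) + - Ln (1 - q))) (UNIV - {0})"
    unfolding split by (rule has_sum_Un_disjoint[OF sp sq]) auto
  hence "(\<Sum>\<^sub>\<infinity>k\<in>UNIV - {0}. ?T (?e k)) = - Ln (1 - p) + - Ln (1 - q)" by (rule infsumI)
  thus "infsum ?T (lattice 1 - {\<lambda>_. 0}) = - Ln (1 - p) - Ln (1 - q)"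
    using infsum_reindex_bij_betw[OF bij, of ?T] by simp
  have "(\<lambda>n. p ^ Suc n / of_nat (Suc n) + q ^ Suc n / of_nat (Suc n)) sums (- Ln (1 - p) + - Ln (1 - q))"
    by (intro sums_add log_series np nq)
  also have "(\<lambda>n. p ^ Suc n / of_nat (Suc n) + q ^ Suc n / of_nat (Suc n)) =
     (\<lambda>n. 2 * (complex_of_real (cos (2*pi*real (Suc n)*\<beta>) / real (Suc n)) * exp (- 2*complex_of_real pi* of_nat (Suc n)*z)))"
  proof
    fix n
    define N where "N = Suc n"
    define x where "x = 2*pi*real N*\<beta>"
    have "2 * complex_of_real (cos x) = exp (\<i> * of_real x) + exp (- (\<i> * of_real x))"
      by (simp add: cos_exp_eq flip: cos_of_real)
    moreover have "2 * pi * (real N * \<beta>) = x" "2 * pi * (- real N * \<beta>) = - x" by (simp_all add: x_def)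
    ultimately have "p ^ N + q ^ N = 2 * complex_of_real (cos x) * exp (- of_real (2 * pi * real N) * z)"
      unfolding pn qn by (simp add: distrib_right)
    thus "p ^ Suc n / of_nat (Suc n) + q ^ Suc n / of_nat (Suc n) =
      2 * (complex_of_real (cos (2*pi*real (Suc n)*\<beta>) / real (Suc n)) * exp (- 2*complex_of_real pi* of_nat (Suc n)*z))"
      unfolding N_def[symmetric] x_def[symmetric] by (simp add: mult_ac flip: add_divide_distrib)
  qed
  finally have S: "(\<lambda>n. 2 * (complex_of_real (cos (2*pi*real (Suc n)*\<beta>) / real (Suc n)) * exp (- 2*complex_of_real pi* of_nat (Suc n)*z)))
      sums (- Ln (1 - p) + - Ln (1 - q))" .
  from sums_mult[OF S, of "1/2"] have "(\<lambda>n. complex_of_real (cos (2*pi*real (Suc n)*\<beta>) / real (Suc n)) * exp (- 2*complex_of_real pi* of_nat (Suc n)*z))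
      sums ((- Ln (1 - p) + - Ln (1 - q)) / 2)" by simp
  thus "2 * (\<Sum>n. complex_of_real (cos (2*pi*real (Suc n)*\<beta>) / real (Suc n))
                                  * exp (- 2*complex_of_real pi* of_nat (Suc n)*z)) = - Ln (1 - p) - Ln (1 - q)"
    by (simp only: sums_iff) simp
qed

theorem mainTheorem5:
  fixes l :: nat and \<alpha> :: "nat \<Rightarrow> real" and \<beta> :: real
  shows
  "(\<forall>z. Re z > 0 \<longrightarrow> zeta_regularizable (lattice (2*l+1))
        (\<lambda>m. complex_of_real (sqnorm_shift (2*l+1) m \<alpha>) + z\<^sup>2)) \<and>
   equiv_upto (2*l) (det_lap (2*l+1) \<alpha>)
     (\<lambda>z. exp (- complex_of_real ((-2*pi)^(l+1) / odd_dfact l) * z^(2*l+1)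
        - (\<Sum>\<^sub>\<infinity>n\<in>lattice (2*l+1) - {\<lambda>_. 0}.
             complex_of_real (1 / lnorm (2*l+1) n ^ (l+1)) *
             (\<Sum>k\<le>l. complex_of_real (cco l k / (2*pi*lnorm (2*l+1) n)^k) * z^(l-k))
             * exp (\<i> * complex_of_real (2*pi*ldot (2*l+1) n \<alpha>))
             * exp (- complex_of_real (2*pi*lnorm (2*l+1) n) * z)))) \<and>
   (\<forall>z. Re z > 0 \<longrightarrow>
      zeta_regularizable (UNIV :: int set) (\<lambda>m. complex_of_real ((real_of_int m + \<beta>)\<^sup>2) + z\<^sup>2) \<and>
      zeta_reg_prod (UNIV :: int set) (\<lambda>m. complex_of_real ((real_of_int m + \<beta>)\<^sup>2) + z\<^sup>2)
        = exp (2*complex_of_real pi*z - 2 * (\<Sum>n. complex_of_real (cos (2*pi*real (Suc n)*\<beta>) / real (Suc n))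
                                  * exp (- 2*complex_of_real pi* of_nat (Suc n)*z))) \<and>
      exp (2*complex_of_real pi*z - 2 * (\<Sum>n. complex_of_real (cos (2*pi*real (Suc n)*\<beta>) / real (Suc n))
                                  * exp (- 2*complex_of_real pi* of_nat (Suc n)*z)))
        = exp (2*complex_of_real pi*z) * (1 - exp (2*complex_of_real pi*\<i>*complex_of_real \<beta>) * exp (-2*complex_of_real pi*z))
                       * (1 - exp (-2*complex_of_real pi*\<i>*complex_of_real \<beta>) * exp (-2*complex_of_real pi*z)))"
proof (intro conjI)
  let ?\<nu> = "2 * l + 1"
  show "\<forall>z. Re z > 0 \<longrightarrow> zeta_regularizable (lattice ?\<nu>) (\<lambda>m. complex_of_real (sqnorm_shift ?\<nu> m \<alpha>) + z\<^sup>2)"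
    using zeta_regularizable_lattice[of _ ?\<nu> \<alpha>] by simp
next
  let ?\<nu> = "2 * l + 1"
  show "equiv_upto (2*l) (det_lap ?\<nu> \<alpha>)
     (\<lambda>z. exp (- complex_of_real ((-2*pi)^(l+1) / odd_dfact l) * z^?\<nu>
        - (\<Sum>\<^sub>\<infinity>n\<in>lattice ?\<nu> - {\<lambda>_. 0}.
             complex_of_real (1 / lnorm ?\<nu> n ^ (l+1)) *
             (\<Sum>k\<le>l. complex_of_real (cco l k / (2*pi*lnorm ?\<nu> n)^k) * z^(l-k))
             * exp (\<i> * complex_of_real (2*pi*ldot ?\<nu> n \<alpha>))
             * exp (- complex_of_real (2*pi*lnorm ?\<nu> n) * z))))"
    unfolding equiv_upto_def
    by (rule exI[of _ 0]) (use zeta_reg_prod_odd_lattice[of _ l \<alpha>] in \<open>simp add: det_lap_def\<close>)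
next
  show "\<forall>z. Re z > 0 \<longrightarrow>
      zeta_regularizable (UNIV :: int set) (\<lambda>m. complex_of_real ((real_of_int m + \<beta>)\<^sup>2) + z\<^sup>2) \<and>
      zeta_reg_prod (UNIV :: int set) (\<lambda>m. complex_of_real ((real_of_int m + \<beta>)\<^sup>2) + z\<^sup>2)
        = exp (2*complex_of_real pi*z - 2 * (\<Sum>n. complex_of_real (cos (2*pi*real (Suc n)*\<beta>) / real (Suc n))
                                  * exp (- 2*complex_of_real pi* of_nat (Suc n)*z))) \<and>
      exp (2*complex_of_real pi*z - 2 * (\<Sum>n. complex_of_real (cos (2*pi*real (Suc n)*\<beta>) / real (Suc n))
                                  * exp (- 2*complex_of_real pi* of_nat (Suc n)*z)))
        = exp (2*complex_of_real pi*z) * (1 - exp (2*complex_of_real pi*\<i>*complex_of_real \<beta>) * exp (-2*complex_of_real pi*z))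
                       * (1 - exp (-2*complex_of_real pi*\<i>*complex_of_real \<beta>) * exp (-2*complex_of_real pi*z))"
  proof (intro allI impI conjI)
    fix z :: complex assume z: "Re z > 0"
    let ?b = "\<lambda>m. complex_of_real (sqnorm_shift 1 m (\<lambda>_. \<beta>)) + z\<^sup>2"
    let ?a = "\<lambda>m::int. complex_of_real ((real_of_int m + \<beta>)\<^sup>2) + z\<^sup>2"
    let ?p = "exp (2*complex_of_real pi*\<i>*complex_of_real \<beta>) * exp (-2*complex_of_real pi*z)"
    let ?q = "exp (-2*complex_of_real pi*\<i>*complex_of_real \<beta>) * exp (-2*complex_of_real pi*z)"
    have a: "?b (\<lambda>j. if j = 0 then k else 0) = ?a k" for k by (simp add: sqnorm_shift_def)
    \<comment> \<open>Both regularizability and the product depend on the family only through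
      \<open>zeta_cont\<close>, apart from the condition on the values. Equality of these predicates
      even makes \<open>SOME\<close> choose the same continuation.\<close>
    have cont: "zeta_cont UNIV ?a = zeta_cont (lattice 1) ?b"
      unfolding fun_eq_iff zeta_cont_reindex[OF bij_betw_lattice_1] a by simp
    have "?a k \<notin> complex_of_real ` {..0}" for k
      using eigenvalue_not_nonpos[OF z, of 1 "\<lambda>j. if j = 0 then k else 0" "\<lambda>_. \<beta>"] unfolding a .
    thus "zeta_regularizable (UNIV :: int set) ?a"
      using zeta_regularizable_lattice[OF z odd_one, of "\<lambda>_. \<beta>"]
      unfolding zeta_regularizable_def cont by blast
    have "zeta_reg_prod (UNIV :: int set) ?a = zeta_reg_prod (lattice 1) ?b"
      unfolding zeta_reg_prod_def cont ..
    also have "\<dots> = exp (- complex_of_real (- 2 * pi) * z - (- Ln (1 - ?p) - Ln (1 - ?q)))"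
    proof -
      \<comment> \<open>For l = 0 the constant is (- 2 pi) / 1!! and the Bessel polynomial is 1, so
        the general formula becomes 2 pi z minus the two logarithmic series.\<close>
      have "odd_dfact 0 = 1" "(\<Sum>k\<le>0. f k) = f 0" for f :: "nat \<Rightarrow> complex" by (simp_all add: odd_dfact_def)
      thus ?thesis
        using zeta_reg_prod_odd_lattice[OF z, of 0 "\<lambda>_. \<beta>"]
        by (simp only: lattice_1_sum(1)[OF z] mult_0_right add_0 power_one_right cco_0 power_0 div_by_1
              of_real_1 mult_1_right diff_self_eq_0)
    qed
    also have "- complex_of_real (- 2 * pi) * z = 2*complex_of_real pi*z" by simp
    finally show "zeta_reg_prod (UNIV :: int set) ?a
        = exp (2*complex_of_real pi*z - 2 * (\<Sum>n. complex_of_real (cos (2*pi*real (Suc n)*\<beta>) / real (Suc n))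
                                  * exp (- 2*complex_of_real pi* of_nat (Suc n)*z)))"
      unfolding lattice_1_sum(2)[OF z] .
    \<comment> \<open>Exponentiating \<open>Ln (1 - p)\<close> and \<open>Ln (1 - q)\<close> returns
      their arguments because these are nonzero.\<close>
    have "?p \<noteq> 1" "?q \<noteq> 1" using lattice_1_sum(3,4)[OF z, of \<beta>] by (metis norm_one less_irrefl)+
    thus "exp (2*complex_of_real pi*z - 2 * (\<Sum>n. complex_of_real (cos (2*pi*real (Suc n)*\<beta>) / real (Suc n))
                                  * exp (- 2*complex_of_real pi* of_nat (Suc n)*z)))
        = exp (2*complex_of_real pi*z) * (1 - ?p) * (1 - ?q)"
      unfolding lattice_1_sum(2)[OF z] by (simp only: diff_conv_add_uminus minus_add_distrib minus_minus exp_add) (simp flip: diff_conv_add_uminus)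
  qed
qed


end
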